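(* Let $n\ge 3$, let $K\subset\mathbb{R}^n$ be a bounded convex domain, and let $\delta(x)=\operatorname{dist}(x,\partial K)$. Let $0<\beta<1$, $0<M<\infty$, $0<\lambda\le\Lambda<\infty$. Let $\mathcal{A}=(\mathcal{A}_{ij})$ be a measurable matrix-valued function on $K$ with $\mathcal{A}_{ij}(x)\eta_i\eta_j\ge\lambda|\eta|^2$ and $|\mathcal{A}_{ij}(x)\eta_i\psi_j|\le\Lambda|\eta||\psi|$ for all $\eta,\psi\in\mathbb{R}^n\setminus\{0\}$ and $x\in K$, and let $\mathcal{B}:K\to\mathbb{R}^n$ be measurable with $$|\mathcal{B}(x)|\,\delta(x)^{1-\beta}\le M\quad\text{for } x\in K.$$ Let $g,f_1,\dots,f_n\in L^2(K)$. Then: (1) There exists a weak solution $u\in W^{1,2}_0(K)$ of $L_1u=g+\partial_if_i$, where $L_1u=-\nabla\cdot(\mathcal{A}\nabla u)+\mathcal{B}\cdot\nabla u$. (2) If in addition $$-\frac{M^2}{\delta(x)^{2-2\beta}}\le\nabla\cdot\mathcal{B}(x)\le 0\quad\text{for } x\in K,$$ then there exists a weak solution $v\in W^{1,2}_0(K)$ of $L_1^Tv=g+\partial_if_i$, where $L_1^Tv=-\nabla\cdot(\mathcal{A}\nabla v+\mathcal{B}v)$.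
   Context: Repeated indices are summed from $1$ to $n$. $W^{1,2}_0(K)$ is the closure of the smooth compactly supported functions on $K$ in the $W^{1,2}(K)$ norm. Weak solutions are understood by testing against $\varphi\in C_c^\infty(K)$: $L_1u=g+\partial_if_i$ means $\int_K \mathcal{A}\nabla u\cdot\nabla\varphi+(\mathcal{B}\cdot\nabla u)\varphi=\int_K g\varphi-f_i\partial_i\varphi$, and $L_1^Tv=g+\partial_if_i$ means $\int_K\mathcal{A}\nabla v\cdot\nabla\varphi+v\,\mathcal{B}\cdot\nabla\varphi=\int_K g\varphi-f_i\partial_i\varphi$. The divergence $\nabla\cdot\mathcal{B}$ is understood in the weak (distributional) sense, as a function satisfying the stated pointwise bounds. *)

theory Defs
  imports "HOL-Analysis.Analysis"
begin

definition partial :: "'n::finite \<Rightarrow> (real^'n \<Rightarrow> real) \<Rightarrow> real^'n \<Rightarrow> real" where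
  "partial i f x = frechet_derivative f (at x) (axis i 1)"

definition grad :: "(real^'n \<Rightarrow> real) \<Rightarrow> real^'n::finite \<Rightarrow> real^'n" where
  "grad f x = (\<chi> i. partial i f x)"

primrec C_k :: "nat \<Rightarrow> (real^'n::finite \<Rightarrow> real) \<Rightarrow> bool" where
  "C_k 0 f \<longleftrightarrow> continuous_on UNIV f"
| "C_k (Suc k) f \<longleftrightarrow> (\<forall>x. f differentiable (at x)) \<and> (\<forall>i. C_k k (partial i f))"

text \<open>Smooth functions with compact support in an open set \<open>K\<close>, represented by their
  extension by zero to the whole space.\<close>
definition test_functions :: "(real^'n::finite) set \<Rightarrow> (real^'n \<Rightarrow> real) set" where
  "test_functions K = {\<phi>. (\<forall>k. C_k k \<phi>) \<and>
     compact (closure {x. \<phi> x \<noteq> 0}) \<and> closure {x. \<phi> x \<noteq> 0} \<subseteq> K}"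

text \<open>Only the values on \<open>K\<close> matter; functions are not identified up to null sets.\<close>
definition L2 :: "(real^'n::finite) set \<Rightarrow> (real^'n \<Rightarrow> 'b::euclidean_space) \<Rightarrow> bool" where
  "L2 K f \<longleftrightarrow> f \<in> borel_measurable (lebesgue_on K) \<and>
     integrable (lebesgue_on K) (\<lambda>x. (norm (f x))\<^sup>2)"

definition locally_integrable ::
    "(real^'n::finite) set \<Rightarrow> (real^'n \<Rightarrow> 'b::euclidean_space) \<Rightarrow> bool" where
  "locally_integrable K f \<longleftrightarrow> (\<forall>C. compact C \<and> C \<subseteq> K \<longrightarrow> f absolutely_integrable_on C)"

text \<open>\<open>u\<close> is a Sobolev function on \<open>K\<close> with weak gradient \<open>G\<close>. As \<open>G\<close> is unique only almost
  everywhere, the weak gradient is a relation rather than a function.\<close>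
definition has_W12_gradient ::
    "(real^'n::finite) set \<Rightarrow> (real^'n \<Rightarrow> real) \<Rightarrow> (real^'n \<Rightarrow> real^'n) \<Rightarrow> bool" where
  "has_W12_gradient K u G \<longleftrightarrow> L2 K u \<and> L2 K G \<and>
     (\<forall>\<phi>\<in>test_functions K. \<forall>i.
        (LINT x|lebesgue_on K. u x * partial i \<phi> x) = - (LINT x|lebesgue_on K. G x $ i * \<phi> x))"

definition W12 :: "(real^'n::finite) set \<Rightarrow> (real^'n \<Rightarrow> real) set" where
  "W12 K = {u. \<exists>G. has_W12_gradient K u G}"

text \<open>The \<open>W\<^sup>1\<^sup>,\<^sup>2(K)\<close> norm of \<open>u\<close>, where \<open>G\<close> is a weak gradient of \<open>u\<close>.\<close>
definition W12_norm ::
    "(real^'n::finite) set \<Rightarrow> (real^'n \<Rightarrow> real) \<Rightarrow> (real^'n \<Rightarrow> real^'n) \<Rightarrow> real" where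
  "W12_norm K u G = sqrt ((LINT x|lebesgue_on K. (u x)\<^sup>2) + (LINT x|lebesgue_on K. (norm (G x))\<^sup>2))"

definition W12_0 :: "(real^'n::finite) set \<Rightarrow> (real^'n \<Rightarrow> real) set" where
  "W12_0 K = {u \<in> W12 K. \<forall>\<epsilon>>0. \<exists>\<phi>\<in>test_functions K. \<exists>H.
     has_W12_gradient K (\<lambda>x. u x - \<phi> x) H \<and> W12_norm K (\<lambda>x. u x - \<phi> x) H < \<epsilon>}"

definition has_weak_divergence ::
    "(real^'n::finite) set \<Rightarrow> (real^'n \<Rightarrow> real^'n) \<Rightarrow> (real^'n \<Rightarrow> real) \<Rightarrow> bool" where
  "has_weak_divergence K B d \<longleftrightarrow> locally_integrable K B \<and> locally_integrable K d \<and>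
     (\<forall>\<phi>\<in>test_functions K.
        (LINT x|lebesgue_on K. B x \<bullet> grad \<phi> x) = - (LINT x|lebesgue_on K. d x * \<phi> x))"

text \<open>\<open>u \<in> W\<^sub>0\<^sup>1\<^sup>,\<^sup>2(K)\<close> solves \<open>-div (A grad u) + B \<bullet> grad u = g + (\<Sum>i. \<partial>\<^sub>i f\<^sub>i)\<close> weakly in \<open>K\<close>.\<close>
definition weak_solution_L1 ::
    "(real^'n::finite) set \<Rightarrow> (real^'n \<Rightarrow> real^'n^'n) \<Rightarrow> (real^'n \<Rightarrow> real^'n) \<Rightarrow>
     (real^'n \<Rightarrow> real) \<Rightarrow> ('n \<Rightarrow> real^'n \<Rightarrow> real) \<Rightarrow> (real^'n \<Rightarrow> real) \<Rightarrow> bool" where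
  "weak_solution_L1 K A B g f u \<longleftrightarrow> u \<in> W12_0 K \<and>
     (\<exists>Du. has_W12_gradient K u Du \<and>
       (\<forall>\<phi>\<in>test_functions K.
          (LINT x|lebesgue_on K. (A x *v Du x) \<bullet> grad \<phi> x + (B x \<bullet> Du x) * \<phi> x) =
          (LINT x|lebesgue_on K. g x * \<phi> x - (\<Sum>i\<in>UNIV. f i x * partial i \<phi> x))))"

text \<open>\<open>v \<in> W\<^sub>0\<^sup>1\<^sup>,\<^sup>2(K)\<close> solves \<open>-div (A grad v + v B) = g + (\<Sum>i. \<partial>\<^sub>i f\<^sub>i)\<close> weakly in \<open>K\<close>. The
  matrix is \<open>A\<close> itself, not its transpose.\<close>
definition weak_solution_L1T ::
    "(real^'n::finite) set \<Rightarrow> (real^'n \<Rightarrow> real^'n^'n) \<Rightarrow> (real^'n \<Rightarrow> real^'n) \<Rightarrow>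
     (real^'n \<Rightarrow> real) \<Rightarrow> ('n \<Rightarrow> real^'n \<Rightarrow> real) \<Rightarrow> (real^'n \<Rightarrow> real) \<Rightarrow> bool" where
  "weak_solution_L1T K A B g f v \<longleftrightarrow> v \<in> W12_0 K \<and>
     (\<exists>Dv. has_W12_gradient K v Dv \<and>
       (\<forall>\<phi>\<in>test_functions K.
          (LINT x|lebesgue_on K. (A x *v Dv x) \<bullet> grad \<phi> x + v x * (B x \<bullet> grad \<phi> x)) =
          (LINT x|lebesgue_on K. g x * \<phi> x - (\<Sum>i\<in>UNIV. f i x * partial i \<phi> x))))"

end

theory Submission imports Defs
begin

text \<open>Write the bilinear form as \<open>\<langle>U, S \<phi>\<rangle>\<close> in \<open>L\<^sup>2(K; \<real> \<times> \<real>\<^sup>n)\<close>, where \<open>U = (u, \<nabla>u)\<close> ranges over the closure of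
  the jets \<open>(\<psi>, \<nabla>\<psi>)\<close> of test functions. By the Riesz representation theorem a solution exists as soon
  as every test function \<open>v\<close> satisfies an a priori bound \<open>\<parallel>v\<parallel> \<le> C N\<close>, where \<open>N\<close> is the norm of the
  functional \<open>\<psi> \<mapsto> \<langle>(\<psi>, \<nabla>\<psi>), S v\<rangle>\<close>. In part (2) the sign of the divergence makes the form coercive and
  the bound is immediate.

  In part (1) the form is not coercive. Hardy's inequality for convex domains makes the drift a small
  perturbation up to a multiple of the \<open>L\<^sup>2\<close> norm, so that \<open>\<parallel>\<nabla>v\<parallel> \<le> C (N + \<parallel>v\<parallel>)\<close>. Testing with
  \<open>\<psi> = arctan (v / \<epsilon>) / \<epsilon>\<close> for \<open>\<epsilon> \<ge> N\<close> bounds the gradient of \<open>arsinh (v / \<epsilon>)\<close> by a constant; hence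
  \<open>\<bar>v\<bar>\<close> exceeds a large multiple of \<open>\<epsilon>\<close> only on a set of small measure, where the \<open>L\<^sup>2\<close> norm of \<open>v\<close> is
  controlled by a small multiple of \<open>\<parallel>\<nabla>v\<parallel>\<close>. Absorbing terms gives \<open>\<parallel>v\<parallel> \<le> C \<epsilon>\<close>. This replaces the
  Fredholm alternative and the maximum principle.\<close>

section \<open>Riesz representation and completeness in \<open>L\<^sup>2\<close>\<close>

text \<open>In part (1) the a priori bound concerns the adjoint problem: \<open>v\<close> is the
  second argument of the form, so the drift multiplies \<open>v\<close> itself and falls on the
  gradient of \<open>\<psi>\<close>. This is why the logarithmic test works: with
  \<open>grad \<psi> = grad v / (\<epsilon>\<^sup>2 + v\<^sup>2)\<close> the drift term becomes
  \<open>B \<bullet> grad w\<close> times a factor of modulus at most 1, whatever the size of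
  \<open>v\<close>. The obstacle is that \<open>B\<close> may blow up at the boundary and has
  neither a sign nor a small norm. Cutting at distance \<eta> from the boundary, \<open>B\<close> is
  bounded by \<eta> to the power \<beta> times a multiple of 1/\<delta> near the boundary, which
  Hardy absorbs for small \<eta>, and is bounded elsewhere; only the bounded part leaves an L2 term.
  \<open>arctan\<close> and \<open>arsinh\<close> take the place of truncations and logarithms
  because they keep test functions smooth or C1, so that every estimate concerns classical functions
  and no chain rule for Sobolev functions enters. In the same spirit the Hilbert space is
  represented by its Gram form on test functions, and limits appear only through explicit
  approximating sequences.\<close>

lemma gram_riesz:
  fixes Q :: "'i \<Rightarrow> 'i \<Rightarrow> real" and F :: "'i \<Rightarrow> real"
  assumes ne: "I \<noteq> {}"
    and sym: "\<And>i j. i \<in> I \<Longrightarrow> j \<in> I \<Longrightarrow> Q i j = Q j i"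
    and nonneg: "\<And>i. i \<in> I \<Longrightarrow> 0 \<le> Q i i"
    and comb: "\<And>i j c. i \<in> I \<Longrightarrow> j \<in> I \<Longrightarrow>
        \<exists>k\<in>I. F k = F i + c * F j \<and> (\<forall>l\<in>I. Q k l = Q i l + c * Q j l)"
    and bound: "\<And>i. i \<in> I \<Longrightarrow> (F i)\<^sup>2 \<le> C * Q i i"
  obtains s :: "nat \<Rightarrow> 'i" where "\<And>n. s n \<in> I"
    and "\<And>m n. Q (s m) (s m) - 2 * Q (s m) (s n) + Q (s n) (s n) \<le> 2 * (1 / real (Suc m) + 1 / real (Suc n))"
    and "\<And>i. i \<in> I \<Longrightarrow> (\<lambda>n. Q (s n) i) \<longlonglongrightarrow> F i"
proof -
  \<comment> \<open>Direct method: a representer of \<open>F\<close> would minimise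
    \<open>J\<close>. As \<open>I\<close> need not be complete, only a minimising sequence is
    produced; its limit is taken later in L2.\<close>
  define J where "J i = Q i i - 2 * F i" for i
  define C' where "C' = max C 0"
  have Jlow: "- C' \<le> J i" if "i \<in> I" for i
  proof -
    have "(F i)\<^sup>2 \<le> C' * Q i i"
      using bound[OF that] nonneg[OF that] unfolding C'_def
      by (meson max.cobounded1 mult_right_mono order_trans)
    \<comment> \<open>AM-GM: \<open>4 * C' * Q i i \<le> (Q i i + C')\<^sup>2\<close>.\<close>
    then have "(2 * F i)\<^sup>2 \<le> (Q i i + C')\<^sup>2"
      using zero_le_power2[of "Q i i - C'"] by (simp add: power2_eq_square algebra_simps)
    then have "\<bar>2 * F i\<bar> \<le> \<bar>Q i i + C'\<bar>" by (simp only: abs_le_square_iff)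
    moreover have "0 \<le> C'" by (simp add: C'_def)
    ultimately show ?thesis using nonneg[OF that] unfolding J_def by linarith
  qed
  then have bdd: "bdd_below (J ` I)" by (intro bdd_belowI2)
  define m where "m = Inf (J ` I)"
  have m_le: "m \<le> J i" if "i \<in> I" for i
    unfolding m_def using bdd that by (rule cINF_lower)
  have "\<exists>i\<in>I. J i < m + 1 / real (Suc n)" for n :: nat
  proof -
    have "Inf (J ` I) < m + 1 / real (Suc n)" unfolding m_def by simp
    then show ?thesis using cInf_less_iff[of "J ` I"] ne bdd by auto
  qed
  then obtain s where s: "\<And>n. s n \<in> I" "\<And>n::nat. J (s n) < m + 1 / real (Suc n)" by metis
  show ?thesis
  proof
    show "s n \<in> I" for n by fact
  next
    fix p n :: nat
    \<comment> \<open>\<open>comb\<close> only yields \<open>i + c * j\<close>, so the midpoint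
      \<open>k\<close> of \<open>s p\<close> and \<open>s n\<close> takes two steps:
      \<open>h\<close> is half of \<open>s p\<close>, then half of \<open>s n\<close> is added.
      Comparing \<open>J k \<ge> m\<close> with the values at \<open>s p\<close> and
      \<open>s n\<close> is the parallelogram argument.\<close>
    obtain h where h: "h \<in> I" "F h = F (s p) + (-1/2) * F (s p)"
      "\<And>l. l \<in> I \<Longrightarrow> Q h l = Q (s p) l + (-1/2) * Q (s p) l"
      using comb[OF s(1)[of p] s(1)[of p], of "-1/2"] by blast
    obtain k where k: "k \<in> I" "F k = F h + (1/2) * F (s n)"
      "\<And>l. l \<in> I \<Longrightarrow> Q k l = Q h l + (1/2) * Q (s n) l"
      using comb[OF h(1) s(1)[of n], of "1/2"] by blast
    have Qk: "Q k l = Q (s p) l / 2 + Q (s n) l / 2" if "l \<in> I" for l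
      using k(3)[OF that] h(3)[OF that] by simp
    have "Q k k = Q k (s p) / 2 + Q k (s n) / 2"
      using Qk[OF k(1)] sym[OF s(1) k(1)] by simp
    also have "\<dots> = (Q (s p) (s p) + 2 * Q (s p) (s n) + Q (s n) (s n)) / 4"
      using Qk[OF s(1)[of p]] Qk[OF s(1)[of n]] sym[OF s(1)[of n] s(1)[of p]] by (simp add: field_simps)
    finally have Jk: "J k = (Q (s p) (s p) + 2 * Q (s p) (s n) + Q (s n) (s n)) / 4 - F (s p) - F (s n)"
      unfolding J_def using k(2) h(2) by simp
    show "Q (s p) (s p) - 2 * Q (s p) (s n) + Q (s n) (s n) \<le> 2 * (1 / real (Suc p) + 1 / real (Suc n))"
    proof -
      have arith: "a - 2 * b + c \<le> 2 * (x + y)"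
        if "j = (a + 2 * b + c) / 4 - e - f" "m \<le> j" "a - 2 * e < m + x" "c - 2 * f < m + y"
        for a b c e f j x y :: real
        using that by (simp add: field_simps)
      show ?thesis
        by (rule arith[OF Jk m_le[OF k(1)]]) (use s(2)[of p] s(2)[of n] in \<open>simp_all add: J_def\<close>)
    qed
  next
    fix i assume i: "i \<in> I"
    define q where "q = Q i i"
    have q: "0 \<le> q" unfolding q_def by (rule nonneg[OF i])
    have est: "(Q (s n) i - F i)\<^sup>2 \<le> (q + 1) * (1 / real (Suc n))" for n
    proof -
      define d where "d = Q (s n) i - F i"
      \<comment> \<open>First variation of \<open>J\<close> in the direction \<open>i\<close>. The
        optimal step would be \<open>- d / q\<close>; the denominator \<open>q + 1\<close> also
        covers \<open>q = 0\<close>.\<close>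
      define t where "t = - d / (q + 1)"
      obtain k where k: "k \<in> I" "F k = F (s n) + t * F i"
        "\<And>l. l \<in> I \<Longrightarrow> Q k l = Q (s n) l + t * Q i l"
        using comb[OF s(1)[of n] i, of t] by blast
      have "Q k k = Q k (s n) + t * Q k i"
        using k(3)[OF k(1)] sym[OF s(1)[of n] k(1)] sym[OF i k(1)] by simp
      also have "\<dots> = Q (s n) (s n) + 2 * t * Q (s n) i + t * t * q"
        using k(3)[OF s(1)[of n]] k(3)[OF i] sym[OF i s(1)[of n]]
        by (simp add: q_def algebra_simps)
      finally have "J k = J (s n) + 2 * t * d + t * t * q"
        unfolding J_def d_def using k(2) by (simp add: algebra_simps)
      then have *: "- (1 / real (Suc n)) \<le> 2 * t * d + t * t * q"
        using m_le[OF k(1)] s(2)[of n] by linarith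
      have td: "d = - (t * (q + 1))" using q by (simp add: t_def)
      have "t * t * (q + 2) = - (2 * t * d + t * t * q)" unfolding td by (simp add: algebra_simps)
      then have "t * t * (q + 1) \<le> - (2 * t * d + t * t * q)"
        using zero_le_square[of t] by (simp add: distrib_left del: zero_le_square)
      then have "t * t * (q + 1) \<le> 1 / real (Suc n)"
        using * by linarith
      then have "(q + 1) * (t * t * (q + 1)) \<le> (q + 1) * (1 / real (Suc n))"
        using q by (intro mult_left_mono) auto
      moreover have "d\<^sup>2 = (q + 1) * (t * t * (q + 1))" unfolding td by (simp add: power2_eq_square)
      ultimately show ?thesis unfolding d_def by simp
    qed
    have "(\<lambda>n. (q + 1) * (1 / real (Suc n))) \<longlonglongrightarrow> (q + 1) * 0"
      by (intro tendsto_mult_left LIMSEQ_Suc[OF lim_1_over_n])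
    then have lim0: "(\<lambda>n. (q + 1) * (1 / real (Suc n))) \<longlonglongrightarrow> 0" by simp
    have "(\<lambda>n. (Q (s n) i - F i)\<^sup>2) \<longlonglongrightarrow> 0"
      by (rule Lim_null_comparison[OF always_eventually lim0]) (use est in simp)
    from tendsto_real_sqrt[OF this] have "(\<lambda>n. \<bar>Q (s n) i - F i\<bar>) \<longlonglongrightarrow> 0" by simp
    then have "(\<lambda>n. Q (s n) i - F i) \<longlonglongrightarrow> 0" by (rule tendsto_rabs_zero_cancel)
    then show "(\<lambda>n. Q (s n) i) \<longlonglongrightarrow> F i" by (rule LIM_zero_cancel)
  qed
qed

text \<open>The content of \<open>L2\<close>, but over an arbitrary measure, so that the abstract
  existence argument can run on pairs of a function and a vector field. Functions are not identified
  almost everywhere, hence \<open>l2_inner\<close> is only positive semidefinite, which is all that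
  \<open>gram_riesz\<close> asks of its form.\<close>

definition square_integrable :: "'a measure \<Rightarrow> ('a \<Rightarrow> 'b::euclidean_space) \<Rightarrow> bool" where
  "square_integrable M f \<longleftrightarrow> f \<in> borel_measurable M \<and> integrable M (\<lambda>x. (norm (f x))\<^sup>2)"

definition l2_inner :: "'a measure \<Rightarrow> ('a \<Rightarrow> 'b::euclidean_space) \<Rightarrow> ('a \<Rightarrow> 'b) \<Rightarrow> real" where
  "l2_inner M f g = (LINT x|M. f x \<bullet> g x)"

section \<open>Algebra and Cauchy-Schwarz for square-integrable fields\<close>

lemma square_integrable_measurable [measurable_dest]:
  "square_integrable M f \<Longrightarrow> f \<in> borel_measurable M"
  by (simp add: square_integrable_def)

lemma square_integrable_inner:
  assumes "square_integrable M f" "square_integrable M g"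
  shows "integrable M (\<lambda>x. f x \<bullet> g x)"
proof (rule Bochner_Integration.integrable_bound)
  show "integrable M (\<lambda>x. (norm (f x))\<^sup>2 + (norm (g x))\<^sup>2)"
    using assms by (auto simp: square_integrable_def)
  show "(\<lambda>x. f x \<bullet> g x) \<in> borel_measurable M"
    using assms[THEN square_integrable_measurable] by measurable
  have "\<bar>f x \<bullet> g x\<bar> \<le> (norm (f x))\<^sup>2 + (norm (g x))\<^sup>2" for x
  proof -
    have "\<bar>f x \<bullet> g x\<bar> \<le> norm (f x) * norm (g x)" by (rule Cauchy_Schwarz_ineq2)
    also have "\<dots> \<le> (norm (f x))\<^sup>2 + (norm (g x))\<^sup>2"
      using sum_squares_bound[of "norm (f x)" "norm (g x)"] mult_nonneg_nonneg[OF norm_ge_zero norm_ge_zero, of "f x" "g x"]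
      by linarith
    finally show ?thesis .
  qed
  then show "AE x in M. norm (f x \<bullet> g x) \<le> norm ((norm (f x))\<^sup>2 + (norm (g x))\<^sup>2)" by simp
qed

lemma square_integrable_add:
  assumes "square_integrable M f" "square_integrable M g"
  shows "square_integrable M (\<lambda>x. f x + g x)"
  unfolding square_integrable_def
proof
  show "(\<lambda>x. f x + g x) \<in> borel_measurable M"
    using assms[THEN square_integrable_measurable] by measurable
  have "(norm (f x + g x))\<^sup>2 = (norm (f x))\<^sup>2 + (norm (g x))\<^sup>2 + 2 * (f x \<bullet> g x)" for x
    by (simp add: power2_norm_eq_inner inner_simps inner_commute)
  then show "integrable M (\<lambda>x. (norm (f x + g x))\<^sup>2)"
    using assms square_integrable_inner[OF assms] by (simp add: square_integrable_def)
qed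

lemma square_integrable_scaleR:
  "square_integrable M f \<Longrightarrow> square_integrable M (\<lambda>x. c *\<^sub>R f x)"
  by (auto simp: square_integrable_def power_mult_distrib)

lemma square_integrable_diff:
  assumes "square_integrable M f" "square_integrable M g"
  shows "square_integrable M (\<lambda>x. f x - g x)"
  using square_integrable_add[OF assms(1) square_integrable_scaleR[OF assms(2), of "-1"]] by simp

lemma l2_inner_commute: "l2_inner M f g = l2_inner M g f"
  by (simp add: l2_inner_def inner_commute)

lemma l2_inner_self: "l2_inner M f f = (LINT x|M. (norm (f x))\<^sup>2)"
  by (simp add: l2_inner_def power2_norm_eq_inner)

lemma l2_inner_nonneg: "0 \<le> l2_inner M f f"
  by (simp add: l2_inner_def)

lemma l2_inner_comb_left:
  assumes "square_integrable M f" "square_integrable M g" "square_integrable M h"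
    and "\<And>x. x \<in> space M \<Longrightarrow> k x = f x + c *\<^sub>R g x"
  shows "l2_inner M k h = l2_inner M f h + c * l2_inner M g h"
proof -
  have "l2_inner M k h = (LINT x|M. f x \<bullet> h x + c * (g x \<bullet> h x))"
    unfolding l2_inner_def using assms(4)
    by (intro Bochner_Integration.integral_cong) (auto simp: inner_simps)
  then show ?thesis unfolding l2_inner_def
    using square_integrable_inner[OF assms(1,3)] square_integrable_inner[OF assms(2,3)] by simp
qed

lemma l2_inner_diff_left:
  assumes "square_integrable M f" "square_integrable M g" "square_integrable M h"
  shows "l2_inner M (\<lambda>x. f x - g x) h = l2_inner M f h - l2_inner M g h"
  using l2_inner_comb_left[OF assms, of _ "-1"] by simp

lemma l2_inner_diff_self:
  assumes "square_integrable M f" "square_integrable M g"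
  shows "(LINT x|M. (norm (f x - g x))\<^sup>2) = l2_inner M f f - 2 * l2_inner M f g + l2_inner M g g"
proof -
  note d = square_integrable_diff[OF assms]
  have "(LINT x|M. (norm (f x - g x))\<^sup>2) = l2_inner M f (\<lambda>x. f x - g x) - l2_inner M g (\<lambda>x. f x - g x)"
    by (simp only: l2_inner_self[symmetric] l2_inner_diff_left[OF assms d])
  also have "\<dots> = l2_inner M (\<lambda>x. f x - g x) f - l2_inner M (\<lambda>x. f x - g x) g"
    by (simp only: l2_inner_commute[of M f "\<lambda>x. f x - g x"] l2_inner_commute[of M g "\<lambda>x. f x - g x"])
  finally show ?thesis
    by (simp add: l2_inner_diff_left[OF assms(1,2)] assms l2_inner_commute[of M g f])
qed

lemma l2_Cauchy_Schwarz:
  assumes "square_integrable M f" "square_integrable M g"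
  shows "(l2_inner M f g)\<^sup>2 \<le> l2_inner M f f * l2_inner M g g"
proof -
  define a b c where "a = l2_inner M f f" and "b = l2_inner M f g" and "c = l2_inner M g g"
  have quad: "0 \<le> a + 2 * t * b + t\<^sup>2 * c" for t
  proof -
    note tg = square_integrable_scaleR[OF assms(2), of "-t"]
    have "l2_inner M f (\<lambda>x. (- t) *\<^sub>R g x) = - t * b"
      "l2_inner M (\<lambda>x. (- t) *\<^sub>R g x) (\<lambda>x. (- t) *\<^sub>R g x) = t\<^sup>2 * c"
      by (simp_all add: l2_inner_def b_def c_def power2_eq_square mult.assoc)
    then have "(LINT x|M. (norm (f x - (- t) *\<^sub>R g x))\<^sup>2) = a + 2 * t * b + t\<^sup>2 * c"
      unfolding l2_inner_diff_self[OF assms(1) tg] a_def by simp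
    moreover have "0 \<le> (LINT x|M. (norm (f x - (- t) *\<^sub>R g x))\<^sup>2)"
      by (rule Bochner_Integration.integral_nonneg) simp
    ultimately show ?thesis by linarith
  qed
  have c: "0 \<le> c" and a: "0 \<le> a" by (auto simp: a_def c_def l2_inner_nonneg)
  have "b\<^sup>2 \<le> a * c"
  proof (cases "c = 0")
    case True
    have "b = 0"
    proof (rule ccontr)
      assume b: "b \<noteq> 0"
      \<comment> \<open>Without its leading term the quadratic is affine in \<open>t\<close>; a
        nonzero slope would let it reach \<open>- 1\<close>.\<close>
      have "a + 2 * (- (a + 1) / (2 * b)) * b = - 1" using b by (simp add: field_simps)
      then show False using quad[of "- (a + 1) / (2 * b)"] True by simp
    qed
    then show ?thesis using True by simp
  next
    case False
    have "a + 2 * (- b / c) * b + (- b / c)\<^sup>2 * c = a - b\<^sup>2 / c"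
      using False by (simp add: power2_eq_square)
    then have "b\<^sup>2 / c \<le> a" using quad[of "- b / c"] by simp
    then show ?thesis using c False by (simp add: pos_divide_le_eq)
  qed
  then show ?thesis by (simp add: a_def b_def c_def)
qed

lemma l2_Cauchy_Schwarz_sqrt:
  assumes "square_integrable M f" "square_integrable M g"
  shows "\<bar>l2_inner M f g\<bar> \<le> sqrt (l2_inner M f f) * sqrt (l2_inner M g g)"
  using real_sqrt_le_mono[OF l2_Cauchy_Schwarz[OF assms]] by (simp add: real_sqrt_mult)

lemma l2_limit_inner:
  assumes "\<And>n. square_integrable M (f n)" "square_integrable M u" "square_integrable M g"
    and "(\<lambda>n. LINT x|M. (norm (f n x - u x))\<^sup>2) \<longlonglongrightarrow> 0"
  shows "(\<lambda>n. l2_inner M (f n) g) \<longlonglongrightarrow> l2_inner M u g"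
proof -
  have "(\<lambda>n. sqrt (LINT x|M. (norm (f n x - u x))\<^sup>2) * sqrt (l2_inner M g g)) \<longlonglongrightarrow> sqrt 0 * sqrt (l2_inner M g g)"
    by (intro tendsto_intros assms)
  then have *: "(\<lambda>n. sqrt (LINT x|M. (norm (f n x - u x))\<^sup>2) * sqrt (l2_inner M g g)) \<longlonglongrightarrow> 0" by simp
  have "norm (l2_inner M (f n) g - l2_inner M u g) \<le> sqrt (LINT x|M. (norm (f n x - u x))\<^sup>2) * sqrt (l2_inner M g g)" for n
    using l2_Cauchy_Schwarz_sqrt[OF square_integrable_diff[OF assms(1)[of n] assms(2)] assms(3)]
    by (simp add: l2_inner_diff_left assms l2_inner_self)
  then have "(\<lambda>n. l2_inner M (f n) g - l2_inner M u g) \<longlonglongrightarrow> 0"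
    by (intro Lim_null_comparison[OF always_eventually *]) auto
  then show ?thesis by (rule LIM_zero_cancel)
qed

lemma l2_complete:
  fixes f :: "nat \<Rightarrow> 'a \<Rightarrow> 'b::euclidean_space"
  assumes f: "\<And>n. square_integrable M (f n)"
    and Cauchy: "\<And>e. 0 < e \<Longrightarrow> \<exists>N. \<forall>m\<ge>N. \<forall>n\<ge>N. (LINT x|M. (norm (f m x - f n x))\<^sup>2) < e"
  obtains u where "square_integrable M u"
    and "(\<lambda>n. LINT x|M. (norm (f n x - u x))\<^sup>2) \<longlonglongrightarrow> 0"
proof -
  note [measurable] = f[THEN square_integrable_measurable]
  have int: "integrable M (\<lambda>x. (norm (f m x - f n x))\<^sup>2)" for m n
    using square_integrable_diff[OF f f] by (simp add: square_integrable_def)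
  have nn: "(\<integral>\<^sup>+x. ennreal ((norm (f m x - f n x))\<^sup>2) \<partial>M) = ennreal (LINT x|M. (norm (f m x - f n x))\<^sup>2)" for m n
    by (intro nn_integral_eq_integral int) auto
  have "\<exists>N. \<forall>m\<ge>N. \<forall>n\<ge>N. (LINT x|M. (norm (f m x - f n x))\<^sup>2) < (1/4)^k" for k
    by (rule Cauchy) simp
  then obtain N0 where N0: "\<And>k m n. m \<ge> N0 k \<Longrightarrow> n \<ge> N0 k \<Longrightarrow> (LINT x|M. (norm (f m x - f n x))\<^sup>2) < (1/4)^k"
    by metis
  \<comment> \<open>Summing the thresholds makes \<open>r\<close> nondecreasing while it stays above
    both \<open>N0 k\<close> and \<open>k\<close>, so consecutive members of the subsequence have
    squared distance below \<open>(1/4)^k\<close>.\<close>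
  define r where "r k = (\<Sum>i\<le>k. N0 i) + k" for k
  have r_ge: "N0 k \<le> r k" "k \<le> r k" for k
    using member_le_sum[of k "{..k}" N0] unfolding r_def by auto
  have r_Suc: "r k \<le> r (Suc k)" for k unfolding r_def by simp
  \<comment> \<open>The weight \<open>2^k\<close> is split evenly: the integrals of
    \<open>2^k * (a k x)\<^sup>2\<close> are still summable, and
    \<open>2 * a k x \<le> (1/2)^k + 2^k * (a k x)\<^sup>2\<close> turns finiteness of the weighted
    series into absolute convergence of the increments at almost every point.\<close>
  define a where "a k x = norm (f (r (Suc k)) x - f (r k) x)" for k x
  have [measurable]: "a k \<in> borel_measurable M" for k unfolding a_def by measurable
  have a_int: "(\<integral>\<^sup>+x. ennreal ((a k x)\<^sup>2) \<partial>M) \<le> ennreal ((1/4)^k)" for k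
    unfolding a_def nn using N0[of k "r (Suc k)" "r k"] r_ge(1)[of k] r_Suc[of k]
    by (intro ennreal_leI) auto
  have "(\<integral>\<^sup>+x. (\<Sum>k. ennreal (2^k * (a k x)\<^sup>2)) \<partial>M) = (\<Sum>k. \<integral>\<^sup>+x. ennreal (2^k * (a k x)\<^sup>2) \<partial>M)"
    by (intro nn_integral_suminf) measurable
  also have "\<dots> \<le> (\<Sum>k. ennreal ((1/2)^k))"
  proof (intro suminf_le summableI)
    fix k
    have "(\<integral>\<^sup>+x. ennreal (2^k * (a k x)\<^sup>2) \<partial>M) = ennreal (2^k) * (\<integral>\<^sup>+x. ennreal ((a k x)\<^sup>2) \<partial>M)"
      by (subst nn_integral_cmult[symmetric]) (simp_all add: ennreal_mult)
    also have "\<dots> \<le> ennreal (2^k) * ennreal ((1/4)^k)" by (intro mult_left_mono a_int) auto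
    also have "\<dots> = ennreal (2^k * (1/4)^k)" by (simp add: ennreal_mult)
    also have "(2::real)^k * (1/4)^k = (1/2)^k" by (subst power_mult_distrib[symmetric]) simp
    finally show "(\<integral>\<^sup>+x. ennreal (2^k * (a k x)\<^sup>2) \<partial>M) \<le> ennreal ((1/2)^k)" .
  qed
  also have "\<dots> = ennreal (\<Sum>k. (1/2)^k)" by (intro suminf_ennreal2) (simp_all add: summable_geometric)
  finally have "(\<integral>\<^sup>+x. (\<Sum>k. ennreal (2^k * (a k x)\<^sup>2)) \<partial>M) < \<infinity>"
    by (rule le_less_trans) simp
  then have "AE x in M. (\<Sum>k. ennreal (2^k * (a k x)\<^sup>2)) \<noteq> \<infinity>"
    by (intro nn_integral_PInf_AE) auto
  then have conv: "AE x in M. convergent (\<lambda>k. f (r k) x)"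
  proof eventually_elim
    case (elim x)
    have "summable (\<lambda>k. 2^k * (a k x)\<^sup>2)"
      by (rule summable_suminf_not_top) (use elim in auto)
    then have "summable (\<lambda>k. (1/2)^k + 2^k * (a k x)\<^sup>2)"
      by (intro summable_add summable_geometric) auto
    then have "summable (\<lambda>k. f (r (Suc k)) x - f (r k) x)"
    proof (rule summable_comparison_test'[where N=0])
      fix k
      have p: "(1/2)^k * 2^k = (1::real)" by (simp flip: power_mult_distrib)
      have "0 \<le> 2^k * ((1/2)^k - a k x)\<^sup>2" by simp
      also have "\<dots> = ((1/2)^k * 2^k) * (1/2)^k + 2^k * (a k x)\<^sup>2 - 2 * ((1/2)^k * 2^k) * a k x"
        by (simp only: power2_eq_square) (simp only: algebra_simps)
      finally have "2 * a k x \<le> (1/2)^k + 2^k * (a k x)\<^sup>2" unfolding p by simp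
      moreover have "0 \<le> a k x" unfolding a_def by simp
      ultimately show "norm (f (r (Suc k)) x - f (r k) x) \<le> (1/2)^k + 2^k * (a k x)\<^sup>2"
        unfolding a_def by linarith
    qed
    then have "convergent (\<lambda>n. f (r n) x - f (r 0) x)"
      unfolding summable_iff_convergent sum_lessThan_telescope[of "\<lambda>k. f (r k) x"] .
    then show ?case unfolding convergent_diff_const_right_iff .
  qed
  define u where "u x = lim (\<lambda>k. f (r k) x)" for x
  have u_meas [measurable]: "u \<in> borel_measurable M" unfolding u_def by measurable
  \<comment> \<open>Fatou along the subsequence: a bound on the distance of \<open>f n\<close> from
    all later members passes to its distance from the pointwise limit.\<close>
  have fatou: "(\<integral>\<^sup>+x. ennreal ((norm (f n x - u x))\<^sup>2) \<partial>M) \<le> ennreal e"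
    if "\<And>m. m \<ge> n \<Longrightarrow> (LINT x|M. (norm (f n x - f m x))\<^sup>2) \<le> e" for n e
  proof -
    have "(\<integral>\<^sup>+x. ennreal ((norm (f n x - u x))\<^sup>2) \<partial>M) = (\<integral>\<^sup>+x. liminf (\<lambda>k. ennreal ((norm (f n x - f (r k) x))\<^sup>2)) \<partial>M)"
    proof (intro nn_integral_cong_AE)
      show "AE x in M. ennreal ((norm (f n x - u x))\<^sup>2) = liminf (\<lambda>k. ennreal ((norm (f n x - f (r k) x))\<^sup>2))"
        using conv
      proof eventually_elim
        case (elim x)
        then have "(\<lambda>k. f (r k) x) \<longlonglongrightarrow> u x" unfolding u_def by (simp add: convergent_LIMSEQ_iff)
        then have "(\<lambda>k. ennreal ((norm (f n x - f (r k) x))\<^sup>2)) \<longlonglongrightarrow> ennreal ((norm (f n x - u x))\<^sup>2)"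
          by (intro tendsto_intros)
        then show ?case by (rule lim_imp_Liminf[OF trivial_limit_sequentially, symmetric])
      qed
    qed
    also have "\<dots> \<le> liminf (\<lambda>k. \<integral>\<^sup>+x. ennreal ((norm (f n x - f (r k) x))\<^sup>2) \<partial>M)"
      by (intro nn_integral_liminf) measurable
    also have "\<dots> \<le> limsup (\<lambda>k. \<integral>\<^sup>+x. ennreal ((norm (f n x - f (r k) x))\<^sup>2) \<partial>M)"
      by (intro Liminf_le_Limsup) auto
    also have "\<dots> \<le> ennreal e"
    proof (rule Limsup_bounded)
      show "\<forall>\<^sub>F k in sequentially. (\<integral>\<^sup>+x. ennreal ((norm (f n x - f (r k) x))\<^sup>2) \<partial>M) \<le> ennreal e"
        using eventually_ge_at_top[of n]
      proof eventually_elim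
        case (elim k)
        then show ?case unfolding nn using r_ge(2)[of k] by (intro ennreal_leI that) auto
      qed
    qed
    finally show ?thesis .
  qed
  have ex: "\<exists>N. \<forall>n\<ge>N. (\<integral>\<^sup>+x. ennreal ((norm (f n x - u x))\<^sup>2) \<partial>M) \<le> ennreal e" if e: "0 < e" for e
  proof -
    obtain N where "\<forall>m\<ge>N. \<forall>n\<ge>N. (LINT x|M. (norm (f m x - f n x))\<^sup>2) < e" using Cauchy[OF e] by blast
    then have "(\<integral>\<^sup>+x. ennreal ((norm (f n x - u x))\<^sup>2) \<partial>M) \<le> ennreal e" if "n \<ge> N" for n
      by (intro fatou less_imp_le) (use that in simp)
    then show ?thesis by blast
  qed
  obtain N where N: "(\<integral>\<^sup>+x. ennreal ((norm (f N x - u x))\<^sup>2) \<partial>M) \<le> ennreal 1"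
    using ex[of 1] by auto
  have "square_integrable M (\<lambda>x. f N x - u x)"
    unfolding square_integrable_def
  proof
    show "integrable M (\<lambda>x. (norm (f N x - u x))\<^sup>2)"
      by (rule integrableI_bounded) (use N in \<open>auto intro: le_less_trans\<close>)
  qed measurable
  then have u: "square_integrable M u"
    using square_integrable_diff[OF f[of N], of "\<lambda>x. f N x - u x"] by simp
  have int_u: "integrable M (\<lambda>x. (norm (f n x - u x))\<^sup>2)" for n
    using square_integrable_diff[OF f u] by (simp add: square_integrable_def)
  show ?thesis
  proof
    show "square_integrable M u" by fact
    show "(\<lambda>n. LINT x|M. (norm (f n x - u x))\<^sup>2) \<longlonglongrightarrow> 0"
    proof (rule LIMSEQ_I)
      fix e :: real assume e: "0 < e"
      obtain N where N: "\<And>n. n \<ge> N \<Longrightarrow> (\<integral>\<^sup>+x. ennreal ((norm (f n x - u x))\<^sup>2) \<partial>M) \<le> ennreal (e/2)"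
        using ex[of "e/2"] e by auto
      have "(LINT x|M. (norm (f n x - u x))\<^sup>2) \<le> e/2" if "n \<ge> N" for n
        using N[OF that] e by (subst (asm) nn_integral_eq_integral[OF int_u]) auto
      then show "\<exists>N. \<forall>n\<ge>N. norm ((LINT x|M. (norm (f n x - u x))\<^sup>2) - 0) < e"
        using e by (intro exI[of _ N]) (force simp: Bochner_Integration.integral_nonneg)
    qed
  qed
qed

text \<open>The minimising sequence of \<open>gram_riesz\<close> is Cauchy in L2, and completeness
  turns it into the representer. The sequence \<open>s\<close> is returned too, because it certifies
  that \<open>u\<close> lies in the closure of the range of \<open>j\<close>.\<close>

lemma l2_riesz:
  fixes j :: "'i \<Rightarrow> 'a \<Rightarrow> 'b::euclidean_space" and F :: "'i \<Rightarrow> real"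
  assumes "I \<noteq> {}" and j: "\<And>i. i \<in> I \<Longrightarrow> square_integrable M (j i)"
    and "\<And>i i' c. i \<in> I \<Longrightarrow> i' \<in> I \<Longrightarrow> \<exists>k\<in>I. F k = F i + c * F i' \<and>
        (\<forall>l\<in>I. l2_inner M (j k) (j l) = l2_inner M (j i) (j l) + c * l2_inner M (j i') (j l))"
    and "\<And>i. i \<in> I \<Longrightarrow> (F i)\<^sup>2 \<le> C * l2_inner M (j i) (j i)"
  obtains u s where "square_integrable M u" and "\<And>n. s n \<in> I"
    and "(\<lambda>n. LINT x|M. (norm (j (s n) x - u x))\<^sup>2) \<longlonglongrightarrow> 0"
    and "\<And>i. i \<in> I \<Longrightarrow> l2_inner M u (j i) = F i"
proof -
  obtain s :: "nat \<Rightarrow> 'i" where s: "\<And>n. s n \<in> I"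
    and C: "\<And>m n. l2_inner M (j (s m)) (j (s m)) - 2 * l2_inner M (j (s m)) (j (s n)) + l2_inner M (j (s n)) (j (s n))
        \<le> 2 * (1 / real (Suc m) + 1 / real (Suc n))"
    and lim: "\<And>i. i \<in> I \<Longrightarrow> (\<lambda>n. l2_inner M (j (s n)) (j i)) \<longlonglongrightarrow> F i"
  proof (rule gram_riesz[of I "\<lambda>i k. l2_inner M (j i) (j k)" F C])
    show "l2_inner M (j i) (j k) = l2_inner M (j k) (j i)" for i k by (rule l2_inner_commute)
  qed (rule assms l2_inner_nonneg that | assumption)+
  obtain u where u: "square_integrable M u" "(\<lambda>n. LINT x|M. (norm (j (s n) x - u x))\<^sup>2) \<longlonglongrightarrow> 0"
  proof (rule l2_complete[of M "\<lambda>n. j (s n)"])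
    show "square_integrable M (j (s n))" for n by (rule j[OF s])
    fix e :: real assume "0 < e"
    then obtain N :: nat where N: "1 / real (Suc N) < e / 4"
      using nat_approx_posE[of "e/4"] by auto
    show "\<exists>N. \<forall>m\<ge>N. \<forall>n\<ge>N. (LINT x|M. (norm (j (s m) x - j (s n) x))\<^sup>2) < e"
    proof (intro exI[of _ N] allI impI)
      fix m n assume mn: "N \<le> m" "N \<le> n"
      have "1 / real (Suc m) \<le> 1 / real (Suc N)" "1 / real (Suc n) \<le> 1 / real (Suc N)" using mn by (auto simp: frac_le)
      then have "2 * (1 / real (Suc m) + 1 / real (Suc n)) \<le> 4 * (1 / real (Suc N))" by (simp only: distrib_left)
      also have "\<dots> < e" using N by simp
      finally show "(LINT x|M. (norm (j (s m) x - j (s n) x))\<^sup>2) < e"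
        unfolding l2_inner_diff_self[OF j[OF s] j[OF s]] by (rule le_less_trans[OF C])
    qed
  qed blast
  show ?thesis
  proof (rule that[OF u(1) s u(2)])
    fix i assume "i \<in> I"
    then show "l2_inner M u (j i) = F i"
      using LIMSEQ_unique[OF l2_limit_inner[OF j[OF s] u(1) j u(2)] lim] by blast
  qed
qed

text \<open>The operator \<open>S\<close> plays the role of the adjoint: surjectivity of \<open>U \<mapsto> \<langle>U, S \<cdot>\<rangle>\<close> on the closure
  of the range of \<open>j\<close> follows from an a priori bound for the orthogonal projection \<open>P\<close> of \<open>S\<close>.\<close>
lemma l2_inf_sup:
  fixes j S :: "'i \<Rightarrow> 'a \<Rightarrow> 'b::euclidean_space" and F :: "'i \<Rightarrow> real"
  assumes ne: "I \<noteq> {}" and j: "\<And>i. i \<in> I \<Longrightarrow> square_integrable M (j i)"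
    and S: "\<And>i. i \<in> I \<Longrightarrow> square_integrable M (S i)"
    and comb: "\<And>i i' c. i \<in> I \<Longrightarrow> i' \<in> I \<Longrightarrow> \<exists>k\<in>I. F k = F i + c * F i' \<and>
        (\<forall>x\<in>space M. j k x = j i x + c *\<^sub>R j i' x \<and> S k x = S i x + c *\<^sub>R S i' x)"
    and bound: "\<And>i N. i \<in> I \<Longrightarrow> 0 \<le> N \<Longrightarrow>
        (\<And>k. k \<in> I \<Longrightarrow> l2_inner M (j k) (S i) \<le> N * sqrt (l2_inner M (j k) (j k))) \<Longrightarrow> \<bar>F i\<bar> \<le> C * N"
  obtains u s where "square_integrable M u" and "\<And>n. s n \<in> I"
    and "(\<lambda>n. LINT x|M. (norm (j (s n) x - u x))\<^sup>2) \<longlonglongrightarrow> 0"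
    and "\<And>i. i \<in> I \<Longrightarrow> l2_inner M u (S i) = F i"
proof -
  \<comment> \<open>Two properties characterise the projection: the sequence places \<open>p\<close>
    in the closure of the range of \<open>j\<close>, and the last clause makes
    \<open>S i - p\<close> orthogonal to that range. It exists by Riesz for the functional that
    pairs \<open>S i\<close> with \<open>j k\<close>.\<close>
  define is_proj where "is_proj i p \<longleftrightarrow> square_integrable M p \<and>
      (\<exists>s. (\<forall>n. s n \<in> I) \<and> (\<lambda>n. LINT x|M. (norm (j (s n) x - p x))\<^sup>2) \<longlonglongrightarrow> 0) \<and>
      (\<forall>k\<in>I. l2_inner M p (j k) = l2_inner M (S i) (j k))" for i p
  have "\<exists>p. is_proj i p" if i: "i \<in> I" for i
  proof (rule l2_riesz[of I M j "\<lambda>k. l2_inner M (S i) (j k)" "l2_inner M (S i) (S i)"])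
    fix k k' c assume k: "k \<in> I" "k' \<in> I"
    obtain m where m: "m \<in> I" "\<forall>x\<in>space M. j m x = j k x + c *\<^sub>R j k' x" using comb[OF k] by blast
    then have "l2_inner M (j m) h = l2_inner M (j k) h + c * l2_inner M (j k') h" if "square_integrable M h" for h
      using that k by (intro l2_inner_comb_left j) auto
    then show "\<exists>m\<in>I. l2_inner M (S i) (j m) = l2_inner M (S i) (j k) + c * l2_inner M (S i) (j k') \<and>
        (\<forall>l\<in>I. l2_inner M (j m) (j l) = l2_inner M (j k) (j l) + c * l2_inner M (j k') (j l))"
      using m(1) j S[OF i] by (auto simp: l2_inner_commute[of M "S i"])
  next
    show "(l2_inner M (S i) (j k))\<^sup>2 \<le> l2_inner M (S i) (S i) * l2_inner M (j k) (j k)" if "k \<in> I" for k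
      by (intro l2_Cauchy_Schwarz S[OF i] j[OF that])
    show "I \<noteq> {}" by (rule ne)
    show "square_integrable M (j k)" if "k \<in> I" for k by (rule j[OF that])
    fix p s assume "square_integrable M p" "\<And>n. s n \<in> I"
      "(\<lambda>n. LINT x|M. (norm (j (s n) x - p x))\<^sup>2) \<longlonglongrightarrow> 0"
      "\<And>k. k \<in> I \<Longrightarrow> l2_inner M p (j k) = l2_inner M (S i) (j k)"
    then show ?thesis unfolding is_proj_def by blast
  qed
  then have "\<forall>i\<in>I. \<exists>p. is_proj i p" by blast
  from bchoice[OF this] obtain P where P0: "\<And>i. i \<in> I \<Longrightarrow> is_proj i (P i)" by blast
  then have P: "\<And>i. i \<in> I \<Longrightarrow> square_integrable M (P i)"
    and Pc: "\<And>i. i \<in> I \<Longrightarrow> \<exists>s. (\<forall>n. s n \<in> I) \<and> (\<lambda>n. LINT x|M. (norm (j (s n) x - P i x))\<^sup>2) \<longlonglongrightarrow> 0"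
    and Pj: "\<And>i k. i \<in> I \<Longrightarrow> k \<in> I \<Longrightarrow> l2_inner M (P i) (j k) = l2_inner M (S i) (j k)"
    unfolding is_proj_def by blast+
  have closure: "l2_inner M h (P i) = l2_inner M h (S i)"
    if "i \<in> I" "square_integrable M h" "\<And>n. t n \<in> I" "(\<lambda>n. LINT x|M. (norm (j (t n) x - h x))\<^sup>2) \<longlonglongrightarrow> 0" for i h t
  proof -
    have "(\<lambda>n. l2_inner M (j (t n)) (P i)) \<longlonglongrightarrow> l2_inner M h (P i)"
      by (rule l2_limit_inner[OF j[OF that(3)] that(2) P[OF that(1)] that(4)])
    moreover have "(\<lambda>n. l2_inner M (j (t n)) (S i)) \<longlonglongrightarrow> l2_inner M h (S i)"
      by (rule l2_limit_inner[OF j[OF that(3)] that(2) S[OF that(1)] that(4)])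
    moreover have "l2_inner M (j (t n)) (P i) = l2_inner M (j (t n)) (S i)" for n
      using Pj[OF that(1) that(3)[of n]] by (simp add: l2_inner_commute)
    ultimately show ?thesis using LIMSEQ_unique by simp
  qed
  \<comment> \<open>\<open>P\<close> is picked separately for each index, so it is linear at best up
    to null sets. Since \<open>P k\<close> lies in the closure, \<open>P i\<close> may be replaced
    by \<open>S i\<close> against it, and the Gram form of \<open>P\<close> inherits linearity from
    \<open>S\<close>.\<close>
  have PP: "l2_inner M (P i) (P k) = l2_inner M (S i) (P k)" if ik: "i \<in> I" "k \<in> I" for i k
  proof -
    obtain t where t: "\<forall>n. t n \<in> I" "(\<lambda>n. LINT x|M. (norm (j (t n) x - P k x))\<^sup>2) \<longlonglongrightarrow> 0"
      using Pc[OF ik(2)] by blast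
    from closure[OF ik(1) P[OF ik(2)] spec[OF t(1)] t(2)] show ?thesis
      by (simp only: l2_inner_commute[of M "P i" "P k"] l2_inner_commute[of M "S i" "P k"])
  qed
  \<comment> \<open>Second use of Riesz, now on the range of \<open>P\<close>. With \<open>N\<close>
    the norm of \<open>P i\<close>, the hypothesis \<open>bound\<close> says exactly that
    \<open>F\<close> is bounded with respect to the Gram form of \<open>P\<close>.\<close>
  obtain u s where u: "square_integrable M u" and s: "\<And>n. s n \<in> I"
    and lim: "(\<lambda>n. LINT x|M. (norm (P (s n) x - u x))\<^sup>2) \<longlonglongrightarrow> 0"
    and uP: "\<And>i. i \<in> I \<Longrightarrow> l2_inner M u (P i) = F i"
  proof (rule l2_riesz[of I M P F "C\<^sup>2"])
    fix i i' c assume i: "i \<in> I" "i' \<in> I"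
    obtain k where k: "k \<in> I" "F k = F i + c * F i'" "\<forall>x\<in>space M. S k x = S i x + c *\<^sub>R S i' x"
      using comb[OF i] by blast
    have "l2_inner M (P k) (P l) = l2_inner M (P i) (P l) + c * l2_inner M (P i') (P l)" if l: "l \<in> I" for l
      unfolding PP[OF i(1) l] PP[OF i(2) l] PP[OF k(1) l]
      using k i by (intro l2_inner_comb_left S P l) auto
    then show "\<exists>k\<in>I. F k = F i + c * F i' \<and> (\<forall>l\<in>I. l2_inner M (P k) (P l) = l2_inner M (P i) (P l) + c * l2_inner M (P i') (P l))"
      using k by blast
  next
    fix i assume i: "i \<in> I"
    have "\<bar>F i\<bar> \<le> C * sqrt (l2_inner M (P i) (P i))"
    proof (rule bound[OF i])
      fix k assume k: "k \<in> I"
      have "l2_inner M (j k) (S i) = l2_inner M (P i) (j k)" using Pj[OF i k] by (simp add: l2_inner_commute)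
      also have "\<dots> \<le> sqrt (l2_inner M (P i) (P i)) * sqrt (l2_inner M (j k) (j k))"
        using l2_Cauchy_Schwarz_sqrt[OF P[OF i] j[OF k]] by linarith
      finally show "l2_inner M (j k) (S i) \<le> sqrt (l2_inner M (P i) (P i)) * sqrt (l2_inner M (j k) (j k))" .
    qed (simp add: l2_inner_nonneg)
    then have "(F i)\<^sup>2 \<le> (C * sqrt (l2_inner M (P i) (P i)))\<^sup>2" by (metis abs_ge_zero power2_abs power_mono)
    then show "(F i)\<^sup>2 \<le> C\<^sup>2 * l2_inner M (P i) (P i)" by (simp add: power_mult_distrib l2_inner_nonneg)
  next
    show "I \<noteq> {}" by (rule ne)
    show "square_integrable M (P i)" if "i \<in> I" for i by (rule P[OF that])
    fix u s assume "square_integrable M u" "\<And>n. s n \<in> I"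
      "(\<lambda>n. LINT x|M. (norm (P (s n) x - u x))\<^sup>2) \<longlonglongrightarrow> 0"
      "\<And>i. i \<in> I \<Longrightarrow> l2_inner M u (P i) = F i"
    then show thesis by (rule that)
  qed
  \<comment> \<open>The representer is a limit of projections, and each projection is a limit of
    values of \<open>j\<close>; a diagonal choice gives one sequence from the range of
    \<open>j\<close>.\<close>
  have "\<exists>k\<in>I. (LINT x|M. (norm (j k x - P (s n) x))\<^sup>2) < 1 / real (Suc n)" for n
  proof -
    obtain t where t: "\<forall>n. t n \<in> I" "(\<lambda>m. LINT x|M. (norm (j (t m) x - P (s n) x))\<^sup>2) \<longlonglongrightarrow> 0"
      using Pc[OF s] by blast
    have "\<forall>\<^sub>F m in sequentially. (LINT x|M. (norm (j (t m) x - P (s n) x))\<^sup>2) < 1 / real (Suc n)"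
      by (rule order_tendstoD(2)[OF t(2)]) simp
    then obtain m where "(LINT x|M. (norm (j (t m) x - P (s n) x))\<^sup>2) < 1 / real (Suc n)"
      unfolding eventually_sequentially by blast
    then show ?thesis using t(1) by blast
  qed
  then obtain t where t: "\<And>n. t n \<in> I" "\<And>n. (LINT x|M. (norm (j (t n) x - P (s n) x))\<^sup>2) < 1 / real (Suc n)" by metis
  have t_lim: "(\<lambda>n. LINT x|M. (norm (j (t n) x - u x))\<^sup>2) \<longlonglongrightarrow> 0"
  proof (rule tendsto_sandwich)
    show "(\<lambda>_. 0::real) \<longlonglongrightarrow> 0" by simp
    have "(\<lambda>n. 2 * (1 / real (Suc n)) + 2 * (LINT x|M. (norm (P (s n) x - u x))\<^sup>2)) \<longlonglongrightarrow> 2 * 0 + 2 * 0"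
      by (intro tendsto_intros lim LIMSEQ_Suc[OF lim_1_over_n])
    then show "(\<lambda>n. 2 * (1 / real (Suc n)) + 2 * (LINT x|M. (norm (P (s n) x - u x))\<^sup>2)) \<longlonglongrightarrow> 0" by simp
    show "\<forall>\<^sub>F n in sequentially. 0 \<le> (LINT x|M. (norm (j (t n) x - u x))\<^sup>2)" by simp
    have "(LINT x|M. (norm (j (t n) x - u x))\<^sup>2) \<le> 2 * (1 / real (Suc n)) + 2 * (LINT x|M. (norm (P (s n) x - u x))\<^sup>2)" for n
    proof -
      have i1: "integrable M (\<lambda>x. (norm (j (t n) x - P (s n) x))\<^sup>2)" and i2: "integrable M (\<lambda>x. (norm (P (s n) x - u x))\<^sup>2)"
        and i3: "integrable M (\<lambda>x. (norm (j (t n) x - u x))\<^sup>2)"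
        using square_integrable_diff[OF j[OF t(1)[of n]] P[OF s[of n]]] square_integrable_diff[OF P[OF s[of n]] u]
          square_integrable_diff[OF j[OF t(1)[of n]] u] by (auto simp: square_integrable_def)
      have "(norm (a - c))\<^sup>2 \<le> 2 * (norm (a - b))\<^sup>2 + 2 * (norm (b - c))\<^sup>2" for a b c :: 'b
      proof -
        have "norm (a - c) \<le> norm (a - b) + norm (b - c)" using norm_triangle_ineq[of "a - b" "b - c"] by simp
        then have "(norm (a - c))\<^sup>2 \<le> (norm (a - b) + norm (b - c))\<^sup>2" by (intro power_mono) auto
        also have "\<dots> \<le> 2 * (norm (a - b))\<^sup>2 + 2 * (norm (b - c))\<^sup>2"
          using sum_squares_bound[of "norm (a - b)" "norm (b - c)"] by (simp add: power2_sum)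
        finally show ?thesis .
      qed
      then have "(LINT x|M. (norm (j (t n) x - u x))\<^sup>2) \<le>
          (LINT x|M. 2 * (norm (j (t n) x - P (s n) x))\<^sup>2 + 2 * (norm (P (s n) x - u x))\<^sup>2)"
        using i1 i2 i3 by (intro integral_mono) auto
      also have "\<dots> = 2 * (LINT x|M. (norm (j (t n) x - P (s n) x))\<^sup>2) + 2 * (LINT x|M. (norm (P (s n) x - u x))\<^sup>2)"
        using i1 i2 by simp
      finally show ?thesis using t(2)[of n] by simp
    qed
    then show "\<forall>\<^sub>F n in sequentially. (LINT x|M. (norm (j (t n) x - u x))\<^sup>2) \<le> 2 * (1 / real (Suc n)) + 2 * (LINT x|M. (norm (P (s n) x - u x))\<^sup>2)"
      by simp
  qed
  show ?thesis
  proof (rule that[OF u t(1) t_lim])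
    show "l2_inner M u (S i) = F i" if "i \<in> I" for i
      using closure[OF that u t(1) t_lim] uP[OF that] by simp
  qed
qed

section \<open>Test functions\<close>

lemma has_derivative_grad:
  fixes f :: "real^'n::finite \<Rightarrow> real"
  assumes "f differentiable (at x)"
  shows "(f has_derivative (\<lambda>h. grad f x \<bullet> h)) (at x)"
proof -
  have D: "(f has_derivative frechet_derivative f (at x)) (at x)"
    using assms frechet_derivative_works by blast
  interpret L: linear "frechet_derivative f (at x)"
    using D by (rule has_derivative_linear)
  have "frechet_derivative f (at x) h = grad f x \<bullet> h" for h
  proof -
    have "h = (\<Sum>i\<in>UNIV. (h $ i) *\<^sub>R axis i 1)"
      using basis_expansion[of h] by (simp add: scalar_mult_eq_scaleR)
    then have "frechet_derivative f (at x) h = frechet_derivative f (at x) (\<Sum>i\<in>UNIV. (h $ i) *\<^sub>R axis i 1)"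
      by (rule arg_cong)
    also have "\<dots> = grad f x \<bullet> h"
      by (simp add: L.sum L.scale inner_vec_def grad_def partial_def mult.commute)
    finally show ?thesis .
  qed
  then have "frechet_derivative f (at x) = (\<lambda>h. grad f x \<bullet> h)" by (rule ext)
  with D show ?thesis by simp
qed

lemma partial_eq:
  assumes "(f has_derivative D) (at x)"
  shows "partial i f x = D (axis i 1)"
  using frechet_derivative_at[OF assms] by (simp add: partial_def)

lemma grad_nth: "grad f x $ i = partial i f x"
  by (simp add: grad_def)

lemma C_k_Suc_imp: "C_k (Suc k) f \<Longrightarrow> C_k k f"
proof (induction k arbitrary: f)
  case 0
  then show ?case
    by (auto intro!: differentiable_imp_continuous_on simp: differentiable_on_def differentiable_at_withinI)
qed auto

lemma C_k_imp_continuous: "C_k k f \<Longrightarrow> continuous_on S f"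
  by (induction k) (auto dest: C_k_Suc_imp intro: continuous_on_subset simp del: C_k.simps(2))

lemma partial_comb:
  assumes "f differentiable (at x)" "g differentiable (at x)"
  shows "partial i (\<lambda>x. f x + c * g x) x = partial i f x + c * partial i g x"
proof -
  have "((\<lambda>x. f x + c * g x) has_derivative (\<lambda>h. grad f x \<bullet> h + c * (grad g x \<bullet> h))) (at x)"
    using assms[THEN has_derivative_grad] by (auto intro!: derivative_eq_intros)
  from partial_eq[OF this] show ?thesis by (simp add: inner_axis grad_nth)
qed

lemma partial_mult:
  assumes "f differentiable (at x)" "g differentiable (at x)"
  shows "partial i (\<lambda>x. f x * g x) x = f x * partial i g x + partial i f x * g x"
proof -
  have "((\<lambda>x. f x * g x) has_derivative (\<lambda>h. f x * (grad g x \<bullet> h) + (grad f x \<bullet> h) * g x)) (at x)"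
    using assms[THEN has_derivative_grad] by (auto intro!: derivative_eq_intros)
  from partial_eq[OF this] show ?thesis by (simp add: inner_axis grad_nth)
qed

lemma partial_chain:
  assumes "f differentiable (at x)" "(H has_real_derivative d) (at (f x))"
  shows "(\<lambda>x. H (f x)) differentiable (at x)" "partial i (\<lambda>x. H (f x)) x = d * partial i f x"
proof -
  have *: "((\<lambda>x. H (f x)) has_derivative (\<lambda>h. d * (grad f x \<bullet> h))) (at x)"
    using has_derivative_compose[OF has_derivative_grad[OF assms(1)] assms(2)[unfolded has_field_derivative_def]] .
  then show "(\<lambda>x. H (f x)) differentiable (at x)" unfolding differentiable_def by blast
  from partial_eq[OF *] show "partial i (\<lambda>x. H (f x)) x = d * partial i f x" by (simp add: inner_axis grad_nth)
qed

lemma C_k_comb: "C_k k f \<Longrightarrow> C_k k g \<Longrightarrow> C_k k (\<lambda>x. f x + c * g x)"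
proof (induction k arbitrary: f g)
  case (Suc k)
  have "partial i (\<lambda>x. f x + c * g x) = (\<lambda>x. partial i f x + c * partial i g x)" for i
    using Suc.prems by (auto simp: partial_comb)
  then show ?case using Suc by auto
qed (auto intro!: continuous_intros)

lemma C_k_mult: "C_k k f \<Longrightarrow> C_k k g \<Longrightarrow> C_k k (\<lambda>x. f x * g x)"
proof (induction k arbitrary: f g)
  case (Suc k)
  have "partial i (\<lambda>x. f x * g x) = (\<lambda>x. f x * partial i g x + 1 * (partial i f x * g x))" for i
    using Suc.prems by (auto simp: partial_mult)
  moreover have "C_k k f" "C_k k g" using Suc.prems by (auto intro: C_k_Suc_imp simp del: C_k.simps)
  then have "C_k k (\<lambda>x. f x * partial i g x + 1 * (partial i f x * g x))" for i
    using Suc.prems by (intro C_k_comb Suc.IH) auto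
  ultimately have "C_k k (partial i (\<lambda>x. f x * g x))" for i by simp
  then show ?case using Suc.prems by auto
qed (auto intro!: continuous_intros)

lemma C_k_scale: "C_k k f \<Longrightarrow> C_k k (\<lambda>x. c * f x)"
  using C_k_comb[of k f f "c - 1"] by (simp add: algebra_simps)

text \<open>The class closes up under differentiation: for
  \<open>r = 1 / (\<epsilon>\<^sup>2 + v\<^sup>2)\<close> the derivative is
  \<open>- 2 * v * r * r\<close> times that of \<open>v\<close>, so the induction needs only
  products.\<close>

lemma C_k_inverse_quadratic:
  assumes "\<And>k. C_k k v" "0 < \<epsilon>"
  shows "C_k k (\<lambda>x. 1 / (\<epsilon>\<^sup>2 + (v x)\<^sup>2))"
proof (induction k)
  case 0
  have "\<epsilon>\<^sup>2 + (v x)\<^sup>2 \<noteq> 0" for x using assms(2) by (metis add_pos_nonneg less_irrefl zero_le_power2 zero_less_power)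
  then show ?case using assms(1)[of 0] by (auto intro!: continuous_intros)
next
  case (Suc k)
  let ?r = "\<lambda>x. 1 / (\<epsilon>\<^sup>2 + (v x)\<^sup>2)"
  have pos: "0 < \<epsilon>\<^sup>2 + t\<^sup>2" for t using assms(2) by (simp add: add_pos_nonneg)
  have d: "((\<lambda>t. 1 / (\<epsilon>\<^sup>2 + t\<^sup>2)) has_real_derivative - 2 * t * (1 / (\<epsilon>\<^sup>2 + t\<^sup>2)) * (1 / (\<epsilon>\<^sup>2 + t\<^sup>2))) (at t)" for t
    using pos[of t] by (auto intro!: derivative_eq_intros simp: divide_simps)
  have dv: "v differentiable (at x)" for x using assms(1)[of 1] by simp
  note pc = partial_chain[OF dv d]
  have "partial i ?r = (\<lambda>x. ((-2) * v x * ?r x * ?r x) * partial i v x)" for i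
    using pc(2) by (intro ext) simp
  moreover have "C_k k (partial i v)" for i using assms(1)[of "Suc k"] by simp
  then have "C_k k (\<lambda>x. ((-2) * v x * ?r x * ?r x) * partial i v x)" for i
    by (intro C_k_mult C_k_scale Suc.IH assms(1))
  ultimately show ?case using pc(1) by simp
qed

text \<open>One derivative leads from \<open>arctan\<close> to the rational function of
  \<open>C_k_inverse_quadratic\<close>. The outer factor \<open>1 / \<epsilon>\<close> is what makes
  the denominator of the gradient exactly \<open>\<epsilon>\<^sup>2 + v\<^sup>2\<close>, the square
  of the one for \<open>arsinh\<close>.\<close>

lemma C_k_arctan:
  assumes "\<And>k. C_k k v" "0 < \<epsilon>"
  shows "C_k k (\<lambda>x. arctan (v x / \<epsilon>) / \<epsilon>)"
    and "partial i (\<lambda>x. arctan (v x / \<epsilon>) / \<epsilon>) x = partial i v x / (\<epsilon>\<^sup>2 + (v x)\<^sup>2)"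
proof -
  have pos: "0 < \<epsilon>\<^sup>2 + t\<^sup>2" for t using assms(2) by (simp add: add_pos_nonneg)
  have d: "((\<lambda>t. arctan (t / \<epsilon>) / \<epsilon>) has_real_derivative 1 / (\<epsilon>\<^sup>2 + t\<^sup>2)) (at t)" for t
  proof -
    have "inverse (1 + (t / \<epsilon>)\<^sup>2) * (1 / \<epsilon>) / \<epsilon> = 1 / (\<epsilon>\<^sup>2 * (1 + (t / \<epsilon>)\<^sup>2))"
      by (simp add: power2_eq_square divide_inverse mult_ac)
    also have "\<epsilon>\<^sup>2 * (1 + (t / \<epsilon>)\<^sup>2) = \<epsilon>\<^sup>2 + t\<^sup>2" using assms(2) by (simp add: field_simps)
    finally show ?thesis
      using DERIV_cdivide[OF DERIV_chain2[OF DERIV_arctan DERIV_cdivide[OF DERIV_ident]], of "\<epsilon>" \<epsilon> t] by simp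
  qed
  have dv: "v differentiable (at x)" for x using assms(1)[of 1] by simp
  note pc = partial_chain[OF dv d]
  show p: "partial i (\<lambda>x. arctan (v x / \<epsilon>) / \<epsilon>) x = partial i v x / (\<epsilon>\<^sup>2 + (v x)\<^sup>2)" for i x
    using pc(2) by simp
  show "C_k k (\<lambda>x. arctan (v x / \<epsilon>) / \<epsilon>)"
  proof (cases k)
    case 0
    then show ?thesis using assms(1)[of 0] assms(2) by (auto intro!: continuous_intros)
  next
    case (Suc m)
    have "partial i (\<lambda>x. arctan (v x / \<epsilon>) / \<epsilon>) = (\<lambda>x. 1 / (\<epsilon>\<^sup>2 + (v x)\<^sup>2) * partial i v x)" for i
      using p by (intro ext) simp
    moreover have "C_k m (partial i v)" for i using assms(1)[of "Suc m"] by simp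
    then have "C_k m (\<lambda>x. 1 / (\<epsilon>\<^sup>2 + (v x)\<^sup>2) * partial i v x)" for i
      by (intro C_k_mult C_k_inverse_quadratic assms)
    ultimately show ?thesis using pc(1) Suc by simp
  qed
qed

lemma C_k_arsinh:
  assumes "C_k 1 v" "0 < \<epsilon>"
  shows "C_k 1 (\<lambda>x. arsinh (v x / \<epsilon>))"
    and "partial i (\<lambda>x. arsinh (v x / \<epsilon>)) x = partial i v x / sqrt (\<epsilon>\<^sup>2 + (v x)\<^sup>2)"
proof -
  have pos: "0 < \<epsilon>\<^sup>2 + t\<^sup>2" for t using assms(2) by (simp add: add_pos_nonneg)
  have d: "((\<lambda>t. arsinh (t / \<epsilon>)) has_real_derivative 1 / sqrt (\<epsilon>\<^sup>2 + t\<^sup>2)) (at t)" for t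
  proof -
    have "sqrt ((t / \<epsilon>)\<^sup>2 + 1) = sqrt ((\<epsilon>\<^sup>2 + t\<^sup>2) / \<epsilon>\<^sup>2)" using assms(2) by (simp add: field_simps)
    also have "\<dots> = sqrt (\<epsilon>\<^sup>2 + t\<^sup>2) / \<epsilon>" using assms(2) by (simp add: real_sqrt_divide)
    finally show ?thesis
      using DERIV_chain2[OF arsinh_real_has_field_derivative DERIV_cdivide[OF DERIV_ident], of \<epsilon> t UNIV] assms(2)
      by simp
  qed
  have dv: "v differentiable (at x)" for x using assms(1) by simp
  note pc = partial_chain[OF dv d]
  show p: "partial i (\<lambda>x. arsinh (v x / \<epsilon>)) x = partial i v x / sqrt (\<epsilon>\<^sup>2 + (v x)\<^sup>2)" for i x
    using pc(2) by simp
  have cv: "continuous_on UNIV v" using C_k_imp_continuous[OF assms(1)] .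
  have "partial i (\<lambda>x. arsinh (v x / \<epsilon>)) = (\<lambda>x. partial i v x / sqrt (\<epsilon>\<^sup>2 + (v x)\<^sup>2))" for i
    using p by (intro ext)
  moreover have "continuous_on UNIV (\<lambda>x. partial i v x / sqrt (\<epsilon>\<^sup>2 + (v x)\<^sup>2))" for i
    using assms(1) cv pos by (auto intro!: continuous_intros simp: less_imp_neq[OF pos, symmetric])
  ultimately show "C_k 1 (\<lambda>x. arsinh (v x / \<epsilon>))" using pc(1) by simp
qed

text \<open>All integral inequalities are stated for this class rather than for
  \<open>test_functions\<close>, because they are also applied to
  \<open>arsinh (v / \<epsilon>)\<close>, for which one continuous derivative is
  established.\<close>

definition C1_compact :: "(real^'n::finite) set \<Rightarrow> (real^'n \<Rightarrow> real) set" where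
  "C1_compact K = {f. C_k 1 f \<and> compact (closure {x. f x \<noteq> 0}) \<and> closure {x. f x \<noteq> 0} \<subseteq> K}"

lemma compact_support_mono:
  assumes "compact (closure S) \<and> closure S \<subseteq> K" "T \<subseteq> S"
  shows "compact (closure T) \<and> closure T \<subseteq> K"
proof -
  have "closure T \<subseteq> closure S" using assms(2) by (rule closure_mono)
  then have "closure S \<inter> closure T = closure T" by blast
  then have "compact (closure T)" using compact_Int_closed[of "closure S" "closure T"] assms(1) by simp
  then show ?thesis using assms(1) \<open>closure T \<subseteq> closure S\<close> by blast
qed

lemma test_imp_C1_compact: "\<phi> \<in> test_functions K \<Longrightarrow> \<phi> \<in> C1_compact K"
  unfolding test_functions_def C1_compact_def by blast

lemma test_functionsI:
  assumes "\<And>k. C_k k f" "\<And>x. f x \<noteq> 0 \<Longrightarrow> x \<in> S" "compact (closure S)" "closure S \<subseteq> K"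
  shows "f \<in> test_functions K"
proof -
  have "compact (closure {x. f x \<noteq> 0}) \<and> closure {x. f x \<noteq> 0} \<subseteq> K"
    by (rule compact_support_mono[of S]) (use assms in blast)+
  then show ?thesis unfolding test_functions_def using assms(1) by blast
qed

lemma test_functionsD:
  assumes "f \<in> test_functions K"
  shows "C_k k f" "compact (closure {x. f x \<noteq> 0})" "closure {x. f x \<noteq> 0} \<subseteq> K"
  using assms unfolding test_functions_def by blast+

lemma test_comb:
  assumes \<phi>: "\<phi> \<in> test_functions K" and \<psi>: "\<psi> \<in> test_functions K"
  shows "(\<lambda>x. \<phi> x + c * \<psi> x) \<in> test_functions K"
proof (rule test_functionsI)
  let ?S = "{x. \<phi> x \<noteq> 0} \<union> {x. \<psi> x \<noteq> 0}"
  show "compact (closure ?S)" "closure ?S \<subseteq> K"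
    unfolding closure_Un using test_functionsD[OF \<phi>] test_functionsD[OF \<psi>] by (blast intro: compact_Un)+
  show "C_k k (\<lambda>x. \<phi> x + c * \<psi> x)" for k
    by (intro C_k_comb test_functionsD[OF \<phi>] test_functionsD[OF \<psi>])
qed auto

lemma test_mult:
  assumes \<phi>: "\<phi> \<in> test_functions K" and \<psi>: "\<psi> \<in> test_functions K"
  shows "(\<lambda>x. \<phi> x * \<psi> x) \<in> test_functions K"
proof (rule test_functionsI)
  show "C_k k (\<lambda>x. \<phi> x * \<psi> x)" for k
    by (intro C_k_mult test_functionsD[OF \<phi>] test_functionsD[OF \<psi>])
qed (use test_functionsD(2,3)[OF \<phi>] in simp_all)

lemma test_arctan:
  assumes \<phi>: "\<phi> \<in> test_functions K" and \<epsilon>: "0 < \<epsilon>"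
  shows "(\<lambda>x. arctan (\<phi> x / \<epsilon>) / \<epsilon>) \<in> test_functions K"
proof (rule test_functionsI)
  show "C_k k (\<lambda>x. arctan (\<phi> x / \<epsilon>) / \<epsilon>)" for k
    by (intro C_k_arctan test_functionsD[OF \<phi>] \<epsilon>)
qed (use test_functionsD(2,3)[OF \<phi>] in simp_all)

lemma C1_compact_arsinh:
  assumes \<phi>: "\<phi> \<in> C1_compact K" and \<epsilon>: "0 < \<epsilon>"
  shows "(\<lambda>x. arsinh (\<phi> x / \<epsilon>)) \<in> C1_compact K"
proof -
  have 1: "C_k 1 \<phi>" "compact (closure {x. \<phi> x \<noteq> 0}) \<and> closure {x. \<phi> x \<noteq> 0} \<subseteq> K"
    using \<phi> unfolding C1_compact_def by blast+
  have "compact (closure {x. arsinh (\<phi> x / \<epsilon>) \<noteq> 0}) \<and> closure {x. arsinh (\<phi> x / \<epsilon>) \<noteq> 0} \<subseteq> K"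
    by (rule compact_support_mono[OF 1(2)]) auto
  then show ?thesis unfolding C1_compact_def using C_k_arsinh(1)[OF 1(1) \<epsilon>] by blast
qed

lemma C1_compact_continuous:
  assumes "f \<in> C1_compact K"
  shows "continuous_on S f" "continuous_on S (partial i f)" "continuous_on S (grad f)"
proof -
  have 1: "continuous_on UNIV (partial i f)" for i using assms by (simp add: C1_compact_def)
  then have "continuous_on UNIV (\<lambda>x. \<chi> i. partial i f x)" by (intro continuous_on_vec_lambda)
  then have "continuous_on UNIV (grad f)" by (simp add: grad_def[abs_def])
  then show "continuous_on S (grad f)" by (rule continuous_on_subset) simp
  show "continuous_on S (partial i f)" using 1 by (rule continuous_on_subset) simp
  show "continuous_on S f"
    using assms unfolding C1_compact_def by (blast intro: C_k_imp_continuous)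
qed

lemma C1_compact_has_derivative:
  assumes "f \<in> C1_compact K"
  shows "(f has_derivative (\<lambda>h. grad f x \<bullet> h)) (at x)"
  using assms by (intro has_derivative_grad) (simp add: C1_compact_def)

lemma C1_compact_support:
  assumes "f \<in> C1_compact K"
  obtains C where "compact C" "C \<subseteq> K" "\<And>x. x \<notin> C \<Longrightarrow> f x = 0" "\<And>x. x \<notin> C \<Longrightarrow> grad f x = 0"
    "\<And>x i. x \<notin> C \<Longrightarrow> partial i f x = 0"
proof -
  define C where "C = closure {x. f x \<noteq> 0}"
  have C: "compact C" "C \<subseteq> K" using assms unfolding C1_compact_def C_def by blast+
  have 1: "f x = 0" if "x \<notin> C" for x
    using that closure_subset[of "{x. f x \<noteq> 0}"] unfolding C_def by blast
  have p: "partial i f x = 0" if x: "x \<notin> C" for x i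
  proof -
    have "open (- C)" using C(1) by (simp add: compact_imp_closed open_Compl)
    then have "(f has_derivative (\<lambda>_. 0)) (at x)"
      by (rule has_derivative_transform_within_open[OF has_derivative_const]) (use x 1 in auto)
    from partial_eq[OF this] show ?thesis .
  qed
  have "grad f x = 0" if "x \<notin> C" for x using p[OF that] by (simp add: vec_eq_iff grad_nth)
  then show ?thesis using that C 1 p by blast
qed

section \<open>Hardy and Poincare inequalities on convex domains\<close>

lemma integrable_lebesgue_on_compact_support:
  fixes h :: "real^'n::finite \<Rightarrow> real"
  assumes "open K" "compact C" "C \<subseteq> K" "continuous_on C h" "\<And>x. x \<in> K \<Longrightarrow> x \<notin> C \<Longrightarrow> h x = 0"
  shows "integrable (lebesgue_on K) h"
proof -
  have eq: "indicat_real K x *\<^sub>R h x = indicat_real C x *\<^sub>R h x" for x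
    using assms(3,5) by (auto simp: indicator_def)
  have "integrable lborel (\<lambda>x. indicat_real C x *\<^sub>R h x)"
    by (rule borel_integrable_compact[OF assms(2,4)])
  then have "integrable lebesgue (\<lambda>x. indicat_real C x *\<^sub>R h x)"
    by (subst integrable_completion) (auto dest: borel_measurable_integrable)
  then show ?thesis using assms(1) unfolding eq[symmetric]
    by (subst integrable_restrict_space) auto
qed

lemma integral_lebesgue_on_eq_lborel:
  fixes h :: "real^'n::finite \<Rightarrow> real"
  assumes "open K" "h \<in> borel_measurable borel" "\<And>x. x \<notin> K \<Longrightarrow> h x = 0"
  shows "(LINT x|lebesgue_on K. h x) = (LINT x|lborel. h x)"
proof -
  have eq: "indicat_real K x * h x = h x" for x
    using assms(3) by (auto simp: indicator_def)
  show ?thesis using assms(1,2) by (simp add: integral_restrict_space eq integral_completion)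
qed

lemma nn_integral_lebesgue_on_eq_lborel:
  fixes h :: "real^'n::finite \<Rightarrow> ennreal"
  assumes "open K" "\<And>x. x \<notin> K \<Longrightarrow> h x = 0"
  shows "(\<integral>\<^sup>+x. h x \<partial>lebesgue_on K) = (\<integral>\<^sup>+x. h x \<partial>lborel)"
proof -
  have eq: "h x * indicator K x = h x" for x
    using assms(2) by (auto simp: indicator_def)
  show ?thesis using assms(1) by (simp add: nn_integral_restrict_space eq nn_integral_completion)
qed

lemma nn_integral_translate:
  fixes f :: "'a::euclidean_space \<Rightarrow> ennreal"
  assumes [measurable]: "f \<in> borel_measurable borel"
  shows "(\<integral>\<^sup>+x. f (x + c) \<partial>lborel) = (\<integral>\<^sup>+x. f x \<partial>lborel)"
proof -
  have "(\<integral>\<^sup>+x. f x \<partial>lborel) = (\<integral>\<^sup>+x. f x \<partial>distr lborel borel ((+) c))"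
    by (simp add: lborel_distr_plus)
  also have "\<dots> = (\<integral>\<^sup>+x. f (c + x) \<partial>lborel)" by (subst nn_integral_distr) auto
  finally show ?thesis by (simp add: add.commute)
qed

lemma integral_translate:
  fixes f :: "'a::euclidean_space \<Rightarrow> real"
  assumes [measurable]: "f \<in> borel_measurable borel"
  shows "(LINT x|lborel. f (x + c)) = (LINT x|lborel. f x)"
proof -
  have "(LINT x|lborel. f x) = (LINT x|distr lborel borel ((+) c). f x)"
    by (simp add: lborel_distr_plus)
  also have "\<dots> = (LINT x|lborel. f (c + x))" by (subst integral_distr) auto
  finally show ?thesis by (simp add: add.commute)
qed

lemma C1_compact_borel:
  assumes "f \<in> C1_compact K"
  shows "f \<in> borel_measurable borel" "partial i f \<in> borel_measurable borel" "grad f \<in> borel_measurable borel"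
  using C1_compact_continuous[OF assms, of UNIV] by (auto intro!: borel_measurable_continuous_onI)

lemma C1_compact_bounded:
  assumes "f \<in> C1_compact K"
  obtains L where "0 \<le> L" "\<And>x. \<bar>f x\<bar> \<le> L" "\<And>x. norm (grad f x) \<le> L" "\<And>x i. \<bar>partial i f x\<bar> \<le> L"
proof -
  obtain C where C: "compact C" "\<And>x. x \<notin> C \<Longrightarrow> f x = 0" "\<And>x. x \<notin> C \<Longrightarrow> grad f x = 0"
    using C1_compact_support[OF assms] by metis
  have "bounded (f ` C)" "bounded (grad f ` C)"
    using C1_compact_continuous[OF assms] C(1) by (auto intro!: compact_imp_bounded compact_continuous_image)
  then obtain L1 L2 where L: "\<And>x. x \<in> C \<Longrightarrow> norm (f x) \<le> L1" "\<And>x. x \<in> C \<Longrightarrow> norm (grad f x) \<le> L2"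
    unfolding bounded_iff by blast
  define L where "L = max 0 (max L1 L2)"
  have g: "norm (grad f x) \<le> L" for x using L(2)[of x] C(3)[of x] by (cases "x \<in> C") (auto simp: L_def)
  show ?thesis
  proof
    show "0 \<le> L" by (simp add: L_def)
    show "\<bar>f x\<bar> \<le> L" for x using L(1)[of x] C(2)[of x] by (cases "x \<in> C") (auto simp: L_def)
    show "norm (grad f x) \<le> L" for x by (rule g)
    show "\<bar>partial i f x\<bar> \<le> L" for x i
      using component_le_norm_cart[of "grad f x" i] g[of x] by (simp add: grad_nth)
  qed
qed

lemma C1_compact_DERIV_line:
  assumes "f \<in> C1_compact K"
  shows "((\<lambda>t. f (x + t *\<^sub>R e)) has_real_derivative grad f (x + t *\<^sub>R e) \<bullet> e) (at t)"
proof -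
  have "((\<lambda>t. x + t *\<^sub>R e) has_derivative (\<lambda>h. h *\<^sub>R e)) (at t)"
    by (auto intro!: derivative_eq_intros)
  from has_derivative_compose[OF this C1_compact_has_derivative[OF assms]]
  show ?thesis unfolding has_field_derivative_def by (simp add: mult_commute_abs)
qed

lemma C1_compact_lipschitz:
  assumes "f \<in> C1_compact K" "\<And>x. norm (grad f x) \<le> L"
  shows "\<bar>f y - f x\<bar> \<le> L * norm (y - x)"
proof -
  have "norm (f y - f x) \<le> L * norm (y - x)"
  proof (rule differentiable_bound[of UNIV f "\<lambda>x h. grad f x \<bullet> h"])
    show "(f has_derivative (\<bullet>) (grad f x)) (at x within UNIV)" for x
      using C1_compact_has_derivative[OF assms(1)] by simp
    show "onorm ((\<bullet>) (grad f x)) \<le> L" for x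
    proof (rule onorm_le)
      show "norm (grad f x \<bullet> h) \<le> L * norm h" for h
        using Cauchy_Schwarz_ineq2[of "grad f x" h] mult_right_mono[OF assms(2)[of x] norm_ge_zero[of h]] by simp
    qed
  qed auto
  then show ?thesis by simp
qed

text \<open>Difference quotients integrate to 0 by translation invariance, and dominated convergence
  carries this over to the derivative. This is the only source of integration by parts.\<close>

lemma integral_partial_eq_0:
  fixes f :: "real^'n::finite \<Rightarrow> real"
  assumes f: "f \<in> C1_compact K"
  shows "(LINT x|lborel. partial i f x) = 0"
proof -
  note [measurable] = C1_compact_borel[OF f]
  obtain C where C: "compact C" "\<And>x. x \<notin> C \<Longrightarrow> f x = 0" using C1_compact_support[OF f] by metis
  obtain R where R: "\<And>x. x \<in> C \<Longrightarrow> norm x \<le> R" using compact_imp_bounded[OF C(1)] bounded_iff by blast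
  obtain L where L: "0 \<le> L" "\<And>x. norm (grad f x) \<le> L" using C1_compact_bounded[OF f] by metis
  define h where "h k = 1 / real (Suc k)" for k
  have h: "0 < h k" "h k \<le> 1" for k by (auto simp: h_def)
  have h0: "h \<longlonglongrightarrow> 0" unfolding h_def by (rule LIMSEQ_Suc[OF lim_1_over_n])
  define D where "D k x = (f (x + h k *\<^sub>R axis i 1) - f x) / h k" for k x
  have fint: "integrable lborel f"
  proof -
    have "integrable lborel (\<lambda>x. indicat_real C x *\<^sub>R f x)"
      by (rule borel_integrable_compact[OF C(1) C1_compact_continuous(1)[OF f]])
    moreover have "(\<lambda>x. indicat_real C x *\<^sub>R f x) = f"
      using C(2) by (intro ext) (auto simp: indicator_def)
    ultimately show ?thesis by (simp only:)
  qed
  have ftint: "integrable lborel (\<lambda>x. f (x + c))" for c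
  proof -
    have "integrable (distr lborel borel ((+) c)) f" by (simp add: lborel_distr_plus fint)
    then show ?thesis by (subst (asm) integrable_distr_eq) (auto simp: add.commute)
  qed
  have D0: "(LINT x|lborel. D k x) = 0" for k
    unfolding D_def using fint ftint by (simp add: integral_translate)
  have "(\<lambda>k. LINT x|lborel. D k x) \<longlonglongrightarrow> (LINT x|lborel. partial i f x)"
  proof (rule integral_dominated_convergence)
    \<comment> \<open>All steps \<open>h k\<close> are at most 1, so every quotient vanishes outside
      the ball of radius \<open>R + 1\<close>; inside, the Lipschitz constant \<open>L\<close>
      dominates.\<close>
    show "integrable lborel (\<lambda>x. indicat_real (cball 0 (R + 1)) x *\<^sub>R L)"
      by (rule borel_integrable_compact) auto
    show "AE x in lborel. (\<lambda>k. D k x) \<longlonglongrightarrow> partial i f x"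
    proof (intro always_eventually allI)
      fix x
      have "((\<lambda>t. f (x + t *\<^sub>R axis i 1)) has_real_derivative grad f (x + 0 *\<^sub>R axis i 1) \<bullet> axis i 1) (at 0)"
        by (rule C1_compact_DERIV_line[OF f])
      then have "(\<lambda>t. (f (x + t *\<^sub>R axis i 1) - f x) / t) \<midarrow>0\<rightarrow> partial i f x"
        unfolding has_field_derivative_iff by (simp add: inner_axis grad_nth)
      moreover have "filterlim h (at 0) sequentially"
        unfolding filterlim_at using h0 by (simp add: less_imp_neq[OF h(1), symmetric])
      ultimately show "(\<lambda>k. D k x) \<longlonglongrightarrow> partial i f x"
        unfolding D_def by (rule filterlim_compose)
    qed
    show "AE x in lborel. norm (D k x) \<le> indicat_real (cball 0 (R + 1)) x *\<^sub>R L" for k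
    proof (intro always_eventually allI)
      fix x
      show "norm (D k x) \<le> indicat_real (cball 0 (R + 1)) x *\<^sub>R L"
      proof (cases "norm x \<le> R + 1")
        case True
        have "\<bar>f (x + h k *\<^sub>R axis i 1) - f x\<bar> \<le> L * h k"
          using C1_compact_lipschitz[OF f L(2), of "x + h k *\<^sub>R axis i 1" x] h(1)[of k] by simp
        then show ?thesis using True h(1)[of k] by (simp add: D_def divide_le_eq)
      next
        case False
        have "x \<notin> C" using R[of x] False by auto
        moreover have "x + h k *\<^sub>R axis i 1 \<notin> C"
        proof
          assume "x + h k *\<^sub>R axis i 1 \<in> C"
          then have "norm (x + h k *\<^sub>R axis i 1) \<le> R" by (rule R)
          moreover have "norm x \<le> norm (x + h k *\<^sub>R axis i (1::real)) + norm (h k *\<^sub>R axis i (1::real) :: real^'n)"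
            using norm_triangle_ineq4[of "x + h k *\<^sub>R axis i 1" "h k *\<^sub>R axis i 1"] by simp
          ultimately show False using False h[of k] by simp
        qed
        ultimately show ?thesis using C(2) False by (simp add: D_def)
      qed
    qed
  qed (unfold D_def, measurable)
  then show ?thesis unfolding D0 by (rule LIMSEQ_unique[OF tendsto_const, symmetric])
qed

text \<open>Averaging the lines over a slab of width 1 gives Fubini along an arbitrary direction.\<close>
lemma nn_integral_lines:
  fixes f :: "'a::euclidean_space \<Rightarrow> ennreal"
  assumes [measurable]: "f \<in> borel_measurable borel" and e: "norm e = 1"
  shows "(\<integral>\<^sup>+x. indicator {x. \<bar>x \<bullet> e\<bar> \<le> 1/2} x * (\<integral>\<^sup>+t. f (x + t *\<^sub>R e) \<partial>lborel) \<partial>lborel) = (\<integral>\<^sup>+x. f x \<partial>lborel)"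
proof -
  have ee: "e \<bullet> e = 1" using e by (simp add: dot_square_norm)
  define I where "I x = (indicator {x. \<bar>x \<bullet> e\<bar> \<le> 1/2} x :: ennreal)" for x
  have I_meas [measurable]: "I \<in> borel_measurable borel" unfolding I_def by measurable
  have "(\<integral>\<^sup>+x. I x * (\<integral>\<^sup>+t. f (x + t *\<^sub>R e) \<partial>lborel) \<partial>lborel) = (\<integral>\<^sup>+x. \<integral>\<^sup>+t. I x * f (x + t *\<^sub>R e) \<partial>lborel \<partial>lborel)"
    by (intro nn_integral_cong nn_integral_cmult[symmetric]) measurable
  also have "\<dots> = (\<integral>\<^sup>+t. \<integral>\<^sup>+x. I x * f (x + t *\<^sub>R e) \<partial>lborel \<partial>lborel)"
    by (rule lborel_pair.Fubini') measurable
  also have "\<dots> = (\<integral>\<^sup>+t. \<integral>\<^sup>+y. I (y - t *\<^sub>R e) * f y \<partial>lborel \<partial>lborel)"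
  proof (rule nn_integral_cong)
    fix t :: real
    have "(\<integral>\<^sup>+x. I ((x + t *\<^sub>R e) - t *\<^sub>R e) * f (x + t *\<^sub>R e) \<partial>lborel) = (\<integral>\<^sup>+y. I (y - t *\<^sub>R e) * f y \<partial>lborel)"
      by (rule nn_integral_translate[of "\<lambda>y. I (y - t *\<^sub>R e) * f y"]) measurable
    then show "(\<integral>\<^sup>+x. I x * f (x + t *\<^sub>R e) \<partial>lborel) = (\<integral>\<^sup>+y. I (y - t *\<^sub>R e) * f y \<partial>lborel)" by simp
  qed
  also have "\<dots> = (\<integral>\<^sup>+y. \<integral>\<^sup>+t. I (y - t *\<^sub>R e) * f y \<partial>lborel \<partial>lborel)"
    by (rule lborel_pair.Fubini') measurable
  also have "\<dots> = (\<integral>\<^sup>+y. f y \<partial>lborel)"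
  proof (intro nn_integral_cong)
    fix y
    have "(\<integral>\<^sup>+t. I (y - t *\<^sub>R e) * f y \<partial>lborel) = (\<integral>\<^sup>+t. indicator {y \<bullet> e - 1/2 .. y \<bullet> e + 1/2} t * f y \<partial>lborel)"
    proof (intro nn_integral_cong)
      fix t
      have "(y - t *\<^sub>R e) \<bullet> e = y \<bullet> e - t" by (simp add: inner_diff_left ee)
      moreover have "\<bar>y \<bullet> e - t\<bar> \<le> 1/2 \<longleftrightarrow> t \<in> {y \<bullet> e - 1/2 .. y \<bullet> e + 1/2}"
        unfolding abs_le_iff atLeastAtMost_iff by linarith
      ultimately show "I (y - t *\<^sub>R e) * f y = indicator {y \<bullet> e - 1/2 .. y \<bullet> e + 1/2} t * f y"
        by (simp only: I_def indicator_def mem_Collect_eq)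
    qed
    also have "\<dots> = f y" by (subst nn_integral_multc) auto
    finally show "(\<integral>\<^sup>+t. I (y - t *\<^sub>R e) * f y \<partial>lborel) = f y" .
  qed
  finally show ?thesis unfolding I_def .
qed

lemma nn_integral_mono_lines:
  fixes f g :: "'a::euclidean_space \<Rightarrow> ennreal"
  assumes "f \<in> borel_measurable borel" "g \<in> borel_measurable borel" "norm e = 1"
    and "\<And>x. (\<integral>\<^sup>+t. f (x + t *\<^sub>R e) \<partial>lborel) \<le> (\<integral>\<^sup>+t. g (x + t *\<^sub>R e) \<partial>lborel)"
  shows "(\<integral>\<^sup>+x. f x \<partial>lborel) \<le> (\<integral>\<^sup>+x. g x \<partial>lborel)"
  unfolding nn_integral_lines[OF assms(1,3), symmetric] nn_integral_lines[OF assms(2,3), symmetric]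
  by (intro nn_integral_mono mult_left_mono assms(4)) auto

text \<open>Hardy's inequality relative to the single endpoint \<open>b\<close>. \<open>P'\<close>
  is the derivative of \<open>(\<phi> t)\<^sup>2 / (b - t)\<close>, which vanishes at
  \<open>a\<close> and \<open>c\<close>, so its integral is 0. Adding twice \<open>P'\<close>
  completes a square: with \<open>z = \<phi> t / (b - t)\<close> the difference of the two sides
  becomes \<open>(2 * \<phi>' t + z)\<^sup>2\<close>. This is where the constant 4 comes
  from.\<close>

lemma hardy_interval:
  fixes \<phi> \<phi>' :: "real \<Rightarrow> real"
  assumes d: "\<And>t. (\<phi> has_real_derivative \<phi>' t) (at t)" and cont: "continuous_on UNIV \<phi>'"
    and ac: "a \<le> c" "c < b" and zero: "\<And>t. t \<le> a \<or> c \<le> t \<Longrightarrow> \<phi> t = 0"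
  shows "(\<integral>\<^sup>+t. ennreal ((\<phi> t)\<^sup>2 / (b - t)\<^sup>2) \<partial>lborel) \<le> (\<integral>\<^sup>+t. ennreal (4 * (\<phi>' t)\<^sup>2) \<partial>lborel)"
proof -
  have c\<phi>: "continuous_on UNIV \<phi>" by (rule DERIV_continuous_on[OF d])
  have nz: "b - t \<noteq> 0" if "t \<in> {a..c}" for t using that ac by auto
  define u where "u t = (\<phi> t)\<^sup>2 / (b - t)\<^sup>2" for t
  define w where "w t = 4 * (\<phi>' t)\<^sup>2" for t
  define P' where "P' t = 2 * \<phi> t * \<phi>' t / (b - t) + (\<phi> t)\<^sup>2 / (b - t)\<^sup>2" for t
  note conts = continuous_on_subset[OF c\<phi> subset_UNIV] continuous_on_subset[OF cont subset_UNIV]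
  have iu: "integrable lborel (\<lambda>t. indicat_real {a..c} t *\<^sub>R u t)"
    unfolding u_def using nz by (intro borel_integrable_compact continuous_intros conts) auto
  have iw: "integrable lborel (\<lambda>t. indicat_real {a..c} t *\<^sub>R w t)"
    unfolding w_def by (intro borel_integrable_compact continuous_intros conts) auto
  have cP: "continuous_on {a..c} P'"
    unfolding P'_def using nz by (intro continuous_intros conts) auto
  then have iP: "integrable lborel (\<lambda>t. indicat_real {a..c} t *\<^sub>R P' t)"
    by (intro borel_integrable_compact) auto
  have P0: "(LINT t|lborel. indicat_real {a..c} t *\<^sub>R P' t) = 0"
  proof -
    have "(LINT t|lborel. indicat_real {a..c} t *\<^sub>R P' t) = (\<phi> c)\<^sup>2 / (b - c) - (\<phi> a)\<^sup>2 / (b - a)"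
    proof (rule integral_FTC_Icc[OF ac(1) _ cP])
      fix t assume "a \<le> t" "t \<le> c"
      then have "b - t \<noteq> 0" using nz by auto
      have "P' t = (2 * \<phi> t * \<phi>' t * (b - t) + (\<phi> t)\<^sup>2) / ((b - t) * (b - t))"
        using \<open>b - t \<noteq> 0\<close> by (simp add: P'_def power2_eq_square add_divide_distrib)
      then have "((\<lambda>t. (\<phi> t)\<^sup>2 / (b - t)) has_real_derivative P' t) (at t)"
        using \<open>b - t \<noteq> 0\<close> by (auto intro!: derivative_eq_intros d)
      then show "((\<lambda>t. (\<phi> t)\<^sup>2 / (b - t)) has_vector_derivative P' t) (at t within {a..c})"
        by (simp add: has_real_derivative_iff_has_vector_derivative has_vector_derivative_at_within)
    qed
    then show ?thesis using zero[of a] zero[of c] by simp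
  qed
  have ptw: "u t \<le> w t + 2 * P' t" if "t \<in> {a..c}" for t
  proof -
    define z where "z = \<phi> t / (b - t)"
    have "w t + 2 * P' t - u t = 4 * (\<phi>' t)\<^sup>2 + 4 * (z * \<phi>' t) + z\<^sup>2"
      unfolding w_def P'_def u_def z_def by (simp add: power_divide)
    also have "\<dots> = (2 * \<phi>' t + z)\<^sup>2" by (simp add: power2_eq_square algebra_simps)
    finally show ?thesis using zero_le_power2[of "2 * \<phi>' t + z"] by linarith
  qed
  have "(LINT t|lborel. indicat_real {a..c} t *\<^sub>R u t)
      \<le> (LINT t|lborel. indicat_real {a..c} t *\<^sub>R w t + 2 * (indicat_real {a..c} t *\<^sub>R P' t))"
  proof (rule integral_mono)
    show "indicat_real {a..c} t *\<^sub>R u t \<le> indicat_real {a..c} t *\<^sub>R w t + 2 * (indicat_real {a..c} t *\<^sub>R P' t)" for t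
      using ptw[of t] by (cases "t \<in> {a..c}") auto
  qed (use iu iw iP in simp_all)
  also have "\<dots> = (LINT t|lborel. indicat_real {a..c} t *\<^sub>R w t)" using iw iP P0 by simp
  finally have le: "(LINT t|lborel. indicat_real {a..c} t *\<^sub>R u t) \<le> (LINT t|lborel. indicat_real {a..c} t *\<^sub>R w t)" .
  have "(\<integral>\<^sup>+t. ennreal (u t) \<partial>lborel) = (\<integral>\<^sup>+t. ennreal (indicat_real {a..c} t *\<^sub>R u t) \<partial>lborel)"
  proof (intro nn_integral_cong)
    fix t
    show "ennreal (u t) = ennreal (indicat_real {a..c} t *\<^sub>R u t)"
      using zero[of t] by (cases "t \<in> {a..c}") (auto simp: u_def)
  qed
  also have "\<dots> = ennreal (LINT t|lborel. indicat_real {a..c} t *\<^sub>R u t)"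
    by (intro nn_integral_eq_integral iu) (auto simp: u_def)
  also have "\<dots> \<le> ennreal (LINT t|lborel. indicat_real {a..c} t *\<^sub>R w t)" by (intro ennreal_leI le)
  also have "\<dots> = (\<integral>\<^sup>+t. ennreal (indicat_real {a..c} t *\<^sub>R w t) \<partial>lborel)"
    by (intro nn_integral_eq_integral[symmetric] iw) (auto simp: w_def)
  also have "\<dots> \<le> (\<integral>\<^sup>+t. ennreal (w t) \<partial>lborel)"
    by (intro nn_integral_mono ennreal_leI) (auto simp: indicator_def w_def)
  finally show ?thesis unfolding u_def w_def .
qed

text \<open>For convex \<open>K\<close> the supremum over the whole line is the distance at which
  the ray from \<open>x\<close> in direction \<open>e\<close> leaves \<open>K\<close>. Written as a
  supremum, \<open>a < exit_dist K e x\<close> becomes an existential statement, which makes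
  measurability easy. The value 0 outside \<open>K\<close> is only ever divided into a function
  vanishing there.\<close>

definition exit_dist :: "'a::euclidean_space set \<Rightarrow> 'a \<Rightarrow> 'a \<Rightarrow> real" where
  "exit_dist K e x = (if x \<in> K then Sup {s. x + s *\<^sub>R e \<in> K} else 0)"

lemma bdd_above_line:
  fixes K :: "'a::euclidean_space set"
  assumes "bounded K" "norm e = 1"
  shows "bdd_above {s. x + s *\<^sub>R e \<in> K}"
proof -
  obtain R where R: "\<And>y. y \<in> K \<Longrightarrow> norm y \<le> R" using assms(1) bounded_iff by blast
  have "s \<le> R + norm x" if "x + s *\<^sub>R e \<in> K" for s
    using norm_triangle_ineq4[of "x + s *\<^sub>R e" x] R[OF that] assms(2) by simp
  then show ?thesis by (intro bdd_aboveI[of _ "R + norm x"]) blast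
qed

lemma exit_dist_greater:
  assumes "bounded K" "norm e = 1" "x \<in> K"
  shows "a < exit_dist K e x \<longleftrightarrow> (\<exists>s>a. x + s *\<^sub>R e \<in> K)"
proof -
  have "{s. x + s *\<^sub>R e \<in> K} \<noteq> {}" using assms(3) by (auto intro: exI[of _ 0])
  from less_cSup_iff[OF this bdd_above_line[OF assms(1,2)]] show ?thesis
    using assms(3) by (auto simp: exit_dist_def)
qed

lemma exit_dist_pos:
  assumes "bounded K" "norm e = 1" "x \<in> K" "open K"
  shows "0 < exit_dist K e x"
proof -
  obtain r where r: "0 < r" "cball x r \<subseteq> K" using assms(3,4) open_contains_cball by blast
  then have "x + r *\<^sub>R e \<in> K" using assms(2) by (auto simp: dist_norm)
  then show ?thesis using r(1) exit_dist_greater[OF assms(1-3)] by blast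
qed

text \<open>Inside \<open>K\<close> the strict superlevel sets are unions of open sets, one for each
  \<open>s > a\<close>. For negative \<open>a\<close> the complement of \<open>K\<close> joins in,
  where the value is 0.\<close>

lemma exit_dist_measurable:
  assumes "bounded K" "norm e = 1" "open K"
  shows "exit_dist K e \<in> borel_measurable borel"
proof (rule borel_measurableI_greater)
  fix a
  have op: "open {x. \<exists>s>a. x \<in> K \<and> x + s *\<^sub>R e \<in> K}"
  proof -
    have "open ((\<lambda>x. x + s *\<^sub>R e) -` K)" for s
      using assms(3) by (intro open_vimage) (auto intro!: continuous_intros)
    then have "open (\<Union>s\<in>{a<..}. K \<inter> (\<lambda>x. x + s *\<^sub>R e) -` K)" using assms(3) by auto
    also have "(\<Union>s\<in>{a<..}. K \<inter> (\<lambda>x. x + s *\<^sub>R e) -` K) = {x. \<exists>s>a. x \<in> K \<and> x + s *\<^sub>R e \<in> K}" by auto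
    finally show ?thesis .
  qed
  have "{x \<in> space borel. a < exit_dist K e x} =
      {x. \<exists>s>a. x \<in> K \<and> x + s *\<^sub>R e \<in> K} \<union> (if a < 0 then - K else {})"
    using exit_dist_greater[OF assms(1,2)] by (auto simp: exit_dist_def)
  also have "\<dots> \<in> sets borel" using op assms(3) by auto
  finally show "{x \<in> space borel. a < exit_dist K e x} \<in> sets borel" .
qed

text \<open>On a fixed line the exit distance is \<open>b - t\<close>, where \<open>b\<close> is the
  supremum of the parameters inside \<open>K\<close>, since moving the base point only shifts the
  parameter set. The claim then reduces to \<open>hardy_interval\<close> line by line.\<close>

lemma hardy_direction:
  fixes K :: "(real^'n::finite) set"
  assumes K: "open K" "convex K" "bounded K" and e: "norm e = 1" and f: "f \<in> C1_compact K"
  shows "(\<integral>\<^sup>+x. ennreal ((f x)\<^sup>2 / (exit_dist K e x)\<^sup>2) \<partial>lborel) \<le> (\<integral>\<^sup>+x. ennreal (4 * (grad f x \<bullet> e)\<^sup>2) \<partial>lborel)"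
proof (rule nn_integral_mono_lines[OF _ _ e])
  note [measurable] = C1_compact_borel[OF f] exit_dist_measurable[OF K(3) e K(1)]
  show "(\<lambda>x. ennreal ((f x)\<^sup>2 / (exit_dist K e x)\<^sup>2)) \<in> borel_measurable borel" by measurable
  show "(\<lambda>x. ennreal (4 * (grad f x \<bullet> e)\<^sup>2)) \<in> borel_measurable borel" by measurable
  fix x
  obtain C where C: "compact C" "C \<subseteq> K" "\<And>x. x \<notin> C \<Longrightarrow> f x = 0" using C1_compact_support[OF f] by metis
  define T where "T = {t. x + t *\<^sub>R e \<in> K}"
  define S where "S = {t. x + t *\<^sub>R e \<in> C}"
  show "(\<integral>\<^sup>+t. ennreal ((f (x + t *\<^sub>R e))\<^sup>2 / (exit_dist K e (x + t *\<^sub>R e))\<^sup>2) \<partial>lborel)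
      \<le> (\<integral>\<^sup>+t. ennreal (4 * (grad f (x + t *\<^sub>R e) \<bullet> e)\<^sup>2) \<partial>lborel)"
  proof (cases "S = {}")
    case True
    then have "f (x + t *\<^sub>R e) = 0" for t using C(3) by (auto simp: S_def)
    then show ?thesis by simp
  next
    case False
    have bT: "bdd_above T" unfolding T_def by (rule bdd_above_line[OF K(3) e])
    have "compact S"
    proof -
      have "closed S" unfolding S_def
        using continuous_closed_vimage[OF compact_imp_closed[OF C(1)], of "\<lambda>t. x + t *\<^sub>R e"]
        by (simp add: vimage_def)
      moreover have "bounded S"
      proof -
        obtain R where R: "\<And>y. y \<in> C \<Longrightarrow> norm y \<le> R" using compact_imp_bounded[OF C(1)] bounded_iff by blast
        have "norm s \<le> R + norm x" if "s \<in> S" for s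
          using norm_triangle_ineq4[of "x + s *\<^sub>R e" x] R[of "x + s *\<^sub>R e"] that e by (simp add: S_def)
        then show ?thesis unfolding bounded_iff by blast
      qed
      ultimately show ?thesis by (simp add: compact_eq_bounded_closed)
    qed
    obtain a0 where a0: "\<And>s. s \<in> S \<Longrightarrow> a0 \<le> s" using compact_attains_inf[OF \<open>compact S\<close> False] by blast
    obtain c0 where c0: "c0 \<in> S" "\<And>s. s \<in> S \<Longrightarrow> s \<le> c0" using compact_attains_sup[OF \<open>compact S\<close> False] by blast
    define b where "b = Sup T"
    have "c0 < b"
    proof -
      have c0K: "x + c0 *\<^sub>R e \<in> K" using c0(1) C(2) by (auto simp: S_def)
      obtain s where "s > 0" "(x + c0 *\<^sub>R e) + s *\<^sub>R e \<in> K"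
        using exit_dist_pos[OF K(3) e c0K K(1)] exit_dist_greater[OF K(3) e c0K] by blast
      then have "c0 + s \<in> T" by (simp add: T_def algebra_simps)
      then have "c0 + s \<le> b" unfolding b_def by (rule cSup_upper[OF _ bT])
      then show ?thesis using \<open>s > 0\<close> by simp
    qed
    define c where "c = (c0 + b) / 2"
    define a where "a = a0 - 1"
    have exit: "exit_dist K e (x + t *\<^sub>R e) = b - t" if "t \<in> S" for t
    proof -
      have tK: "x + t *\<^sub>R e \<in> K" using that C(2) by (auto simp: S_def)
      have "T \<noteq> {}" using tK by (auto simp: T_def)
      have "{s. x + t *\<^sub>R e + s *\<^sub>R e \<in> K} = (\<lambda>s. s - t) ` T"
      proof (intro equalityI subsetI)
        fix s assume "s \<in> {s. x + t *\<^sub>R e + s *\<^sub>R e \<in> K}"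
        then have "t + s \<in> T" by (simp add: T_def algebra_simps)
        then show "s \<in> (\<lambda>s. s - t) ` T" by (auto intro: image_eqI[of _ _ "t + s"])
      qed (auto simp: T_def algebra_simps)
      moreover have "Sup ((\<lambda>s. s - t) ` T) = b - t"
      proof (rule cSup_eq_non_empty)
        show "s \<le> b - t" if "s \<in> (\<lambda>s. s - t) ` T" for s
          using that cSup_upper[OF _ bT] by (auto simp: b_def)
        fix y assume y: "\<And>s. s \<in> (\<lambda>s. s - t) ` T \<Longrightarrow> s \<le> y"
        have "b \<le> y + t" unfolding b_def
          by (rule cSup_least[OF \<open>T \<noteq> {}\<close>]) (use y in force)
        then show "b - t \<le> y" by simp
      qed (use \<open>T \<noteq> {}\<close> in simp)
      ultimately show ?thesis using tK by (simp add: exit_dist_def)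
    qed
    have "(\<integral>\<^sup>+t. ennreal ((f (x + t *\<^sub>R e))\<^sup>2 / (exit_dist K e (x + t *\<^sub>R e))\<^sup>2) \<partial>lborel) =
       (\<integral>\<^sup>+t. ennreal ((f (x + t *\<^sub>R e))\<^sup>2 / (b - t)\<^sup>2) \<partial>lborel)"
    proof (intro nn_integral_cong)
      fix t
      show "ennreal ((f (x + t *\<^sub>R e))\<^sup>2 / (exit_dist K e (x + t *\<^sub>R e))\<^sup>2) = ennreal ((f (x + t *\<^sub>R e))\<^sup>2 / (b - t)\<^sup>2)"
        using exit[of t] C(3)[of "x + t *\<^sub>R e"] by (cases "t \<in> S") (auto simp: S_def)
    qed
    also have "\<dots> \<le> (\<integral>\<^sup>+t. ennreal (4 * (grad f (x + t *\<^sub>R e) \<bullet> e)\<^sup>2) \<partial>lborel)"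
    proof (rule hardy_interval[where a = a and c = c])
      show "((\<lambda>t. f (x + t *\<^sub>R e)) has_real_derivative grad f (x + t *\<^sub>R e) \<bullet> e) (at t)" for t
        by (rule C1_compact_DERIV_line[OF f])
      show "continuous_on UNIV (\<lambda>t. grad f (x + t *\<^sub>R e) \<bullet> e)"
        by (intro continuous_intros continuous_on_compose2[OF C1_compact_continuous(3)[OF f, of UNIV]]) auto
      show "a \<le> c" "c < b" using \<open>c0 < b\<close> a0[OF c0(1)] by (auto simp: a_def c_def)
      show "f (x + t *\<^sub>R e) = 0" if "t \<le> a \<or> c \<le> t" for t
      proof (rule C(3), rule notI)
        assume "x + t *\<^sub>R e \<in> C"
        then have "t \<in> S" by (simp add: S_def)
        then show False using a0[of t] c0(2)[of t] that \<open>c0 < b\<close> by (auto simp: a_def c_def)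
      qed
    qed
    finally show ?thesis .
  qed
qed

lemma infdist_frontier:
  fixes K :: "'a::euclidean_space set"
  assumes "open K" "bounded K" "x \<in> K"
  shows "frontier K \<noteq> {}" "0 < infdist x (frontier K)"
proof -
  show ne: "frontier K \<noteq> {}"
    using assms not_bounded_UNIV[where 'a='a] by (auto simp: frontier_eq_empty)
  have "x \<notin> frontier K" using assms by (simp add: frontier_def interior_open)
  then show "0 < infdist x (frontier K)" using ne by (intro infdist_pos_not_in_closed frontier_closed)
qed

text \<open>A supporting hyperplane at the boundary point nearest to \<open>x\<close> bounds the exit distance along
  \<open>e\<close> by \<open>\<delta> / (n \<bullet> e)\<close>; the squares of the components of the unit normal \<open>n\<close> add up to 1.\<close>
lemma inverse_infdist_le:
  fixes K :: "(real^'n::finite) set"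
  assumes K: "open K" "convex K" "bounded K" and x: "x \<in> K"
  shows "1 / (infdist x (frontier K))\<^sup>2 \<le>
    (\<Sum>i\<in>UNIV. 1 / (exit_dist K (axis i 1) x)\<^sup>2 + 1 / (exit_dist K (- axis i 1) x)\<^sup>2)"
proof -
  define d where "d = infdist x (frontier K)"
  have d: "0 < d" unfolding d_def by (rule infdist_frontier[OF K(1,3) x])
  obtain y where y: "y \<in> frontier K" "d = dist x y"
    using infdist_attains_inf[OF frontier_closed infdist_frontier(1)[OF K(1,3) x], of x] unfolding d_def by blast
  have "y \<in> closure K" "y \<notin> rel_interior K"
    using y(1) K(1) by (auto simp: frontier_def interior_open rel_interior_open)
  then obtain a where a: "a \<noteq> 0" "\<And>z. z \<in> closure K \<Longrightarrow> a \<bullet> y \<le> a \<bullet> z"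
    using supporting_hyperplane_relative_frontier[OF K(2)] by metis
  \<comment> \<open>The outward unit normal: \<open>a\<close> points into the half-space containing
    \<open>K\<close>.\<close>
  define n where "n = - (1 / norm a) *\<^sub>R a"
  have n: "norm n = 1" using a(1) by (simp add: n_def)
  have exit: "exit_dist K e x * (n \<bullet> e) \<le> d" if e: "norm e = 1" and pos: "0 < n \<bullet> e" for e
  proof (rule ccontr)
    assume "\<not> ?thesis"
    then have "d / (n \<bullet> e) < exit_dist K e x" using pos by (simp add: pos_divide_less_eq)
    then obtain s where s: "d / (n \<bullet> e) < s" "x + s *\<^sub>R e \<in> K"
      using exit_dist_greater[OF K(3) e x] by blast
    have "a \<bullet> y \<le> a \<bullet> (x + s *\<^sub>R e)" using a(2) s(2) closure_subset by blast
    then have "n \<bullet> (x + s *\<^sub>R e) \<le> n \<bullet> y" using a(1) by (simp add: n_def divide_right_mono)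
    then have "s * (n \<bullet> e) \<le> n \<bullet> (y - x)" by (simp add: inner_add_right inner_diff_right)
    also have "\<dots> \<le> norm n * norm (y - x)" by (rule norm_cauchy_schwarz)
    also have "\<dots> = d" using n y(2) by (simp add: dist_norm norm_minus_commute)
    finally show False using s(1) pos by (simp add: pos_divide_less_eq)
  qed
  have sq: "(n \<bullet> e)\<^sup>2 / d\<^sup>2 \<le> 1 / (exit_dist K e x)\<^sup>2" if e: "norm e = 1" and pos: "0 < n \<bullet> e" for e
  proof -
    have ep: "0 < exit_dist K e x" by (rule exit_dist_pos[OF K(3) e x K(1)])
    have "(n \<bullet> e) / d \<le> 1 / exit_dist K e x"
      using exit[OF e pos] ep d by (simp add: field_simps)
    then have "((n \<bullet> e) / d)\<^sup>2 \<le> (1 / exit_dist K e x)\<^sup>2"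
      using pos d by (intro power_mono) auto
    then show ?thesis by (simp add: power_divide)
  qed
  \<comment> \<open>The sign of \<open>n $ i\<close> decides which of the two opposite directions
    crosses the hyperplane; the other one only adds a nonnegative term.\<close>
  have comp: "(n $ i)\<^sup>2 / d\<^sup>2 \<le> 1 / (exit_dist K (axis i 1) x)\<^sup>2 + 1 / (exit_dist K (- axis i 1) x)\<^sup>2" for i
  proof -
    have nn: "0 \<le> 1 / (exit_dist K e x)\<^sup>2" for e by simp
    consider "0 < n $ i" | "n $ i < 0" | "n $ i = 0" by linarith
    then show ?thesis
    proof cases
      case 1
      then have "(n $ i)\<^sup>2 / d\<^sup>2 \<le> 1 / (exit_dist K (axis i 1) x)\<^sup>2"
        using sq[of "axis i 1"] by (simp add: inner_axis)
      then show ?thesis using nn[of "- axis i 1"] by linarith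
    next
      case 2
      then have "(n $ i)\<^sup>2 / d\<^sup>2 \<le> 1 / (exit_dist K (- axis i 1) x)\<^sup>2"
        using sq[of "- axis i 1"] by (simp add: inner_axis)
      then show ?thesis using nn[of "axis i 1"] by linarith
    next
      case 3
      then show ?thesis using nn[of "axis i 1"] nn[of "- axis i 1"] by simp
    qed
  qed
  have "(\<Sum>i\<in>UNIV. (n $ i)\<^sup>2) = 1"
    using n by (simp add: norm_eq_sqrt_inner inner_vec_def power2_eq_square)
  then have "1 / d\<^sup>2 = (\<Sum>i\<in>UNIV. (n $ i)\<^sup>2 / d\<^sup>2)" by (simp flip: sum_divide_distrib)
  also have "\<dots> \<le> (\<Sum>i\<in>UNIV. 1 / (exit_dist K (axis i 1) x)\<^sup>2 + 1 / (exit_dist K (- axis i 1) x)\<^sup>2)"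
    by (intro sum_mono comp)
  finally show ?thesis unfolding d_def .
qed

text \<open>Summing the directional inequalities over the coordinate axes. The constant is the 4 of
  \<open>hardy_interval\<close>, doubled because each axis is used in both orientations.\<close>

lemma hardy_nn:
  fixes K :: "(real^'n::finite) set"
  assumes K: "open K" "convex K" "bounded K" and f: "f \<in> C1_compact K"
  shows "(\<integral>\<^sup>+x. ennreal ((f x)\<^sup>2 / (infdist x (frontier K))\<^sup>2) \<partial>lborel) \<le> (\<integral>\<^sup>+x. ennreal (8 * (norm (grad f x))\<^sup>2) \<partial>lborel)"
proof -
  let ?h = "\<lambda>e x. ennreal ((f x)\<^sup>2 / (exit_dist K e x)\<^sup>2)"
  have f0: "f x = 0" if "x \<notin> K" for x using C1_compact_support[OF f] that by (metis subsetD)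
  note [measurable] = C1_compact_borel[OF f] exit_dist_measurable[OF K(3) _ K(1)]
  have [measurable]: "(\<lambda>x. grad f x $ i) \<in> borel_measurable borel" for i
    unfolding grad_nth by (rule C1_compact_borel(2)[OF f])
  have [measurable]: "?h (axis i 1) \<in> borel_measurable borel" "?h (- axis i 1) \<in> borel_measurable borel" for i
    by measurable
  have "(\<integral>\<^sup>+x. ennreal ((f x)\<^sup>2 / (infdist x (frontier K))\<^sup>2) \<partial>lborel)
      \<le> (\<integral>\<^sup>+x. (\<Sum>i\<in>UNIV. ?h (axis i 1) x + ?h (- axis i 1) x) \<partial>lborel)"
  proof (intro nn_integral_mono)
    fix x
    show "ennreal ((f x)\<^sup>2 / (infdist x (frontier K))\<^sup>2) \<le> (\<Sum>i\<in>UNIV. ?h (axis i 1) x + ?h (- axis i 1) x)"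
    proof (cases "x \<in> K")
      case True
      have "(f x)\<^sup>2 / (infdist x (frontier K))\<^sup>2 \<le>
          (f x)\<^sup>2 * (\<Sum>i\<in>UNIV. 1 / (exit_dist K (axis i 1) x)\<^sup>2 + 1 / (exit_dist K (- axis i 1) x)\<^sup>2)"
        using mult_left_mono[OF inverse_infdist_le[OF K True] zero_le_power2[of "f x"]] by simp
      then have "(f x)\<^sup>2 / (infdist x (frontier K))\<^sup>2 \<le>
          (\<Sum>i\<in>UNIV. (f x)\<^sup>2 / (exit_dist K (axis i 1) x)\<^sup>2 + (f x)\<^sup>2 / (exit_dist K (- axis i 1) x)\<^sup>2)"
        by (simp add: sum_distrib_left distrib_left)
      then have "ennreal ((f x)\<^sup>2 / (infdist x (frontier K))\<^sup>2) \<le>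
          ennreal (\<Sum>i\<in>UNIV. (f x)\<^sup>2 / (exit_dist K (axis i 1) x)\<^sup>2 + (f x)\<^sup>2 / (exit_dist K (- axis i 1) x)\<^sup>2)"
        by (rule ennreal_leI)
      then show ?thesis by (simp add: sum_ennreal[symmetric] ennreal_plus)
    next
      case False
      then show ?thesis by (simp add: f0)
    qed
  qed
  also have "\<dots> = (\<Sum>i\<in>UNIV. (\<integral>\<^sup>+x. ?h (axis i 1) x \<partial>lborel) + (\<integral>\<^sup>+x. ?h (- axis i 1) x \<partial>lborel))"
    by (subst nn_integral_sum) (auto intro!: sum.cong nn_integral_add)
  also have "\<dots> \<le> (\<Sum>i\<in>UNIV. (\<integral>\<^sup>+x. ennreal (4 * (grad f x \<bullet> axis i 1)\<^sup>2) \<partial>lborel) + (\<integral>\<^sup>+x. ennreal (4 * (grad f x \<bullet> - axis i 1)\<^sup>2) \<partial>lborel))"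
    by (intro sum_mono add_mono hardy_direction K f) simp_all
  also have "\<dots> = (\<Sum>i\<in>UNIV. \<integral>\<^sup>+x. ennreal (8 * (grad f x $ i)\<^sup>2) \<partial>lborel)"
  proof (rule sum.cong[OF refl])
    fix i
    have "(\<integral>\<^sup>+x. ennreal (4 * (grad f x \<bullet> axis i 1)\<^sup>2) \<partial>lborel) + (\<integral>\<^sup>+x. ennreal (4 * (grad f x \<bullet> - axis i 1)\<^sup>2) \<partial>lborel)
        = (\<integral>\<^sup>+x. ennreal (4 * (grad f x \<bullet> axis i 1)\<^sup>2) + ennreal (4 * (grad f x \<bullet> - axis i 1)\<^sup>2) \<partial>lborel)"
      by (subst nn_integral_add) auto
    also have "\<dots> = (\<integral>\<^sup>+x. ennreal (8 * (grad f x $ i)\<^sup>2) \<partial>lborel)"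
      by (intro nn_integral_cong) (simp add: inner_axis flip: ennreal_plus)
    finally show "(\<integral>\<^sup>+x. ennreal (4 * (grad f x \<bullet> axis i 1)\<^sup>2) \<partial>lborel) + (\<integral>\<^sup>+x. ennreal (4 * (grad f x \<bullet> - axis i 1)\<^sup>2) \<partial>lborel)
        = (\<integral>\<^sup>+x. ennreal (8 * (grad f x $ i)\<^sup>2) \<partial>lborel)" .
  qed
  also have "\<dots> = (\<integral>\<^sup>+x. (\<Sum>i\<in>UNIV. ennreal (8 * (grad f x $ i)\<^sup>2)) \<partial>lborel)"
    by (subst nn_integral_sum) auto
  also have "\<dots> = (\<integral>\<^sup>+x. ennreal (8 * (norm (grad f x))\<^sup>2) \<partial>lborel)"
  proof (intro nn_integral_cong)
    fix x
    have "(norm (grad f x))\<^sup>2 = (\<Sum>i\<in>UNIV. (grad f x $ i)\<^sup>2)"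
      unfolding power2_norm_eq_inner inner_vec_def by (simp add: power2_eq_square)
    then show "(\<Sum>i\<in>UNIV. ennreal (8 * (grad f x $ i)\<^sup>2)) = ennreal (8 * (norm (grad f x))\<^sup>2)"
      by (simp add: sum_ennreal sum_distrib_left)
  qed
  finally show ?thesis .
qed

section \<open>Hardy and Poincare for integrals over \<open>lebesgue_on K\<close>\<close>

lemma nn_integral_compact_support:
  fixes h :: "real^'n::finite \<Rightarrow> real"
  assumes "open K" "compact C" "C \<subseteq> K" "continuous_on C h" "\<And>x. x \<notin> C \<Longrightarrow> h x = 0" "\<And>x. 0 \<le> h x"
  shows "(\<integral>\<^sup>+x. ennreal (h x) \<partial>lborel) = ennreal (LINT x|lebesgue_on K. h x)"
proof -
  have "(\<integral>\<^sup>+x. ennreal (h x) \<partial>lborel) = (\<integral>\<^sup>+x. ennreal (h x) \<partial>lebesgue_on K)"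
    using assms by (intro nn_integral_lebesgue_on_eq_lborel[symmetric]) auto
  also have "\<dots> = ennreal (LINT x|lebesgue_on K. h x)"
    using assms by (intro nn_integral_eq_integral integrable_lebesgue_on_compact_support[of K C]) auto
  finally show ?thesis .
qed

lemma C1_compact_square_integral:
  assumes "open K" and f: "f \<in> C1_compact K"
  shows "integrable (lebesgue_on K) (\<lambda>x. (f x)\<^sup>2)" "integrable (lebesgue_on K) (\<lambda>x. (norm (grad f x))\<^sup>2)"
    "(\<integral>\<^sup>+x. ennreal ((f x)\<^sup>2) \<partial>lborel) = ennreal (LINT x|lebesgue_on K. (f x)\<^sup>2)"
    "(\<integral>\<^sup>+x. ennreal ((norm (grad f x))\<^sup>2) \<partial>lborel) = ennreal (LINT x|lebesgue_on K. (norm (grad f x))\<^sup>2)"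
proof -
  obtain C where C: "compact C" "C \<subseteq> K" "\<And>x. x \<notin> C \<Longrightarrow> f x = 0" "\<And>x. x \<notin> C \<Longrightarrow> grad f x = 0"
    using C1_compact_support[OF f] by metis
  have 1: "continuous_on C (\<lambda>x. (f x)\<^sup>2)" "continuous_on C (\<lambda>x. (norm (grad f x))\<^sup>2)"
    by (intro continuous_intros C1_compact_continuous[OF f])+
  show "integrable (lebesgue_on K) (\<lambda>x. (f x)\<^sup>2)" "integrable (lebesgue_on K) (\<lambda>x. (norm (grad f x))\<^sup>2)"
    using C(3,4) by (auto intro!: integrable_lebesgue_on_compact_support[OF assms(1) C(1,2)] 1)
  show "(\<integral>\<^sup>+x. ennreal ((f x)\<^sup>2) \<partial>lborel) = ennreal (LINT x|lebesgue_on K. (f x)\<^sup>2)"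
    "(\<integral>\<^sup>+x. ennreal ((norm (grad f x))\<^sup>2) \<partial>lborel) = ennreal (LINT x|lebesgue_on K. (norm (grad f x))\<^sup>2)"
    using C(3,4) by (auto intro!: nn_integral_compact_support[OF assms(1) C(1,2)] 1)
qed

lemma hardy:
  fixes K :: "(real^'n::finite) set"
  assumes K: "open K" "convex K" "bounded K" and f: "f \<in> C1_compact K"
  shows "integrable (lebesgue_on K) (\<lambda>x. (f x)\<^sup>2 / (infdist x (frontier K))\<^sup>2)"
    "(LINT x|lebesgue_on K. (f x)\<^sup>2 / (infdist x (frontier K))\<^sup>2) \<le> 8 * (LINT x|lebesgue_on K. (norm (grad f x))\<^sup>2)"
proof -
  obtain C where C: "compact C" "C \<subseteq> K" "\<And>x. x \<notin> C \<Longrightarrow> f x = 0" "\<And>x. x \<notin> C \<Longrightarrow> grad f x = 0"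
    using C1_compact_support[OF f] by metis
  have nz: "infdist x (frontier K) \<noteq> 0" if "x \<in> C" for x
    using infdist_frontier(2)[OF K(1,3), of x] that C(2) by auto
  have cont: "continuous_on C (\<lambda>x. (f x)\<^sup>2 / (infdist x (frontier K))\<^sup>2)"
    using nz by (intro continuous_intros C1_compact_continuous[OF f]) auto
  show "integrable (lebesgue_on K) (\<lambda>x. (f x)\<^sup>2 / (infdist x (frontier K))\<^sup>2)"
    by (rule integrable_lebesgue_on_compact_support[OF K(1) C(1,2) cont]) (simp add: C(3))
  have eq: "(\<integral>\<^sup>+x. ennreal ((f x)\<^sup>2 / (infdist x (frontier K))\<^sup>2) \<partial>lborel)
      = ennreal (LINT x|lebesgue_on K. (f x)\<^sup>2 / (infdist x (frontier K))\<^sup>2)"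
    by (rule nn_integral_compact_support[OF K(1) C(1,2) cont]) (simp_all add: C(3))
  have "(\<integral>\<^sup>+x. ennreal (8 * (norm (grad f x))\<^sup>2) \<partial>lborel) = ennreal (LINT x|lebesgue_on K. 8 * (norm (grad f x))\<^sup>2)"
    by (rule nn_integral_compact_support[OF K(1) C(1,2)]) (auto simp: C(4) intro!: continuous_intros C1_compact_continuous[OF f])
  then have "ennreal (LINT x|lebesgue_on K. (f x)\<^sup>2 / (infdist x (frontier K))\<^sup>2)
      \<le> ennreal (8 * (LINT x|lebesgue_on K. (norm (grad f x))\<^sup>2))"
    using hardy_nn[OF K f] unfolding eq by simp
  then show "(LINT x|lebesgue_on K. (f x)\<^sup>2 / (infdist x (frontier K))\<^sup>2) \<le> 8 * (LINT x|lebesgue_on K. (norm (grad f x))\<^sup>2)"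
    by (subst (asm) ennreal_le_iff) auto
qed

text \<open>A consequence of Hardy: the distance to the boundary is at most some \<open>R\<close> on
  a bounded set, hence
  \<open>f\<^sup>2 \<le> R\<^sup>2 * (f\<^sup>2 / \<delta>\<^sup>2)\<close>.\<close>

lemma poincare:
  fixes K :: "(real^'n::finite) set"
  assumes K: "open K" "convex K" "bounded K"
  obtains D where "0 \<le> D"
    "\<And>f. f \<in> C1_compact K \<Longrightarrow> (LINT x|lebesgue_on K. (f x)\<^sup>2) \<le> D * (LINT x|lebesgue_on K. (norm (grad f x))\<^sup>2)"
proof -
  obtain R where R: "\<And>x. x \<in> K \<Longrightarrow> infdist x (frontier K) \<le> R"
  proof (cases "K = {}")
    case False
    then obtain p where p: "p \<in> frontier K" using infdist_frontier(1)[OF K(1,3)] by blast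
    obtain r where r: "\<And>x. x \<in> K \<Longrightarrow> dist p x \<le> r" using K(3) bounded_any_center[of K p] by blast
    have "infdist x (frontier K) \<le> r" if "x \<in> K" for x
      using infdist_le[OF p, of x] r[OF that] by (simp add: dist_commute)
    then show ?thesis using that by blast
  qed (use that in blast)
  show ?thesis
  proof
    show "0 \<le> R\<^sup>2 * 8" by simp
    fix f assume f: "f \<in> C1_compact K"
    note H = hardy[OF K f]
    have "(LINT x|lebesgue_on K. (f x)\<^sup>2) \<le> (LINT x|lebesgue_on K. R\<^sup>2 * ((f x)\<^sup>2 / (infdist x (frontier K))\<^sup>2))"
    proof (intro integral_mono C1_compact_square_integral[OF K(1) f] integrable_mult_right H(1))
      fix x assume "x \<in> space (lebesgue_on K)"
      then have x: "x \<in> K" by simp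
      define d where "d = infdist x (frontier K)"
      have d: "0 < d" "d \<le> R" unfolding d_def using infdist_frontier(2)[OF K(1,3) x] R[OF x] by auto
      have "d\<^sup>2 * (f x)\<^sup>2 \<le> R\<^sup>2 * (f x)\<^sup>2" using d by (intro mult_right_mono power_mono) auto
      then show "(f x)\<^sup>2 \<le> R\<^sup>2 * ((f x)\<^sup>2 / (infdist x (frontier K))\<^sup>2)"
        unfolding d_def[symmetric] using d by (simp add: field_simps)
    qed
    also have "\<dots> = R\<^sup>2 * (LINT x|lebesgue_on K. (f x)\<^sup>2 / (infdist x (frontier K))\<^sup>2)"
      by (rule integral_mult_right_zero)
    also have "\<dots> \<le> R\<^sup>2 * (8 * (LINT x|lebesgue_on K. (norm (grad f x))\<^sup>2))"
      by (intro mult_left_mono H(2)) auto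
    finally show "(LINT x|lebesgue_on K. (f x)\<^sup>2) \<le> R\<^sup>2 * 8 * (LINT x|lebesgue_on K. (norm (grad f x))\<^sup>2)"
      by (simp add: mult.assoc)
  qed
qed

section \<open>Estimates on small sets and of the drift\<close>

text \<open>The increment \<open>m = f (x + y) - f x\<close> is the mean over the unit interval of
  the derivative along the segment. The mean square of that derivative is at least
  \<open>m\<^sup>2\<close> because its variance is nonnegative; Fubini and translation invariance
  then remove the parameter \<open>t\<close>.\<close>

lemma translation_estimate:
  fixes f :: "real^'n::finite \<Rightarrow> real"
  assumes f: "f \<in> C1_compact K"
  shows "(\<integral>\<^sup>+x. ennreal ((f (x + y) - f x)\<^sup>2) \<partial>lborel) \<le> ennreal ((norm y)\<^sup>2) * (\<integral>\<^sup>+x. ennreal ((norm (grad f x))\<^sup>2) \<partial>lborel)"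
proof -
  note [measurable] = C1_compact_borel[OF f]
  let ?I = "\<lambda>t::real. indicator {0..1} t :: ennreal"
  have ptw: "ennreal ((f (x + y) - f x)\<^sup>2) \<le> (\<integral>\<^sup>+t. ?I t * (ennreal ((norm y)\<^sup>2) * ennreal ((norm (grad f (x + t *\<^sub>R y)))\<^sup>2)) \<partial>lborel)" for x
  proof -
    define g' where "g' t = grad f (x + t *\<^sub>R y) \<bullet> y" for t
    define m where "m = f (x + y) - f x"
    have cont: "continuous_on {0..1} g'" unfolding g'_def
      by (intro continuous_intros continuous_on_compose2[OF C1_compact_continuous(3)[OF f, of UNIV]]) auto
    have i1: "integrable lborel (\<lambda>t. indicat_real {0..1} t *\<^sub>R g' t)"
      by (rule borel_integrable_compact[OF _ cont]) auto
    have i2: "integrable lborel (\<lambda>t. indicat_real {0..1} t *\<^sub>R (g' t)\<^sup>2)"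
      by (intro borel_integrable_compact continuous_intros cont) auto
    have "(LINT t|lborel. indicat_real {0..1} t *\<^sub>R g' t) = f (x + 1 *\<^sub>R y) - f (x + 0 *\<^sub>R y)"
    proof (rule integral_FTC_Icc[OF _ _ cont])
      show "((\<lambda>t. f (x + t *\<^sub>R y)) has_vector_derivative g' t) (at t within {0..1})" for t
        using C1_compact_DERIV_line[OF f, of x y t] unfolding g'_def
        by (simp add: has_real_derivative_iff_has_vector_derivative has_vector_derivative_at_within)
    qed simp
    then have m1: "(LINT t|lborel. indicat_real {0..1} t *\<^sub>R g' t) = m" by (simp add: m_def)
    have i3: "integrable lborel (\<lambda>t::real. indicat_real {0..1} t *\<^sub>R m\<^sup>2)"
      by (intro borel_integrable_compact continuous_intros compact_Icc)
    have m3: "(LINT t::real|lborel. indicat_real {0..1} t *\<^sub>R m\<^sup>2) = m\<^sup>2" by simp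
    have "0 \<le> (LINT t|lborel. indicat_real {0..1} t *\<^sub>R (g' t)\<^sup>2 - 2 * m * (indicat_real {0..1} t *\<^sub>R g' t) + indicat_real {0..1} t *\<^sub>R m\<^sup>2)"
    proof (rule Bochner_Integration.integral_nonneg)
      fix t
      have "0 \<le> (g' t)\<^sup>2 - 2 * m * g' t + m\<^sup>2" using zero_le_power2[of "g' t - m"] by (simp add: power2_diff algebra_simps)
      then show "0 \<le> indicat_real {0..1} t *\<^sub>R (g' t)\<^sup>2 - 2 * m * (indicat_real {0..1} t *\<^sub>R g' t) + indicat_real {0..1} t *\<^sub>R m\<^sup>2"
        by (cases "t \<in> {0..1}") auto
    qed
    also have "\<dots> = (LINT t|lborel. indicat_real {0..1} t *\<^sub>R (g' t)\<^sup>2) - 2 * m * m + m\<^sup>2"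
      using i1 i2 i3 m1 m3 by simp
    finally have "m\<^sup>2 \<le> (LINT t|lborel. indicat_real {0..1} t *\<^sub>R (g' t)\<^sup>2)" by (simp add: power2_eq_square)
    then have "ennreal (m\<^sup>2) \<le> ennreal (LINT t|lborel. indicat_real {0..1} t *\<^sub>R (g' t)\<^sup>2)" by (rule ennreal_leI)
    also have "\<dots> = (\<integral>\<^sup>+t. ennreal (indicat_real {0..1} t *\<^sub>R (g' t)\<^sup>2) \<partial>lborel)"
      by (intro nn_integral_eq_integral[symmetric] i2) auto
    also have "\<dots> \<le> (\<integral>\<^sup>+t. ?I t * (ennreal ((norm y)\<^sup>2) * ennreal ((norm (grad f (x + t *\<^sub>R y)))\<^sup>2)) \<partial>lborel)"
    proof (intro nn_integral_mono)
      fix t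
      have "\<bar>g' t\<bar> \<le> norm y * norm (grad f (x + t *\<^sub>R y))"
        unfolding g'_def using Cauchy_Schwarz_ineq2[of "grad f (x + t *\<^sub>R y)" y] by (simp add: mult.commute)
      then have "(g' t)\<^sup>2 \<le> (norm y)\<^sup>2 * (norm (grad f (x + t *\<^sub>R y)))\<^sup>2"
        by (metis abs_ge_zero power2_abs power_mono power_mult_distrib)
      then have "ennreal ((g' t)\<^sup>2) \<le> ennreal ((norm y)\<^sup>2) * ennreal ((norm (grad f (x + t *\<^sub>R y)))\<^sup>2)"
        by (subst ennreal_mult[symmetric]) (auto intro: ennreal_leI)
      then show "ennreal (indicat_real {0..1} t *\<^sub>R (g' t)\<^sup>2) \<le> ?I t * (ennreal ((norm y)\<^sup>2) * ennreal ((norm (grad f (x + t *\<^sub>R y)))\<^sup>2))"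
        by (cases "t \<in> {0..1}") auto
    qed
    finally show ?thesis unfolding m_def .
  qed
  have "(\<integral>\<^sup>+x. ennreal ((f (x + y) - f x)\<^sup>2) \<partial>lborel) \<le>
      (\<integral>\<^sup>+x. \<integral>\<^sup>+t. ?I t * (ennreal ((norm y)\<^sup>2) * ennreal ((norm (grad f (x + t *\<^sub>R y)))\<^sup>2)) \<partial>lborel \<partial>lborel)"
    by (rule nn_integral_mono) (rule ptw)
  also have "\<dots> = (\<integral>\<^sup>+t. \<integral>\<^sup>+x. ?I t * (ennreal ((norm y)\<^sup>2) * ennreal ((norm (grad f (x + t *\<^sub>R y)))\<^sup>2)) \<partial>lborel \<partial>lborel)"
    by (rule lborel_pair.Fubini') measurable
  also have "\<dots> = (\<integral>\<^sup>+t. ?I t * (ennreal ((norm y)\<^sup>2) * (\<integral>\<^sup>+x. ennreal ((norm (grad f x))\<^sup>2) \<partial>lborel)) \<partial>lborel)"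
  proof (rule nn_integral_cong)
    fix t :: real
    have "(\<integral>\<^sup>+x. ?I t * (ennreal ((norm y)\<^sup>2) * ennreal ((norm (grad f (x + t *\<^sub>R y)))\<^sup>2)) \<partial>lborel)
        = ?I t * (ennreal ((norm y)\<^sup>2) * (\<integral>\<^sup>+x. ennreal ((norm (grad f (x + t *\<^sub>R y)))\<^sup>2) \<partial>lborel))"
      by (simp add: nn_integral_cmult)
    also have "(\<integral>\<^sup>+x. ennreal ((norm (grad f (x + t *\<^sub>R y)))\<^sup>2) \<partial>lborel) = (\<integral>\<^sup>+x. ennreal ((norm (grad f x))\<^sup>2) \<partial>lborel)"
      by (rule nn_integral_translate[of "\<lambda>x. ennreal ((norm (grad f x))\<^sup>2)"]) measurable
    finally show "(\<integral>\<^sup>+x. ?I t * (ennreal ((norm y)\<^sup>2) * ennreal ((norm (grad f (x + t *\<^sub>R y)))\<^sup>2)) \<partial>lborel)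
        = ?I t * (ennreal ((norm y)\<^sup>2) * (\<integral>\<^sup>+x. ennreal ((norm (grad f x))\<^sup>2) \<partial>lborel))" .
  qed
  also have "\<dots> = ennreal ((norm y)\<^sup>2) * (\<integral>\<^sup>+x. ennreal ((norm (grad f x))\<^sup>2) \<partial>lborel)"
    by (subst nn_integral_multc) auto
  finally show ?thesis .
qed

text \<open>A quantitative form of compactness: average \<open>f x\<^sup>2 \<le> 2 (f (x + y) - f x)\<^sup>2 + 2 f (x + y)\<^sup>2\<close> over
  a small ball of translations \<open>y\<close>.\<close>
lemma small_set_estimate:
  fixes K :: "(real^'n::finite) set"
  assumes K: "open K" "bounded K" and \<theta>: "0 < \<theta>"
  obtains C where "0 \<le> C"
    "\<And>f E. f \<in> C1_compact K \<Longrightarrow> E \<in> sets borel \<Longrightarrow> E \<subseteq> K \<Longrightarrow>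
      (LINT x|lebesgue_on K. indicat_real E x * (f x)\<^sup>2) \<le>
      \<theta> * (LINT x|lebesgue_on K. (norm (grad f x))\<^sup>2) + C * measure lborel E * (LINT x|lebesgue_on K. (f x)\<^sup>2)"
proof -
  \<comment> \<open>For translations shorter than \<open>r\<close> the difference term costs at most
    \<open>2 * r\<^sup>2 = \<theta>\<close> times the gradient integral.\<close>
  define r where "r = sqrt (\<theta> / 2)"
  have r: "0 < r" "2 * r\<^sup>2 = \<theta>" using \<theta> by (auto simp: r_def)
  define b where "b = (ball 0 r :: (real^'n) set)"
  define v where "v = measure lborel b"
  have v: "0 < v" unfolding v_def b_def using r(1) by (simp add: content_ball_pos)
  have ev: "emeasure lborel b = ennreal v"
    unfolding v_def b_def using emeasure_lborel_ball_finite[of "0 :: real^'n" r]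
    by (intro emeasure_eq_ennreal_measure) (simp add: less_imp_neq)
  have [measurable]: "b \<in> sets borel" by (simp add: b_def)
  show ?thesis
  proof
    show "0 \<le> 2 / v" using v by simp
    fix f :: "real^'n \<Rightarrow> real" and E :: "(real^'n) set"
    assume f: "f \<in> C1_compact K" and E [measurable]: "E \<in> sets borel" and EK: "E \<subseteq> K"
    note [measurable] = C1_compact_borel[OF f]
    define G where "G = (LINT x|lebesgue_on K. (norm (grad f x))\<^sup>2)"
    define F where "F = (LINT x|lebesgue_on K. (f x)\<^sup>2)"
    define H where "H = (LINT x|lebesgue_on K. indicat_real E x * (f x)\<^sup>2)"
    define m where "m = measure lborel E"
    have nn: "0 \<le> G" "0 \<le> F" "0 \<le> H" "0 \<le> m" by (auto simp: G_def F_def H_def m_def)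
    have "bounded E" using EK K(2) by (rule bounded_subset[rotated])
    then have em: "emeasure lborel E = ennreal m"
      unfolding m_def using emeasure_bounded_finite[of E] by (intro emeasure_eq_ennreal_measure) (simp add: less_imp_neq)
    have intE: "integrable (lebesgue_on K) (\<lambda>x. indicat_real E x * (f x)\<^sup>2)"
    proof (rule Bochner_Integration.integrable_bound[OF C1_compact_square_integral(1)[OF K(1) f]])
      have "(\<lambda>x. indicat_real E x * (f x)\<^sup>2) \<in> borel_measurable lebesgue"
        by (intro measurable_completion) measurable
      then show "(\<lambda>x. indicat_real E x * (f x)\<^sup>2) \<in> borel_measurable (lebesgue_on K)"
        by (rule measurable_restrict_space1)
    qed (auto simp: indicator_def)
    have H: "(\<integral>\<^sup>+x. indicator E x * ennreal ((f x)\<^sup>2) \<partial>lborel) = ennreal H"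
    proof -
      have "(\<integral>\<^sup>+x. indicator E x * ennreal ((f x)\<^sup>2) \<partial>lborel) = (\<integral>\<^sup>+x. ennreal (indicat_real E x * (f x)\<^sup>2) \<partial>lborel)"
        by (intro nn_integral_cong) (auto simp: indicator_def)
      also have "\<dots> = (\<integral>\<^sup>+x. ennreal (indicat_real E x * (f x)\<^sup>2) \<partial>lebesgue_on K)"
        using EK by (intro nn_integral_lebesgue_on_eq_lborel[symmetric] K) (auto simp: indicator_def)
      also have "\<dots> = ennreal H" unfolding H_def by (intro nn_integral_eq_integral intE) auto
      finally show ?thesis .
    qed
    note FG = C1_compact_square_integral(3,4)[OF K(1) f, folded F_def G_def]
    have "ennreal v * ennreal H = (\<integral>\<^sup>+y. indicator b y * (\<integral>\<^sup>+x. indicator E x * ennreal ((f x)\<^sup>2) \<partial>lborel) \<partial>lborel)"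
      unfolding H by (subst nn_integral_multc) (auto simp: ev)
    also have "\<dots> = (\<integral>\<^sup>+y. \<integral>\<^sup>+x. indicator b y * (indicator E x * ennreal ((f x)\<^sup>2)) \<partial>lborel \<partial>lborel)"
      by (simp add: nn_integral_cmult)
    \<comment> \<open>A different indicator is dropped in each summand. The difference keeps the
      restriction to small \<open>y\<close> and is integrated over all \<open>x\<close>; the other
      term keeps \<open>x\<close> in \<open>E\<close> and is integrated over all \<open>y\<close>,
      which gives the measure of \<open>E\<close> times the full integral of
      \<open>f\<^sup>2\<close>.\<close>
    also have "\<dots> \<le> (\<integral>\<^sup>+y. \<integral>\<^sup>+x. indicator b y * (2 * ennreal ((f (x + y) - f x)\<^sup>2)) + indicator E x * (2 * ennreal ((f (x + y))\<^sup>2)) \<partial>lborel \<partial>lborel)"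
    proof (intro nn_integral_mono)
      fix x y
      have "(f x)\<^sup>2 \<le> 2 * (f (x + y) - f x)\<^sup>2 + 2 * (f (x + y))\<^sup>2"
      proof -
        have "0 \<le> (2 * f (x + y) - f x)\<^sup>2" by simp
        then show ?thesis by (simp add: power2_eq_square algebra_simps)
      qed
      then have "ennreal ((f x)\<^sup>2) \<le> ennreal (2 * (f (x + y) - f x)\<^sup>2 + 2 * (f (x + y))\<^sup>2)" by (rule ennreal_leI)
      also have "\<dots> = 2 * ennreal ((f (x + y) - f x)\<^sup>2) + 2 * ennreal ((f (x + y))\<^sup>2)"
        by (simp add: ennreal_plus ennreal_mult)
      finally show "indicator b y * (indicator E x * ennreal ((f x)\<^sup>2))
          \<le> indicator b y * (2 * ennreal ((f (x + y) - f x)\<^sup>2)) + indicator E x * (2 * ennreal ((f (x + y))\<^sup>2))"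
        by (auto simp: indicator_def)
    qed
    also have "\<dots> = (\<integral>\<^sup>+y. indicator b y * (2 * (\<integral>\<^sup>+x. ennreal ((f (x + y) - f x)\<^sup>2) \<partial>lborel)) \<partial>lborel)
       + (\<integral>\<^sup>+y. \<integral>\<^sup>+x. indicator E x * (2 * ennreal ((f (x + y))\<^sup>2)) \<partial>lborel \<partial>lborel)"
      by (simp add: nn_integral_add nn_integral_cmult)
    also have "\<dots> \<le> ennreal (v * (\<theta> * G)) + ennreal (m * (2 * F))"
    proof (rule add_mono)
      have "(\<integral>\<^sup>+y. indicator b y * (2 * (\<integral>\<^sup>+x. ennreal ((f (x + y) - f x)\<^sup>2) \<partial>lborel)) \<partial>lborel)
          \<le> (\<integral>\<^sup>+y. indicator b y * ennreal (\<theta> * G) \<partial>lborel)"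
      proof (intro nn_integral_mono)
        fix y
        show "indicator b y * (2 * (\<integral>\<^sup>+x. ennreal ((f (x + y) - f x)\<^sup>2) \<partial>lborel)) \<le> indicator b y * ennreal (\<theta> * G)"
        proof (cases "y \<in> b")
          case True
          then have "(norm y)\<^sup>2 \<le> r\<^sup>2" unfolding b_def by (intro power_mono) auto
          then have "2 * ((norm y)\<^sup>2 * G) \<le> 2 * (r\<^sup>2 * G)" using nn by (intro mult_left_mono mult_right_mono) auto
          also have "\<dots> = \<theta> * G" using r(2) by (simp flip: mult.assoc)
          finally have *: "2 * ((norm y)\<^sup>2 * G) \<le> \<theta> * G" .
          have "2 * (\<integral>\<^sup>+x. ennreal ((f (x + y) - f x)\<^sup>2) \<partial>lborel) \<le> 2 * (ennreal ((norm y)\<^sup>2) * ennreal G)"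
            using translation_estimate[OF f, of y] unfolding FG by (intro mult_left_mono) auto
          also have "\<dots> = ennreal (2 * ((norm y)\<^sup>2 * G))" using nn by (simp add: ennreal_mult)
          also have "\<dots> \<le> ennreal (\<theta> * G)" by (rule ennreal_leI[OF *])
          finally show ?thesis using True by simp
        qed simp
      qed
      also have "\<dots> = ennreal (v * (\<theta> * G))"
        using v nn \<theta> by (subst nn_integral_multc) (simp_all add: ev ennreal_mult)
      finally show "(\<integral>\<^sup>+y. indicator b y * (2 * (\<integral>\<^sup>+x. ennreal ((f (x + y) - f x)\<^sup>2) \<partial>lborel)) \<partial>lborel) \<le> ennreal (v * (\<theta> * G))" .
    next
      have "(\<integral>\<^sup>+y. \<integral>\<^sup>+x. indicator E x * (2 * ennreal ((f (x + y))\<^sup>2)) \<partial>lborel \<partial>lborel)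
          = (\<integral>\<^sup>+x. \<integral>\<^sup>+y. indicator E x * (2 * ennreal ((f (x + y))\<^sup>2)) \<partial>lborel \<partial>lborel)"
        by (rule lborel_pair.Fubini') measurable
      also have "\<dots> = (\<integral>\<^sup>+x. indicator E x * ennreal (2 * F) \<partial>lborel)"
      proof (rule nn_integral_cong)
        fix x
        have "(\<integral>\<^sup>+y. ennreal ((f (y + x))\<^sup>2) \<partial>lborel) = ennreal F"
          unfolding FG[symmetric] by (rule nn_integral_translate[of "\<lambda>y. ennreal ((f y)\<^sup>2)"]) measurable
        then have "(\<integral>\<^sup>+y. ennreal ((f (x + y))\<^sup>2) \<partial>lborel) = ennreal F" by (simp add: add.commute)
        then show "(\<integral>\<^sup>+y. indicator E x * (2 * ennreal ((f (x + y))\<^sup>2)) \<partial>lborel) = indicator E x * ennreal (2 * F)"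
          using nn by (simp add: nn_integral_cmult ennreal_mult)
      qed
      also have "\<dots> = ennreal (m * (2 * F))"
        using nn by (subst nn_integral_multc) (simp_all add: em ennreal_mult)
      finally show "(\<integral>\<^sup>+y. \<integral>\<^sup>+x. indicator E x * (2 * ennreal ((f (x + y))\<^sup>2)) \<partial>lborel \<partial>lborel) \<le> ennreal (m * (2 * F))" by simp
    qed
    finally have "ennreal (v * H) \<le> ennreal (v * (\<theta> * G) + m * (2 * F))"
      using v nn \<theta> by (simp add: ennreal_mult ennreal_plus)
    then have "v * H \<le> v * (\<theta> * G) + m * (2 * F)"
      using v nn \<theta> by (subst (asm) ennreal_le_iff) auto
    then have "H \<le> (v * (\<theta> * G) + m * (2 * F)) / v" using v by (simp add: pos_le_divide_eq mult.commute)
    also have "\<dots> = \<theta> * G + 2 / v * m * F" using v by (simp add: field_simps)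
    finally show "H \<le> \<theta> * G + 2 / v * m * F" .
  qed
qed

text \<open>For \<open>d < \<eta>\<close> the hypothesis gives
  \<open>b * d \<le> M * d powr \<beta> \<le> M * \<eta> powr \<beta>\<close>; otherwise
  \<open>b \<le> M / \<eta> powr (1 - \<beta>)\<close>. Only the first case enlarges
  \<open>h\<close> to \<open>f\<close>, so that Hardy can be applied to \<open>f\<close> while the
  remainder still involves \<open>h\<close>.\<close>

lemma drift_pointwise:
  fixes b d \<eta> h f :: real
  assumes "0 \<le> b" "0 < d" "0 < \<eta>" "0 < \<beta>" "\<beta> < 1" "0 < M" "b * d powr (1 - \<beta>) \<le> M" "\<bar>h\<bar> \<le> \<bar>f\<bar>"
  shows "b\<^sup>2 * h\<^sup>2 \<le> (M * \<eta> powr \<beta>)\<^sup>2 * (f\<^sup>2 / d\<^sup>2) + (M / \<eta> powr (1 - \<beta>))\<^sup>2 * h\<^sup>2"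
proof (cases "d < \<eta>")
  case True
  have "d = d powr (1 - \<beta>) * d powr \<beta>" using assms(2) by (simp flip: powr_add)
  then have "b * d = b * d powr (1 - \<beta>) * d powr \<beta>" by simp
  also have "\<dots> \<le> M * d powr \<beta>" by (intro mult_right_mono assms(7)) simp
  also have "\<dots> \<le> M * \<eta> powr \<beta>" using assms True by (intro mult_left_mono powr_mono2) auto
  finally have "b * d \<le> M * \<eta> powr \<beta>" .
  then have "(b * d)\<^sup>2 \<le> (M * \<eta> powr \<beta>)\<^sup>2" using assms by (intro power_mono) auto
  then have "(b * d)\<^sup>2 * (h\<^sup>2 / d\<^sup>2) \<le> (M * \<eta> powr \<beta>)\<^sup>2 * (f\<^sup>2 / d\<^sup>2)"
    using assms(8) by (intro mult_mono divide_right_mono) (auto simp: abs_le_square_iff)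
  moreover have "(b * d)\<^sup>2 * (h\<^sup>2 / d\<^sup>2) = b\<^sup>2 * h\<^sup>2" using assms(2) by (simp add: power_mult_distrib)
  moreover have "0 \<le> (M / \<eta> powr (1 - \<beta>))\<^sup>2 * h\<^sup>2" by simp
  ultimately show ?thesis by linarith
next
  case False
  have "b * \<eta> powr (1 - \<beta>) \<le> b * d powr (1 - \<beta>)" using assms False by (intro mult_left_mono powr_mono2) auto
  then have "b * \<eta> powr (1 - \<beta>) \<le> M" using assms(7) by linarith
  then have "b \<le> M / \<eta> powr (1 - \<beta>)" using assms(3) by (simp add: pos_le_divide_eq)
  then have "b\<^sup>2 * h\<^sup>2 \<le> (M / \<eta> powr (1 - \<beta>))\<^sup>2 * h\<^sup>2" using assms(1) by (intro mult_right_mono power_mono) auto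
  moreover have "0 \<le> (M * \<eta> powr \<beta>)\<^sup>2 * (f\<^sup>2 / d\<^sup>2)" by simp
  ultimately show ?thesis by linarith
qed

text \<open>Keeping \<open>h\<close> apart from \<open>f\<close> is essential for the logarithmic
  step, where \<open>h\<close> is bounded by 1 but no bound on \<open>f\<close> is known
  beforehand.\<close>

lemma drift_estimate:
  fixes K :: "(real^'n::finite) set" and B :: "real^'n \<Rightarrow> real^'n"
  assumes K: "open K" "convex K" "bounded K" and \<beta>: "0 < \<beta>" "\<beta> < 1" and M: "0 < M"
    and B: "B \<in> borel_measurable (lebesgue_on K)"
    and bound: "\<And>x. x \<in> K \<Longrightarrow> norm (B x) * infdist x (frontier K) powr (1 - \<beta>) \<le> M"
    and \<theta>: "0 < \<theta>"
  obtains C where "0 \<le> C"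
    "\<And>f h. f \<in> C1_compact K \<Longrightarrow> continuous_on UNIV h \<Longrightarrow> (\<And>x. \<bar>h x\<bar> \<le> \<bar>f x\<bar>) \<Longrightarrow>
      integrable (lebesgue_on K) (\<lambda>x. (norm (B x))\<^sup>2 * (h x)\<^sup>2) \<and>
      (LINT x|lebesgue_on K. (norm (B x))\<^sup>2 * (h x)\<^sup>2) \<le>
      \<theta> * (LINT x|lebesgue_on K. (norm (grad f x))\<^sup>2) + C * (LINT x|lebesgue_on K. (h x)\<^sup>2)"
proof -
  \<comment> \<open>Solves \<open>(M * \<eta> powr \<beta>)\<^sup>2 = \<theta> / 8\<close>; the 8
    cancels Hardy's constant.\<close>
  define \<eta> where "\<eta> = (sqrt (\<theta> / 8) / M) powr (1 / \<beta>)"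
  have \<eta>: "0 < \<eta>" using \<theta> M by (simp add: \<eta>_def)
  have "\<eta> powr \<beta> = sqrt (\<theta> / 8) / M" using \<theta> M \<beta> by (simp add: \<eta>_def powr_powr)
  then have \<eta>\<beta>: "(M * \<eta> powr \<beta>)\<^sup>2 = \<theta> / 8" using M \<theta> by simp
  show ?thesis
  proof (rule that[of "(M / \<eta> powr (1 - \<beta>))\<^sup>2"])
    show "0 \<le> (M / \<eta> powr (1 - \<beta>))\<^sup>2" by simp
    fix f h :: "real^'n \<Rightarrow> real"
    assume f: "f \<in> C1_compact K" and h: "continuous_on UNIV h" and hf: "\<And>x. \<bar>h x\<bar> \<le> \<bar>f x\<bar>"
    obtain C where C: "compact C" "C \<subseteq> K" "\<And>x. x \<notin> C \<Longrightarrow> f x = 0"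
      using C1_compact_support[OF f] by metis
    have ih: "integrable (lebesgue_on K) (\<lambda>x. (h x)\<^sup>2)"
    proof (rule integrable_lebesgue_on_compact_support[OF K(1) C(1,2)])
      show "continuous_on C (\<lambda>x. (h x)\<^sup>2)"
        by (intro continuous_intros continuous_on_subset[OF h]) auto
      show "(h x)\<^sup>2 = 0" if "x \<notin> C" for x using hf[of x] C(3)[OF that] by simp
    qed
    note H = hardy[OF K f]
    let ?R = "\<lambda>x. (M * \<eta> powr \<beta>)\<^sup>2 * ((f x)\<^sup>2 / (infdist x (frontier K))\<^sup>2) + (M / \<eta> powr (1 - \<beta>))\<^sup>2 * (h x)\<^sup>2"
    have iR: "integrable (lebesgue_on K) ?R"
      by (intro Bochner_Integration.integrable_add integrable_mult_right H(1) ih)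
    have le: "(norm (B x))\<^sup>2 * (h x)\<^sup>2 \<le> ?R x" if "x \<in> K" for x
      by (rule drift_pointwise[OF norm_ge_zero infdist_frontier(2)[OF K(1,3) that] \<eta> \<beta> M bound[OF that] hf])
    have hm: "h \<in> borel_measurable (lebesgue_on K)"
      using h by (intro measurable_restrict_space1 measurable_completion) (simp add: borel_measurable_continuous_onI)
    have int: "integrable (lebesgue_on K) (\<lambda>x. (norm (B x))\<^sup>2 * (h x)\<^sup>2)"
    proof (rule Bochner_Integration.integrable_bound[OF iR])
      show "(\<lambda>x. (norm (B x))\<^sup>2 * (h x)\<^sup>2) \<in> borel_measurable (lebesgue_on K)"
        using B hm by measurable
      show "AE x in lebesgue_on K. norm ((norm (B x))\<^sup>2 * (h x)\<^sup>2) \<le> norm (?R x)"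
        using le by (intro AE_I2) (simp add: order_trans[OF _ abs_ge_self])
    qed
    have "(LINT x|lebesgue_on K. (norm (B x))\<^sup>2 * (h x)\<^sup>2) \<le> (LINT x|lebesgue_on K. ?R x)"
      by (intro integral_mono int iR le) simp
    also have "\<dots> = \<theta> / 8 * (LINT x|lebesgue_on K. (f x)\<^sup>2 / (infdist x (frontier K))\<^sup>2)
        + (M / \<eta> powr (1 - \<beta>))\<^sup>2 * (LINT x|lebesgue_on K. (h x)\<^sup>2)"
      unfolding \<eta>\<beta>
      by (subst Bochner_Integration.integral_add) (use H(1) ih in \<open>simp_all only: integrable_mult_right integral_mult_right_zero\<close>)
    also have "\<dots> \<le> \<theta> * (LINT x|lebesgue_on K. (norm (grad f x))\<^sup>2) + (M / \<eta> powr (1 - \<beta>))\<^sup>2 * (LINT x|lebesgue_on K. (h x)\<^sup>2)"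
      using mult_left_mono[OF H(2), of "\<theta> / 8"] \<theta> by simp
    finally show "integrable (lebesgue_on K) (\<lambda>x. (norm (B x))\<^sup>2 * (h x)\<^sup>2) \<and>
      (LINT x|lebesgue_on K. (norm (B x))\<^sup>2 * (h x)\<^sup>2) \<le>
      \<theta> * (LINT x|lebesgue_on K. (norm (grad f x))\<^sup>2) + (M / \<eta> powr (1 - \<beta>))\<^sup>2 * (LINT x|lebesgue_on K. (h x)\<^sup>2)"
      using int by blast
  qed
qed

section \<open>The energy estimate\<close>

definition jet :: "(real^'n::finite \<Rightarrow> real) \<Rightarrow> real^'n \<Rightarrow> real \<times> (real^'n)" where
  "jet f x = (f x, grad f x)"

lemma borel_measurable_lebesgue_on_continuous:
  fixes h :: "real^'n::finite \<Rightarrow> 'b::topological_space"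
  assumes "continuous_on UNIV h"
  shows "h \<in> borel_measurable (lebesgue_on K)"
  using assms by (intro measurable_restrict_space1 measurable_completion) (simp add: borel_measurable_continuous_onI)

lemma C1_compact_square_integrable:
  assumes "open K" "f \<in> C1_compact K"
  shows "square_integrable (lebesgue_on K) f" "square_integrable (lebesgue_on K) (grad f)"
    "square_integrable (lebesgue_on K) (jet f)"
proof -
  note c = C1_compact_continuous[OF assms(2), of UNIV]
  note i = C1_compact_square_integral(1,2)[OF assms]
  show "square_integrable (lebesgue_on K) f" "square_integrable (lebesgue_on K) (grad f)"
    using i by (auto simp: square_integrable_def intro!: borel_measurable_lebesgue_on_continuous c)
  have "continuous_on UNIV (jet f)" unfolding jet_def[abs_def] by (intro continuous_intros c)
  then show "square_integrable (lebesgue_on K) (jet f)"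
    using i by (auto simp: square_integrable_def jet_def norm_Pair intro!: borel_measurable_lebesgue_on_continuous)
qed

lemma l2_inner_jet_self:
  assumes "open K" "f \<in> C1_compact K"
  shows "l2_inner (lebesgue_on K) (jet f) (jet f) =
    (LINT x|lebesgue_on K. (f x)\<^sup>2) + (LINT x|lebesgue_on K. (norm (grad f x))\<^sup>2)"
  using C1_compact_square_integral(1,2)[OF assms] by (simp add: l2_inner_self jet_def norm_Pair)

lemma test_comb_grad:
  assumes "\<phi> \<in> test_functions K" "\<psi> \<in> test_functions K"
  shows "grad (\<lambda>x. \<phi> x + c * \<psi> x) x = grad \<phi> x + c *\<^sub>R grad \<psi> x"
proof -
  have "\<phi> differentiable (at x)" "\<psi> differentiable (at x)"
    using test_functionsD(1)[OF assms(1), of 1] test_functionsD(1)[OF assms(2), of 1] by auto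
  then show ?thesis by (simp add: vec_eq_iff grad_nth partial_comb)
qed

lemma matrix_vector_inner:
  fixes A :: "real^'n::finite^'m::finite"
  shows "(A *v y) \<bullet> x = (x v* A) \<bullet> y"
  unfolding dot_lmul_matrix by (rule inner_commute)

locale elliptic_drift =
  fixes K :: "(real^'n::finite) set" and A :: "real^'n \<Rightarrow> real^'n^'n" and B :: "real^'n \<Rightarrow> real^'n"
    and \<beta> M lam Lam :: real
  assumes K: "open K" "convex K" "bounded K"
    and \<beta>: "0 < \<beta>" "\<beta> < 1" and M: "0 < M" and lam: "0 < lam"
    and A_measurable: "A \<in> borel_measurable (lebesgue_on K)"
    and A_coercive: "\<And>x \<eta>. x \<in> K \<Longrightarrow> lam * (norm \<eta>)\<^sup>2 \<le> (A x *v \<eta>) \<bullet> \<eta>"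
    and A_bounded: "\<And>x \<eta> \<psi>. x \<in> K \<Longrightarrow> \<bar>(A x *v \<psi>) \<bullet> \<eta>\<bar> \<le> Lam * norm \<eta> * norm \<psi>"
    and B_measurable: "B \<in> borel_measurable (lebesgue_on K)"
    and B_bound: "\<And>x. x \<in> K \<Longrightarrow> norm (B x) * infdist x (frontier K) powr (1 - \<beta>) \<le> M"
begin

abbreviation "\<mu> \<equiv> lebesgue_on K"

abbreviation grad_norm :: "(real^'n \<Rightarrow> real) \<Rightarrow> real" where
  "grad_norm f \<equiv> sqrt (LINT x|\<mu>. (norm (grad f x))\<^sup>2)"

lemma Lam_nonneg: "K \<noteq> {} \<Longrightarrow> 0 \<le> Lam"
proof -
  assume "K \<noteq> {}"
  then obtain x where x: "x \<in> K" by blast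
  fix i :: 'n
  have "\<bar>(A x *v axis i 1) \<bullet> axis i 1\<bar> \<le> Lam" using A_bounded[OF x, of "axis i 1" "axis i 1"] by simp
  then show ?thesis by linarith
qed

text \<open>Duality: the bound on the form is tested with the vector \<open>z v* A x\<close> itself,
  and one factor of its norm cancels.\<close>

lemma norm_vector_matrix_le:
  assumes "x \<in> K"
  shows "norm (z v* A x) \<le> Lam * norm z"
proof -
  have "norm (z v* A x) * norm (z v* A x) = (A x *v (z v* A x)) \<bullet> z"
    unfolding matrix_vector_inner by (simp add: power2_norm_eq_inner flip: power2_eq_square)
  also have "\<dots> \<le> Lam * norm z * norm (z v* A x)" using A_bounded[OF assms, of "z v* A x" z] by simp
  finally have *: "norm (z v* A x) * norm (z v* A x) \<le> Lam * norm z * norm (z v* A x)" .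
  have "0 \<le> Lam * norm z" using Lam_nonneg assms by (intro mult_nonneg_nonneg) auto
  with * show ?thesis
    by (cases "norm (z v* A x) = 0") auto
qed

lemma vector_matrix_measurable:
  assumes "G \<in> borel_measurable \<mu>"
  shows "(\<lambda>x. G x v* A x) \<in> borel_measurable \<mu>"
proof -
  have "continuous_on UNIV (\<lambda>p :: (real^'n) \<times> (real^'n^'n). fst p v* snd p)"
    unfolding vector_matrix_mult_def by (intro continuous_intros continuous_on_vec_lambda)
  from borel_measurable_continuous_on[OF this, of "\<lambda>x. (G x, A x)"] show ?thesis
    using assms A_measurable by simp
qed

lemma square_integrable_vector_matrix:
  assumes "square_integrable \<mu> G"
  shows "square_integrable \<mu> (\<lambda>x. G x v* A x)"
  unfolding square_integrable_def
proof
  show m: "(\<lambda>x. G x v* A x) \<in> borel_measurable \<mu>"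
    using assms by (intro vector_matrix_measurable) (simp add: square_integrable_def)
  show "integrable \<mu> (\<lambda>x. (norm (G x v* A x))\<^sup>2)"
  proof (rule Bochner_Integration.integrable_bound)
    show "integrable \<mu> (\<lambda>x. Lam\<^sup>2 * (norm (G x))\<^sup>2)" using assms by (simp add: square_integrable_def)
    show "(\<lambda>x. (norm (G x v* A x))\<^sup>2) \<in> borel_measurable \<mu>" using m by measurable
    show "AE x in \<mu>. norm ((norm (G x v* A x))\<^sup>2) \<le> norm (Lam\<^sup>2 * (norm (G x))\<^sup>2)"
    proof (intro AE_I2)
      fix x assume "x \<in> space \<mu>"
      then have "(norm (G x v* A x))\<^sup>2 \<le> (Lam * norm (G x))\<^sup>2"
        by (intro power_mono norm_vector_matrix_le) auto
      then show "norm ((norm (G x v* A x))\<^sup>2) \<le> norm (Lam\<^sup>2 * (norm (G x))\<^sup>2)"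
        by (simp add: power_mult_distrib)
    qed
  qed
qed

lemma A_energy:
  assumes f: "f \<in> C1_compact K"
  shows "integrable \<mu> (\<lambda>x. (A x *v grad f x) \<bullet> grad f x)"
    "lam * (grad_norm f)\<^sup>2 \<le> (LINT x|\<mu>. (A x *v grad f x) \<bullet> grad f x)"
proof -
  note g = C1_compact_square_integrable(2)[OF K(1) f]
  have eq: "(A x *v grad f x) \<bullet> grad f x = (grad f x v* A x) \<bullet> grad f x" for x
    by (rule matrix_vector_inner)
  show i: "integrable \<mu> (\<lambda>x. (A x *v grad f x) \<bullet> grad f x)"
    unfolding eq by (intro square_integrable_inner square_integrable_vector_matrix g)
  have "lam * (grad_norm f)\<^sup>2 = (LINT x|\<mu>. lam * (norm (grad f x))\<^sup>2)"
    by (simp add: Bochner_Integration.integral_nonneg)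
  also have "\<dots> \<le> (LINT x|\<mu>. (A x *v grad f x) \<bullet> grad f x)"
    using g i A_coercive by (intro integral_mono) (auto simp: square_integrable_def)
  finally show "lam * (grad_norm f)\<^sup>2 \<le> (LINT x|\<mu>. (A x *v grad f x) \<bullet> grad f x)" .
qed

lemma drift_square_integrable:
  assumes f: "f \<in> C1_compact K" and h: "continuous_on UNIV h" "\<And>x. \<bar>h x\<bar> \<le> \<bar>f x\<bar>"
  shows "square_integrable \<mu> (\<lambda>x. h x *\<^sub>R B x)"
proof -
  have "integrable \<mu> (\<lambda>x. (norm (B x))\<^sup>2 * (h x)\<^sup>2)"
    by (rule drift_estimate[OF K \<beta> M B_measurable B_bound zero_less_one]) (use f h in blast)+
  moreover have "(\<lambda>x. h x *\<^sub>R B x) \<in> borel_measurable \<mu>"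
    using borel_measurable_lebesgue_on_continuous[OF h(1)] B_measurable by measurable
  ultimately show ?thesis
    by (simp add: square_integrable_def power_mult_distrib mult.commute)
qed

text \<open>Applied with \<open>h = f\<close> and with \<open>f = arsinh (v / \<epsilon>)\<close>, \<open>h = v / sqrt (\<epsilon>\<^sup>2 + v\<^sup>2)\<close>.\<close>
lemma energy_estimate:
  obtains C where "0 < C"
    "\<And>f h T. f \<in> C1_compact K \<Longrightarrow> continuous_on UNIV h \<Longrightarrow> (\<And>x. \<bar>h x\<bar> \<le> \<bar>f x\<bar>) \<Longrightarrow> 0 \<le> T \<Longrightarrow>
      (LINT x|\<mu>. (A x *v grad f x) \<bullet> grad f x + (B x \<bullet> grad f x) * h x) \<le> T * grad_norm f \<Longrightarrow>
      grad_norm f \<le> C * (T + sqrt (LINT x|\<mu>. (h x)\<^sup>2))"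
proof -
  \<comment> \<open>With the factor \<open>(lam / 2)\<^sup>2\<close> the L2 norm of \<open>h\<close>
    times \<open>B\<close> is at most \<open>lam / 2 * n + sqrt D * s\<close>, so half of the
    ellipticity survives the absorption.\<close>
  obtain D where D: "0 \<le> D" "\<And>f h. f \<in> C1_compact K \<Longrightarrow> continuous_on UNIV h \<Longrightarrow> (\<And>x. \<bar>h x\<bar> \<le> \<bar>f x\<bar>) \<Longrightarrow>
      integrable \<mu> (\<lambda>x. (norm (B x))\<^sup>2 * (h x)\<^sup>2) \<and>
      (LINT x|\<mu>. (norm (B x))\<^sup>2 * (h x)\<^sup>2) \<le> (lam / 2)\<^sup>2 * (LINT x|\<mu>. (norm (grad f x))\<^sup>2) + D * (LINT x|\<mu>. (h x)\<^sup>2)"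
    using drift_estimate[OF K \<beta> M B_measurable B_bound, of "(lam / 2)\<^sup>2"] lam by auto
  show ?thesis
  proof (rule that[of "2 / lam * (1 + sqrt D)"])
    show "0 < 2 / lam * (1 + sqrt D)" using lam D(1) by (simp add: add_pos_nonneg)
    fix f h T assume f: "f \<in> C1_compact K" and h: "continuous_on UNIV h" "\<And>x. \<bar>h x\<bar> \<le> \<bar>f x\<bar>" and T: "0 \<le> T"
      and le: "(LINT x|\<mu>. (A x *v grad f x) \<bullet> grad f x + (B x \<bullet> grad f x) * h x) \<le> T * grad_norm f"
    define n where "n = grad_norm f"
    define s where "s = sqrt (LINT x|\<mu>. (h x)\<^sup>2)"
    have n: "0 \<le> n" "n\<^sup>2 = (LINT x|\<mu>. (norm (grad f x))\<^sup>2)" by (simp_all add: n_def Bochner_Integration.integral_nonneg)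
    have s: "0 \<le> s" "s\<^sup>2 = (LINT x|\<mu>. (h x)\<^sup>2)" by (simp_all add: s_def Bochner_Integration.integral_nonneg)
    note g = C1_compact_square_integrable(2)[OF K(1) f]
    note hB = drift_square_integrable[OF f h]
    have i: "integrable \<mu> (\<lambda>x. (B x \<bullet> grad f x) * h x)"
      using square_integrable_inner[OF hB g] by (simp add: mult.commute)
    have "\<bar>l2_inner \<mu> (\<lambda>x. h x *\<^sub>R B x) (grad f)\<bar> \<le> sqrt (l2_inner \<mu> (\<lambda>x. h x *\<^sub>R B x) (\<lambda>x. h x *\<^sub>R B x)) * n"
      using l2_Cauchy_Schwarz_sqrt[OF hB g] by (simp add: n_def l2_inner_self)
    also have "\<dots> \<le> (lam / 2 * n + sqrt D * s) * n"
    proof (intro mult_right_mono n)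
      have "l2_inner \<mu> (\<lambda>x. h x *\<^sub>R B x) (\<lambda>x. h x *\<^sub>R B x) = (LINT x|\<mu>. (norm (B x))\<^sup>2 * (h x)\<^sup>2)"
        by (simp add: l2_inner_self power_mult_distrib mult.commute)
      also have "\<dots> \<le> (lam / 2)\<^sup>2 * n\<^sup>2 + D * s\<^sup>2" using D(2)[OF f h] n(2) s(2) by simp
      also have "\<dots> \<le> (lam / 2 * n + sqrt D * s)\<^sup>2"
      proof -
        have "0 \<le> (lam / 2 * n) * (sqrt D * s)" using lam n(1) D(1) s(1) by simp
        then show ?thesis using D(1) by (simp add: power2_sum power_mult_distrib power_divide)
      qed
      finally show "sqrt (l2_inner \<mu> (\<lambda>x. h x *\<^sub>R B x) (\<lambda>x. h x *\<^sub>R B x)) \<le> lam / 2 * n + sqrt D * s"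
        using lam n(1) D(1) s(1) by (intro real_le_lsqrt) auto
    qed
    finally have drift: "- (LINT x|\<mu>. (B x \<bullet> grad f x) * h x) \<le> (lam / 2 * n + sqrt D * s) * n"
      by (simp add: l2_inner_def mult.commute abs_le_iff)
    have "lam * n\<^sup>2 \<le> (LINT x|\<mu>. (A x *v grad f x) \<bullet> grad f x)" using A_energy(2)[OF f] by (simp add: n_def)
    also have "\<dots> = (LINT x|\<mu>. (A x *v grad f x) \<bullet> grad f x + (B x \<bullet> grad f x) * h x) - (LINT x|\<mu>. (B x \<bullet> grad f x) * h x)"
      using A_energy(1)[OF f] i by simp
    also have "\<dots> \<le> T * n + (lam / 2 * n + sqrt D * s) * n" using le drift by (simp add: n_def)
    finally have "n * (lam / 2 * n) \<le> n * (T + sqrt D * s)" by (simp add: power2_eq_square algebra_simps)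
    then have "lam / 2 * n \<le> T + sqrt D * s"
      using n(1) T D(1) s(1) by (cases "n = 0") (auto simp: mult_le_cancel_left)
    then have "n \<le> 2 / lam * (T + sqrt D * s)" using lam by (simp add: field_simps)
    also have "\<dots> \<le> 2 / lam * ((1 + sqrt D) * (T + s))"
      using lam T D(1) s(1) by (intro mult_left_mono) (auto simp: algebra_simps)
    finally show "grad_norm f \<le> 2 / lam * (1 + sqrt D) * (T + sqrt (LINT x|\<mu>. (h x)\<^sup>2))"
      by (simp only: n_def s_def mult.assoc)
  qed
qed

text \<open>The Riesz vector of the \<open>L1\<close> form in its first argument. The solution
  enters that form only through its gradient, hence the component 0; \<open>v*\<close> applies the
  transpose of \<open>A x\<close> to the test function.\<close>

definition drift_adjoint :: "(real^'n \<Rightarrow> real) \<Rightarrow> real^'n \<Rightarrow> real \<times> (real^'n)" where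
  "drift_adjoint \<phi> x = (0, grad \<phi> x v* A x + \<phi> x *\<^sub>R B x)"

lemma drift_adjoint_square_integrable:
  assumes "\<phi> \<in> test_functions K"
  shows "square_integrable \<mu> (drift_adjoint \<phi>)"
proof -
  note \<phi> = test_imp_C1_compact[OF assms]
  have "square_integrable \<mu> (\<lambda>x. grad \<phi> x v* A x + \<phi> x *\<^sub>R B x)"
    by (intro square_integrable_add square_integrable_vector_matrix C1_compact_square_integrable[OF K(1) \<phi>]
        drift_square_integrable[OF \<phi>] C1_compact_continuous[OF \<phi>]) simp
  then show ?thesis
    by (auto simp: square_integrable_def drift_adjoint_def[abs_def] norm_Pair intro!: borel_measurable_Pair)
qed

lemma inner_drift_adjoint:
  "(u, G) \<bullet> drift_adjoint \<phi> x = (A x *v G) \<bullet> grad \<phi> x + (B x \<bullet> G) * \<phi> x"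
proof -
  have "(u, G) \<bullet> drift_adjoint \<phi> x = G \<bullet> (grad \<phi> x v* A x) + \<phi> x * (G \<bullet> B x)"
    by (simp add: drift_adjoint_def inner_add_right)
  then show ?thesis
    unfolding matrix_vector_inner by (simp only: inner_commute[of G] mult.commute[of "\<phi> x"])
qed

end

section \<open>Weak solutions from a priori bounds\<close>

lemma zero_test_function:
  fixes K :: "(real^'n::finite) set"
  shows "(\<lambda>_. 0) \<in> test_functions K"
proof -
  have "C_k k (\<lambda>_::real^'n::finite. 0)" for k
  proof (induction k)
    case (Suc k)
    have "partial i (\<lambda>_::real^'n. 0) = (\<lambda>_. 0)" for i
      by (rule ext) (rule partial_eq[OF has_derivative_const])
    then show ?case using Suc by simp
  qed simp
  then show ?thesis by (simp add: test_functions_def)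
qed

lemma L2_iff_square_integrable: "L2 K f \<longleftrightarrow> square_integrable (lebesgue_on K) f"
  by (simp add: L2_def square_integrable_def)

lemma square_integrable_fst_snd:
  assumes "square_integrable M U"
  shows "square_integrable M (\<lambda>x. fst (U x))" "square_integrable M (\<lambda>x. snd (U x))"
proof -
  have [measurable]: "(\<lambda>x. fst (U x)) \<in> borel_measurable M" "(\<lambda>x. snd (U x)) \<in> borel_measurable M"
    by (rule borel_measurable_continuous_on[OF _ square_integrable_measurable[OF assms]], intro continuous_intros)+
  have i: "integrable M (\<lambda>x. (norm (U x))\<^sup>2)" using assms by (simp add: square_integrable_def)
  have n: "norm (fst (U x)) \<le> norm (U x)" "norm (snd (U x)) \<le> norm (U x)" for x
    using norm_fst_le[of "fst (U x)" "snd (U x)"] norm_snd_le[of "snd (U x)" "fst (U x)"] by simp_all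
  show "square_integrable M (\<lambda>x. fst (U x))" "square_integrable M (\<lambda>x. snd (U x))"
    unfolding square_integrable_def
    using n by (auto intro!: Bochner_Integration.integrable_bound[OF i] AE_I2 power_mono)
qed

lemma square_integrable_Pair:
  assumes "square_integrable M f" "square_integrable M g"
  shows "square_integrable M (\<lambda>x. (f x, g x))"
  using assms by (auto simp: square_integrable_def norm_Pair intro!: borel_measurable_Pair)

text \<open>The weak gradient identity for the \<open>i\<close>-th component says that \<open>(u, G)\<close> is orthogonal to all
  of these fields.\<close>
definition weak_gradient_test :: "'n::finite \<Rightarrow> (real^'n \<Rightarrow> real) \<Rightarrow> real^'n \<Rightarrow> real \<times> (real^'n)" where
  "weak_gradient_test i \<phi> x = (partial i \<phi> x, axis i (\<phi> x))"

lemma weak_gradient_test_square_integrable: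
  fixes K :: "(real^'n::finite) set"
  assumes "open K" and \<phi>: "\<phi> \<in> C1_compact K"
  shows "square_integrable (lebesgue_on K) (weak_gradient_test i \<phi>)"
proof -
  note c = C1_compact_continuous[OF \<phi>, of UNIV]
  obtain C where C: "compact C" "C \<subseteq> K" "\<And>x. x \<notin> C \<Longrightarrow> \<phi> x = 0" "\<And>x. x \<notin> C \<Longrightarrow> partial i \<phi> x = 0"
    using C1_compact_support[OF \<phi>] by metis
  have "square_integrable (lebesgue_on K) (partial i \<phi>)"
    unfolding square_integrable_def
    by (intro conjI borel_measurable_lebesgue_on_continuous c integrable_lebesgue_on_compact_support[OF assms(1) C(1,2)])
       (auto intro!: continuous_intros C1_compact_continuous[OF \<phi>] simp: C(4))
  moreover have "square_integrable (lebesgue_on K) (\<lambda>x. axis i (\<phi> x) :: real^'n)"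
  proof -
    have eq: "axis i (\<phi> x) = \<phi> x *\<^sub>R (axis i 1 :: real^'n)" for x by (simp add: axis_def vec_eq_iff)
    have "continuous_on UNIV (\<lambda>x. \<phi> x *\<^sub>R (axis i 1 :: real^'n))" by (intro continuous_intros c)
    then show ?thesis using C1_compact_square_integral(1)[OF assms]
      by (auto simp: square_integrable_def eq intro!: borel_measurable_lebesgue_on_continuous)
  qed
  ultimately show ?thesis
    unfolding weak_gradient_test_def[abs_def] by (rule square_integrable_Pair)
qed

lemma inner_weak_gradient_test: "U \<bullet> weak_gradient_test i \<phi> x = fst U * partial i \<phi> x + snd U $ i * \<phi> x"
  by (cases U) (simp add: weak_gradient_test_def inner_axis)

text \<open>As an orthogonality relation the weak gradient identity is visibly stable under
  differences and L2 limits, which is how it is used for the closure of the jets.\<close>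

lemma has_W12_gradient_iff:
  assumes K: "open K" and U: "square_integrable (lebesgue_on K) U"
  shows "has_W12_gradient K (\<lambda>x. fst (U x)) (\<lambda>x. snd (U x)) \<longleftrightarrow>
    (\<forall>\<phi>\<in>test_functions K. \<forall>i. l2_inner (lebesgue_on K) U (weak_gradient_test i \<phi>) = 0)"
proof -
  have "(LINT x|lebesgue_on K. fst (U x) * partial i \<phi> x) = - (LINT x|lebesgue_on K. snd (U x) $ i * \<phi> x) \<longleftrightarrow>
      l2_inner (lebesgue_on K) U (weak_gradient_test i \<phi>) = 0" if "\<phi> \<in> test_functions K" for \<phi> i
  proof -
    note Z = weak_gradient_test_square_integrable[OF K test_imp_C1_compact[OF that], of i]
    note ZZ = square_integrable_fst_snd[OF Z] and UU = square_integrable_fst_snd[OF U]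
    have 1: "integrable (lebesgue_on K) (\<lambda>x. fst (U x) * partial i \<phi> x)"
      using square_integrable_inner[OF UU(1) ZZ(1)] by (simp add: weak_gradient_test_def)
    have 2: "integrable (lebesgue_on K) (\<lambda>x. snd (U x) $ i * \<phi> x)"
      using square_integrable_inner[OF UU(2) ZZ(2)] by (simp add: weak_gradient_test_def inner_axis)
    show ?thesis using 1 2 by (auto simp: l2_inner_def inner_weak_gradient_test)
  qed
  then show ?thesis
    unfolding has_W12_gradient_def L2_iff_square_integrable using square_integrable_fst_snd[OF U] by blast
qed

text \<open>By the product rule the integrand is the \<open>i\<close>-th derivative of
  \<open>\<psi> * \<phi>\<close>, which has compact support and integral 0.\<close>

lemma jet_weak_gradient:
  assumes K: "open K" and \<psi>: "\<psi> \<in> test_functions K" and \<phi>: "\<phi> \<in> test_functions K"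
  shows "l2_inner (lebesgue_on K) (jet \<psi>) (weak_gradient_test i \<phi>) = 0"
proof -
  note m = test_imp_C1_compact[OF test_mult[OF \<psi> \<phi>]]
  obtain C where C: "C \<subseteq> K" "\<And>x. x \<notin> C \<Longrightarrow> partial i (\<lambda>x. \<psi> x * \<phi> x) x = 0"
    using C1_compact_support[OF m] by metis
  have "\<psi> differentiable (at x)" "\<phi> differentiable (at x)" for x
    using test_functionsD(1)[OF \<psi>, of 1] test_functionsD(1)[OF \<phi>, of 1] by auto
  then have "l2_inner (lebesgue_on K) (jet \<psi>) (weak_gradient_test i \<phi>) = (LINT x|lebesgue_on K. partial i (\<lambda>x. \<psi> x * \<phi> x) x)"
    by (simp add: l2_inner_def inner_weak_gradient_test jet_def grad_nth partial_mult)
  also have "\<dots> = (LINT x|lborel. partial i (\<lambda>x. \<psi> x * \<phi> x) x)"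
    by (rule integral_lebesgue_on_eq_lborel[OF K C1_compact_borel(2)[OF m]]) (use C in blast)
  also have "\<dots> = 0" by (rule integral_partial_eq_0[OF m])
  finally show ?thesis .
qed

text \<open>Orthogonality to the fields \<open>weak_gradient_test\<close> passes from the jets to
  their limit. The approximating test functions are the \<open>s n\<close> themselves, and
  \<open>U - jet (s n)\<close> supplies the weak gradient of the difference.\<close>

lemma jet_closure_W12_0:
  assumes K: "open K" and U: "square_integrable (lebesgue_on K) U" and s: "\<And>n. s n \<in> test_functions K"
    and lim: "(\<lambda>n. LINT x|lebesgue_on K. (norm (jet (s n) x - U x))\<^sup>2) \<longlonglongrightarrow> 0"
  shows "has_W12_gradient K (\<lambda>x. fst (U x)) (\<lambda>x. snd (U x))" "(\<lambda>x. fst (U x)) \<in> W12_0 K"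
proof -
  note j = C1_compact_square_integrable(3)[OF K test_imp_C1_compact]
  have Z: "l2_inner (lebesgue_on K) U (weak_gradient_test i \<phi>) = 0" if \<phi>: "\<phi> \<in> test_functions K" for \<phi> i
  proof -
    have "(\<lambda>n. l2_inner (lebesgue_on K) (jet (s n)) (weak_gradient_test i \<phi>)) \<longlonglongrightarrow> l2_inner (lebesgue_on K) U (weak_gradient_test i \<phi>)"
      by (rule l2_limit_inner[OF j[OF s] U weak_gradient_test_square_integrable[OF K test_imp_C1_compact[OF \<phi>]] lim])
    then show ?thesis unfolding jet_weak_gradient[OF K s \<phi>] by (rule LIMSEQ_unique[OF tendsto_const, symmetric])
  qed
  then show W: "has_W12_gradient K (\<lambda>x. fst (U x)) (\<lambda>x. snd (U x))"
    using has_W12_gradient_iff[OF K U] by blast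
  have "\<exists>\<phi>\<in>test_functions K. \<exists>H. has_W12_gradient K (\<lambda>x. fst (U x) - \<phi> x) H \<and>
      W12_norm K (\<lambda>x. fst (U x) - \<phi> x) H < \<epsilon>" if \<epsilon>: "0 < \<epsilon>" for \<epsilon>
  proof -
    have "\<forall>\<^sub>F n in sequentially. (LINT x|lebesgue_on K. (norm (jet (s n) x - U x))\<^sup>2) < \<epsilon>\<^sup>2"
      by (rule order_tendstoD(2)[OF lim]) (use \<epsilon> in simp)
    then obtain n where n: "(LINT x|lebesgue_on K. (norm (jet (s n) x - U x))\<^sup>2) < \<epsilon>\<^sup>2"
      unfolding eventually_sequentially by blast
    define V where "V x = U x - jet (s n) x" for x
    have V: "square_integrable (lebesgue_on K) V" unfolding V_def by (intro square_integrable_diff U j s)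
    have "l2_inner (lebesgue_on K) V (weak_gradient_test i \<phi>) = 0" if \<phi>: "\<phi> \<in> test_functions K" for \<phi> i
      unfolding V_def[abs_def]
      using l2_inner_diff_left[OF U j[OF s] weak_gradient_test_square_integrable[OF K test_imp_C1_compact[OF \<phi>]]]
        Z[OF \<phi>] jet_weak_gradient[OF K s \<phi>] by simp
    then have "has_W12_gradient K (\<lambda>x. fst (V x)) (\<lambda>x. snd (V x))" using has_W12_gradient_iff[OF K V] by blast
    moreover have "W12_norm K (\<lambda>x. fst (V x)) (\<lambda>x. snd (V x)) < \<epsilon>"
    proof -
      have "(norm (fst z))\<^sup>2 + (norm (snd z))\<^sup>2 = (norm z)\<^sup>2" for z :: "real \<times> (real^'a)"
        by (cases z) (simp add: norm_Pair)
      then have "(LINT x|lebesgue_on K. (fst (V x))\<^sup>2) + (LINT x|lebesgue_on K. (norm (snd (V x)))\<^sup>2)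
          = (LINT x|lebesgue_on K. (norm (V x))\<^sup>2)"
        using square_integrable_fst_snd[OF V]
        by (subst Bochner_Integration.integral_add[symmetric]) (auto simp: square_integrable_def)
      also have "\<dots> < \<epsilon>\<^sup>2" using n by (simp add: V_def norm_minus_commute)
      finally show ?thesis unfolding W12_norm_def using \<epsilon> by (intro real_less_lsqrt) auto
    qed
    ultimately show ?thesis using s[of n] by (intro bexI[of _ "s n"]) (auto simp: V_def jet_def)
  qed
  then show "(\<lambda>x. fst (U x)) \<in> W12_0 K" unfolding W12_0_def W12_def using W by blast
qed

text \<open>\<open>l2_inf_sup\<close> over test functions, with \<open>F\<close> the pairing with
  the data. The bound is required for the full jet norm of the second argument, so that
  Cauchy-Schwarz against arbitrary L2 data controls \<open>F\<close>.\<close>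

lemma weak_solvability:
  fixes K :: "(real^'n::finite) set" and S :: "(real^'n \<Rightarrow> real) \<Rightarrow> real^'n \<Rightarrow> real \<times> (real^'n)"
  assumes K: "open K"
    and S: "\<And>\<phi>. \<phi> \<in> test_functions K \<Longrightarrow> square_integrable (lebesgue_on K) (S \<phi>)"
    and S_comb: "\<And>\<phi> \<psi> c x. \<phi> \<in> test_functions K \<Longrightarrow> \<psi> \<in> test_functions K \<Longrightarrow> x \<in> K \<Longrightarrow>
        S (\<lambda>x. \<phi> x + c * \<psi> x) x = S \<phi> x + c *\<^sub>R S \<psi> x"
    and C: "0 \<le> C"
    and apriori: "\<And>\<phi> N. \<phi> \<in> test_functions K \<Longrightarrow> 0 \<le> N \<Longrightarrow>
        (\<And>\<psi>. \<psi> \<in> test_functions K \<Longrightarrow> l2_inner (lebesgue_on K) (jet \<psi>) (S \<phi>) \<le>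
          N * sqrt (l2_inner (lebesgue_on K) (jet \<psi>) (jet \<psi>))) \<Longrightarrow>
        sqrt (l2_inner (lebesgue_on K) (jet \<phi>) (jet \<phi>)) \<le> C * N"
    and g: "L2 K g" and f: "\<And>i. L2 K (f i)"
  obtains u Du where "u \<in> W12_0 K" "has_W12_gradient K u Du"
    "\<And>\<phi>. \<phi> \<in> test_functions K \<Longrightarrow> (LINT x|lebesgue_on K. (u x, Du x) \<bullet> S \<phi> x) =
      (LINT x|lebesgue_on K. g x * \<phi> x - (\<Sum>i\<in>UNIV. f i x * partial i \<phi> x))"
proof -
  \<comment> \<open>The minus sign makes the pairing of \<open>R\<close> with
    \<open>jet \<phi>\<close> equal to the integrand on the right of the weak formulation.\<close>
  define R where "R x = (g x, \<chi> i. - f i x)" for x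
  have R: "square_integrable (lebesgue_on K) R"
  proof -
    have "square_integrable (lebesgue_on K) (\<lambda>x. \<chi> i. - f i x)"
      unfolding square_integrable_def
    proof
      have [measurable]: "f i \<in> borel_measurable (lebesgue_on K)" for i using f[of i] by (simp add: L2_def)
      have "(\<lambda>x. \<chi> i. - f i x) = (\<lambda>x. \<Sum>i\<in>UNIV. (- f i x) *\<^sub>R axis i 1)"
        by (simp add: fun_eq_iff vec_eq_iff axis_def if_distrib cong: if_cong)
      then show "(\<lambda>x. \<chi> i. - f i x) \<in> borel_measurable (lebesgue_on K)" by simp
      have "(norm (\<chi> i. - f i x))\<^sup>2 = (\<Sum>i\<in>UNIV. (norm (f i x))\<^sup>2)" for x
        unfolding power2_norm_eq_inner inner_vec_def by simp
      then show "integrable (lebesgue_on K) (\<lambda>x. (norm (\<chi> i. - f i x))\<^sup>2)"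
        using f by (simp add: L2_def)
    qed
    then show ?thesis
      using g unfolding R_def[abs_def] L2_iff_square_integrable by (intro square_integrable_Pair)
  qed
  note j = C1_compact_square_integrable(3)[OF K test_imp_C1_compact]
  have jet_comb: "jet (\<lambda>x. \<phi> x + c * \<psi> x) x = jet \<phi> x + c *\<^sub>R jet \<psi> x"
    if "\<phi> \<in> test_functions K" "\<psi> \<in> test_functions K" for \<phi> \<psi> c x
    using test_comb_grad[OF that] by (simp add: jet_def)
  obtain U s where U: "square_integrable (lebesgue_on K) U" and s: "\<And>n. s n \<in> test_functions K"
    and lim: "(\<lambda>n. LINT x|lebesgue_on K. (norm (jet (s n) x - U x))\<^sup>2) \<longlonglongrightarrow> 0"
    and sol: "\<And>\<phi>. \<phi> \<in> test_functions K \<Longrightarrow> l2_inner (lebesgue_on K) U (S \<phi>) = l2_inner (lebesgue_on K) R (jet \<phi>)"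
  proof (rule l2_inf_sup[of "test_functions K" "lebesgue_on K" jet S "\<lambda>\<phi>. l2_inner (lebesgue_on K) R (jet \<phi>)"
      "sqrt (l2_inner (lebesgue_on K) R R) * C"])
    show "test_functions K \<noteq> {}" using zero_test_function by blast
    show "square_integrable (lebesgue_on K) (jet \<phi>)" if "\<phi> \<in> test_functions K" for \<phi> by (rule j[OF that])
    show "square_integrable (lebesgue_on K) (S \<phi>)" if "\<phi> \<in> test_functions K" for \<phi> by (rule S[OF that])
  next
    fix \<phi> \<psi> c assume t: "\<phi> \<in> test_functions K" "\<psi> \<in> test_functions K"
    have "l2_inner (lebesgue_on K) (jet (\<lambda>x. \<phi> x + c * \<psi> x)) R
        = l2_inner (lebesgue_on K) (jet \<phi>) R + c * l2_inner (lebesgue_on K) (jet \<psi>) R"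
      by (rule l2_inner_comb_left[OF j[OF t(1)] j[OF t(2)] R jet_comb[OF t]])
    then show "\<exists>k\<in>test_functions K. l2_inner (lebesgue_on K) R (jet k) =
          l2_inner (lebesgue_on K) R (jet \<phi>) + c * l2_inner (lebesgue_on K) R (jet \<psi>) \<and>
        (\<forall>x\<in>space (lebesgue_on K). jet k x = jet \<phi> x + c *\<^sub>R jet \<psi> x \<and> S k x = S \<phi> x + c *\<^sub>R S \<psi> x)"
      using test_comb[OF t] jet_comb[OF t] S_comb[OF t]
      by (intro bexI[of _ "\<lambda>x. \<phi> x + c * \<psi> x"]) (auto simp: l2_inner_commute[of _ R])
  next
    fix \<phi> N assume \<phi>: "\<phi> \<in> test_functions K" and N: "0 \<le> N"
      and le: "\<And>\<psi>. \<psi> \<in> test_functions K \<Longrightarrow> l2_inner (lebesgue_on K) (jet \<psi>) (S \<phi>) \<le>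
          N * sqrt (l2_inner (lebesgue_on K) (jet \<psi>) (jet \<psi>))"
    have "\<bar>l2_inner (lebesgue_on K) R (jet \<phi>)\<bar> \<le> sqrt (l2_inner (lebesgue_on K) R R) * sqrt (l2_inner (lebesgue_on K) (jet \<phi>) (jet \<phi>))"
      by (rule l2_Cauchy_Schwarz_sqrt[OF R j[OF \<phi>]])
    also have "\<dots> \<le> sqrt (l2_inner (lebesgue_on K) R R) * (C * N)"
      by (intro mult_left_mono apriori[OF \<phi> N le]) (simp_all add: l2_inner_nonneg)
    finally show "\<bar>l2_inner (lebesgue_on K) R (jet \<phi>)\<bar> \<le> sqrt (l2_inner (lebesgue_on K) R R) * C * N"
      by (simp add: mult.assoc)
  next
    fix U s assume "square_integrable (lebesgue_on K) U" "\<And>n. s n \<in> test_functions K"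
      "(\<lambda>n. LINT x|lebesgue_on K. (norm (jet (s n) x - U x))\<^sup>2) \<longlonglongrightarrow> 0"
      "\<And>\<phi>. \<phi> \<in> test_functions K \<Longrightarrow> l2_inner (lebesgue_on K) U (S \<phi>) = l2_inner (lebesgue_on K) R (jet \<phi>)"
    then show thesis by (rule that)
  qed
  show ?thesis
  proof (rule that[OF jet_closure_W12_0(2,1)[OF K U s lim]])
    fix \<phi> assume "\<phi> \<in> test_functions K"
    from sol[OF this] show "(LINT x|lebesgue_on K. (fst (U x), snd (U x)) \<bullet> S \<phi> x) =
      (LINT x|lebesgue_on K. g x * \<phi> x - (\<Sum>i\<in>UNIV. f i x * partial i \<phi> x))"
      by (simp add: l2_inner_def R_def jet_def inner_vec_def grad_nth sum_negf)
  qed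
qed

section \<open>A priori bounds and existence\<close>

text \<open>With \<open>s = arsinh (v / \<epsilon>)\<close> the quotient is \<open>tanh s\<close>,
  and \<open>tanh\<close> is dominated by the identity. This is the condition
  \<open>\<bar>h x\<bar> \<le> \<bar>f x\<bar>\<close> of the energy estimate.\<close>

lemma quotient_le_arsinh:
  fixes v \<epsilon> :: real
  assumes "0 < \<epsilon>"
  shows "\<bar>v / sqrt (\<epsilon>\<^sup>2 + v\<^sup>2)\<bar> \<le> \<bar>arsinh (v / \<epsilon>)\<bar>"
proof -
  have tanh_le: "tanh s \<le> s" if "0 \<le> s" for s :: real
  proof -
    have "0 - tanh 0 \<le> s - tanh s"
    proof (rule DERIV_nonneg_imp_nondecreasing[OF that])
      fix x :: real
      have "((\<lambda>x. x - tanh x) has_real_derivative (tanh x)\<^sup>2) (at x)"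
        by (auto intro!: derivative_eq_intros)
      then show "\<exists>y. ((\<lambda>x. x - tanh x) has_real_derivative y) (at x) \<and> 0 \<le> y" by (intro exI conjI) auto
    qed
    then show ?thesis by simp
  qed
  define s where "s = arsinh (v / \<epsilon>)"
  have s: "sinh s = v / \<epsilon>" "cosh s = sqrt (\<epsilon>\<^sup>2 + v\<^sup>2) / \<epsilon>"
  proof -
    show "sinh s = v / \<epsilon>" by (simp add: s_def)
    have "cosh s = sqrt ((\<epsilon>\<^sup>2 + v\<^sup>2) / \<epsilon>\<^sup>2)" using assms by (simp add: s_def cosh_arsinh_real field_simps)
    then show "cosh s = sqrt (\<epsilon>\<^sup>2 + v\<^sup>2) / \<epsilon>" using assms by (simp add: real_sqrt_divide)
  qed
  have "v / sqrt (\<epsilon>\<^sup>2 + v\<^sup>2) = tanh s" unfolding tanh_def s using assms by simp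
  moreover have "\<bar>tanh s\<bar> \<le> \<bar>s\<bar>"
    using tanh_le[of s] tanh_le[of "- s"] by (cases "0 \<le> s") auto
  ultimately show ?thesis by (simp add: s_def)
qed

context elliptic_drift
begin

lemma K_measurable: "K \<in> lmeasurable"
  using K(1,3) by (simp add: lmeasurable_open)

lemma integral_const_K: "(LINT x|\<mu>. c) = c * measure lebesgue K"
  using fmeasurableD[OF K_measurable] by (simp add: measure_restrict_space)

lemma jet_norm_le_grad_norm:
  obtains P where "0 \<le> P" "\<And>f. f \<in> C1_compact K \<Longrightarrow> sqrt (l2_inner \<mu> (jet f) (jet f)) \<le> P * grad_norm f"
proof -
  obtain D where D: "0 \<le> D"
    "\<And>f. f \<in> C1_compact K \<Longrightarrow> (LINT x|\<mu>. (f x)\<^sup>2) \<le> D * (LINT x|\<mu>. (norm (grad f x))\<^sup>2)"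
    by (fact poincare[OF K])
  show ?thesis
  proof
    show "0 \<le> sqrt (D + 1)" using D(1) by simp
    fix f assume f: "f \<in> C1_compact K"
    have "l2_inner \<mu> (jet f) (jet f) \<le> (D + 1) * (LINT x|\<mu>. (norm (grad f x))\<^sup>2)"
      unfolding l2_inner_jet_self[OF K(1) f] using D(2)[OF f] by (simp add: distrib_right)
    then show "sqrt (l2_inner \<mu> (jet f) (jet f)) \<le> sqrt (D + 1) * grad_norm f"
      by (simp flip: real_sqrt_mult)
  qed
qed

lemma inner_jet_drift_adjoint:
  "l2_inner \<mu> (jet \<psi>) (drift_adjoint \<phi>) = (LINT x|\<mu>. (A x *v grad \<psi> x) \<bullet> grad \<phi> x + (B x \<bullet> grad \<psi> x) * \<phi> x)"
  by (simp add: l2_inner_def jet_def inner_drift_adjoint)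

text \<open>Testing with \<open>\<psi> = arctan (v / \<epsilon>) / \<epsilon>\<close> controls \<open>w = arsinh (v / \<epsilon>)\<close> independently of \<open>v\<close> and \<open>\<epsilon>\<close>:
  since \<open>\<nabla>\<psi> = \<nabla>v / (\<epsilon>\<^sup>2 + v\<^sup>2)\<close> and \<open>\<nabla>w = \<nabla>v / sqrt (\<epsilon>\<^sup>2 + v\<^sup>2)\<close>, the form evaluated at \<open>(\<psi>, v)\<close> is the form
  of the energy estimate for \<open>w\<close> with the bounded function \<open>h = v / sqrt (\<epsilon>\<^sup>2 + v\<^sup>2)\<close>.\<close>
lemma log_estimate:
  obtains W where "0 \<le> W"
    "\<And>v N \<epsilon>. v \<in> test_functions K \<Longrightarrow> 0 \<le> N \<Longrightarrow>
      (\<And>\<psi>. \<psi> \<in> test_functions K \<Longrightarrow>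
        l2_inner \<mu> (jet \<psi>) (drift_adjoint v) \<le> N * sqrt (l2_inner \<mu> (jet \<psi>) (jet \<psi>))) \<Longrightarrow>
      0 < \<epsilon> \<Longrightarrow> N \<le> \<epsilon> \<Longrightarrow> grad_norm (\<lambda>x. arsinh (v x / \<epsilon>)) \<le> W"
proof -
  obtain P where P: "0 \<le> P" "\<And>f. f \<in> C1_compact K \<Longrightarrow> sqrt (l2_inner \<mu> (jet f) (jet f)) \<le> P * grad_norm f"
    by (fact jet_norm_le_grad_norm)
  obtain C where C: "0 < C"
    and energy: "\<And>f h T. f \<in> C1_compact K \<Longrightarrow> continuous_on UNIV h \<Longrightarrow> (\<And>x. \<bar>h x\<bar> \<le> \<bar>f x\<bar>) \<Longrightarrow> 0 \<le> T \<Longrightarrow>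
      (LINT x|\<mu>. (A x *v grad f x) \<bullet> grad f x + (B x \<bullet> grad f x) * h x) \<le> T * grad_norm f \<Longrightarrow>
      grad_norm f \<le> C * (T + sqrt (LINT x|\<mu>. (h x)\<^sup>2))"
    by (fact energy_estimate)
  show ?thesis
  proof
    show "0 \<le> C * (P + sqrt (measure lebesgue K))" using C P(1) by simp
    fix v N \<epsilon>
    assume v: "v \<in> test_functions K" and N: "0 \<le> N" and \<epsilon>: "0 < \<epsilon>" "N \<le> \<epsilon>"
      and le: "\<And>\<psi>. \<psi> \<in> test_functions K \<Longrightarrow>
        l2_inner \<mu> (jet \<psi>) (drift_adjoint v) \<le> N * sqrt (l2_inner \<mu> (jet \<psi>) (jet \<psi>))"
    define w where "w x = arsinh (v x / \<epsilon>)" for x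
    define \<psi> where "\<psi> x = arctan (v x / \<epsilon>) / \<epsilon>" for x
    define q where "q x = sqrt (\<epsilon>\<^sup>2 + (v x)\<^sup>2)" for x
    define h where "h x = v x / q x" for x
    note v1 = test_imp_C1_compact[OF v]
    have q: "0 < q x" "(q x)\<^sup>2 = \<epsilon>\<^sup>2 + (v x)\<^sup>2" "\<epsilon> \<le> q x" for x
      using \<epsilon> by (auto simp: q_def add_pos_nonneg intro: real_le_rsqrt)
    have w: "w \<in> C1_compact K" unfolding w_def[abs_def] by (rule C1_compact_arsinh[OF v1 \<epsilon>(1)])
    have \<psi>: "\<psi> \<in> test_functions K" unfolding \<psi>_def[abs_def] by (rule test_arctan[OF v \<epsilon>(1)])
    note \<psi>1 = test_imp_C1_compact[OF \<psi>]
    have gw: "grad w x = (1 / q x) *\<^sub>R grad v x" for x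
      using C_k_arsinh(2)[OF test_functionsD(1)[OF v] \<epsilon>(1)]
      by (simp add: vec_eq_iff grad_nth w_def[abs_def] q_def)
    have g\<psi>: "grad \<psi> x = (1 / (q x)\<^sup>2) *\<^sub>R grad v x" for x
      using C_k_arctan(2)[OF test_functionsD(1)[OF v] \<epsilon>(1)]
      by (simp add: vec_eq_iff grad_nth \<psi>_def[abs_def] q(2))
    have hw: "\<bar>h x\<bar> \<le> \<bar>w x\<bar>" for x
      unfolding h_def w_def q_def by (rule quotient_le_arsinh[OF \<epsilon>(1)])
    have h1: "(h x)\<^sup>2 \<le> 1" for x
      using q(1)[of x] \<epsilon> by (simp add: h_def power_divide q(2) add_pos_nonneg)
    have qc: "continuous_on UNIV q"
      unfolding q_def by (intro continuous_intros C1_compact_continuous[OF v1])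
    have hc: "continuous_on UNIV h"
      unfolding h_def using q(1) by (intro continuous_intros C1_compact_continuous[OF v1] qc) (metis less_irrefl)
    have "(LINT x|\<mu>. (A x *v grad w x) \<bullet> grad w x + (B x \<bullet> grad w x) * h x) = l2_inner \<mu> (jet \<psi>) (drift_adjoint v)"
      unfolding inner_jet_drift_adjoint
      by (simp add: gw g\<psi> h_def matrix_vector_mult_scaleR power2_eq_square)
    also have "l2_inner \<mu> (jet \<psi>) (drift_adjoint v) \<le> N * sqrt (l2_inner \<mu> (jet \<psi>) (jet \<psi>))" by (rule le[OF \<psi>])
    also have "\<dots> \<le> N * (P * grad_norm \<psi>)" by (intro mult_left_mono P \<psi>1 N)
    \<comment> \<open>\<open>grad \<psi>\<close> is \<open>grad w / q\<close> with
      \<open>q \<ge> \<epsilon>\<close>. The resulting factor \<open>1 / \<epsilon>\<close> is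
      cancelled by \<open>N \<le> \<epsilon>\<close>, so the bound depends on neither.\<close>
    also have "\<dots> \<le> N * (P * (grad_norm w / \<epsilon>))"
    proof (intro mult_left_mono N P(1))
      have "(LINT x|\<mu>. (norm (grad \<psi> x))\<^sup>2) \<le> (LINT x|\<mu>. (norm (grad w x))\<^sup>2 / \<epsilon>\<^sup>2)"
      proof (intro integral_mono integrable_divide C1_compact_square_integral(2)[OF K(1)] w \<psi>1)
        fix x
        have "grad \<psi> x = (1 / q x) *\<^sub>R grad w x" by (simp add: gw g\<psi> power2_eq_square)
        then have "norm (grad \<psi> x) = norm (grad w x) / q x" using q(1)[of x] by simp
        also have "\<dots> \<le> norm (grad w x) / \<epsilon>" using q[of x] \<epsilon> by (intro divide_left_mono) auto
        finally have "(norm (grad \<psi> x))\<^sup>2 \<le> (norm (grad w x) / \<epsilon>)\<^sup>2" by (intro power_mono) auto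
        then show "(norm (grad \<psi> x))\<^sup>2 \<le> (norm (grad w x))\<^sup>2 / \<epsilon>\<^sup>2" by (simp add: power_divide)
      qed
      then have "grad_norm \<psi> \<le> sqrt ((LINT x|\<mu>. (norm (grad w x))\<^sup>2) / \<epsilon>\<^sup>2)" by (simp add: real_sqrt_le_mono)
      then show "grad_norm \<psi> \<le> grad_norm w / \<epsilon>" using \<epsilon> by (simp add: real_sqrt_divide)
    qed
    also have "\<dots> = (N / \<epsilon>) * (P * grad_norm w)" by simp
    also have "\<dots> \<le> 1 * (P * grad_norm w)"
      using \<epsilon> P(1) by (intro mult_right_mono) (auto simp: Bochner_Integration.integral_nonneg)
    finally have "(LINT x|\<mu>. (A x *v grad w x) \<bullet> grad w x + (B x \<bullet> grad w x) * h x) \<le> P * grad_norm w" by simp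
    then have "grad_norm w \<le> C * (P + sqrt (LINT x|\<mu>. (h x)\<^sup>2))"
      by (rule energy[OF w hc hw P(1)])
    also have "\<dots> \<le> C * (P + sqrt (measure lebesgue K))"
    proof -
      have "(LINT x|\<mu>. (h x)\<^sup>2) \<le> (LINT x|\<mu>. 1)"
      proof (rule integral_mono)
        obtain S where S: "compact S" "S \<subseteq> K" "\<And>x. x \<notin> S \<Longrightarrow> v x = 0" using C1_compact_support[OF v1] by metis
        show "integrable \<mu> (\<lambda>x. (h x)\<^sup>2)"
          by (rule integrable_lebesgue_on_compact_support[OF K(1) S(1,2)])
             (simp_all add: continuous_on_power continuous_on_subset[OF hc], simp add: h_def S(3))
        show "integrable \<mu> (\<lambda>x. 1 :: real)"
          using finite_measure.integrable_const[OF finite_measure_lebesgue_on[OF K_measurable]] by blast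
      qed (rule h1)
      then show ?thesis unfolding integral_const_K using C by (intro mult_left_mono add_left_mono real_sqrt_le_mono) auto
    qed
    finally show "grad_norm (\<lambda>x. arsinh (v x / \<epsilon>)) \<le> C * (P + sqrt (measure lebesgue K))" unfolding w_def .
  qed
qed

lemma drift_apriori:
  obtains C where "0 \<le> C"
    "\<And>v N. v \<in> test_functions K \<Longrightarrow> 0 \<le> N \<Longrightarrow>
      (\<And>\<psi>. \<psi> \<in> test_functions K \<Longrightarrow>
        l2_inner \<mu> (jet \<psi>) (drift_adjoint v) \<le> N * sqrt (l2_inner \<mu> (jet \<psi>) (jet \<psi>))) \<Longrightarrow>
      sqrt (l2_inner \<mu> (jet v) (jet v)) \<le> C * N"
proof -
  obtain P where P: "0 \<le> P" "\<And>f. f \<in> C1_compact K \<Longrightarrow> sqrt (l2_inner \<mu> (jet f) (jet f)) \<le> P * grad_norm f"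
    by (fact jet_norm_le_grad_norm)
  obtain D where D: "0 \<le> D"
    "\<And>f. f \<in> C1_compact K \<Longrightarrow> (LINT x|\<mu>. (f x)\<^sup>2) \<le> D * (LINT x|\<mu>. (norm (grad f x))\<^sup>2)"
    by (fact poincare[OF K])
  obtain C1 where C1: "0 < C1"
    and energy: "\<And>f h T. f \<in> C1_compact K \<Longrightarrow> continuous_on UNIV h \<Longrightarrow> (\<And>x. \<bar>h x\<bar> \<le> \<bar>f x\<bar>) \<Longrightarrow> 0 \<le> T \<Longrightarrow>
      (LINT x|\<mu>. (A x *v grad f x) \<bullet> grad f x + (B x \<bullet> grad f x) * h x) \<le> T * grad_norm f \<Longrightarrow>
      grad_norm f \<le> C1 * (T + sqrt (LINT x|\<mu>. (h x)\<^sup>2))"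
    by (fact energy_estimate)
  obtain W where W: "0 \<le> W"
    and log: "\<And>v N \<epsilon>. v \<in> test_functions K \<Longrightarrow> 0 \<le> N \<Longrightarrow>
      (\<And>\<psi>. \<psi> \<in> test_functions K \<Longrightarrow>
        l2_inner \<mu> (jet \<psi>) (drift_adjoint v) \<le> N * sqrt (l2_inner \<mu> (jet \<psi>) (jet \<psi>))) \<Longrightarrow>
      0 < \<epsilon> \<Longrightarrow> N \<le> \<epsilon> \<Longrightarrow> grad_norm (\<lambda>x. arsinh (v x / \<epsilon>)) \<le> W"
    by (fact log_estimate)
  \<comment> \<open>The energy estimate will give \<open>G \<le> 2 * C1\<^sup>2 *
    (\<epsilon>\<^sup>2 * P\<^sup>2 + X)\<close>; this factor reduces the contribution of
    \<open>X\<close> through the gradient to \<open>X / 4\<close>.\<close>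
  have c1: "0 < 1 / (8 * C1\<^sup>2)" using C1 by simp
  obtain C2 where C2: "0 \<le> C2"
    and small: "\<And>f E. f \<in> C1_compact K \<Longrightarrow> E \<in> sets borel \<Longrightarrow> E \<subseteq> K \<Longrightarrow>
      (LINT x|\<mu>. indicat_real E x * (f x)\<^sup>2) \<le>
      1 / (8 * C1\<^sup>2) * (LINT x|\<mu>. (norm (grad f x))\<^sup>2) + C2 * measure lborel E * (LINT x|\<mu>. (f x)\<^sup>2)"
    by (fact small_set_estimate[OF K(1,3) c1])
  define m where "m = measure lebesgue K"
  have m: "0 \<le> m" by (simp add: m_def)
  \<comment> \<open>Chebyshev for \<open>w = arsinh (v / \<epsilon>)\<close>, with Poincare and the
    bound \<open>W\<close>, gives \<open>L\<^sup>2\<close> times the measure of \<open>E\<close> at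
    most \<open>D * W\<^sup>2\<close>. Hence \<open>C2\<close> times that measure is at most 1/4,
    and together with the gradient term half of \<open>X\<close> is absorbed. The summand 1 keeps
    \<open>L\<close> positive in degenerate cases.\<close>
  define L where "L = 2 * sqrt (C2 * (D * W\<^sup>2)) + 1"
  have L: "0 < L" "4 * (C2 * (D * W\<^sup>2)) \<le> L\<^sup>2"
  proof -
    define r where "r = sqrt (C2 * (D * W\<^sup>2))"
    have r: "0 \<le> r" "r\<^sup>2 = C2 * (D * W\<^sup>2)" using C2 D(1) by (auto simp: r_def)
    show "0 < L" unfolding L_def r_def[symmetric] using r(1) by linarith
    show "4 * (C2 * (D * W\<^sup>2)) \<le> L\<^sup>2"
      unfolding L_def r_def[symmetric] r(2)[symmetric] using r(1) by (simp add: power2_eq_square algebra_simps)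
  qed
  \<comment> \<open>What is left after absorbing half of \<open>X\<close>, doubled: off
    \<open>E\<close> one has \<open>\<bar>v x\<bar> \<le> \<epsilon> * sinh L\<close>, and the
    gradient term leaves \<open>\<epsilon>\<^sup>2 * P\<^sup>2 / 4\<close>. Thus
    \<open>X \<le> Z * \<epsilon>\<^sup>2\<close>.\<close>
  define Z where "Z = 2 * ((sinh L)\<^sup>2 * m + P\<^sup>2 / 4)"
  have Z: "0 \<le> Z" using m by (simp add: Z_def)
  define C where "C = sqrt (Z + 2 * C1\<^sup>2 * (P\<^sup>2 + Z))"
  have est: "sqrt (l2_inner \<mu> (jet v) (jet v)) \<le> C * \<epsilon>"
    if v: "v \<in> test_functions K" and N: "0 \<le> N" and \<epsilon>: "0 < \<epsilon>" "N \<le> \<epsilon>"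
      and le: "\<And>\<psi>. \<psi> \<in> test_functions K \<Longrightarrow>
        l2_inner \<mu> (jet \<psi>) (drift_adjoint v) \<le> N * sqrt (l2_inner \<mu> (jet \<psi>) (jet \<psi>))" for v N \<epsilon>
  proof -
    note v1 = test_imp_C1_compact[OF v]
    define w where "w x = arsinh (v x / \<epsilon>)" for x
    have w: "w \<in> C1_compact K" unfolding w_def[abs_def] by (rule C1_compact_arsinh[OF v1 \<epsilon>(1)])
    define X where "X = (LINT x|\<mu>. (v x)\<^sup>2)"
    define G where "G = (LINT x|\<mu>. (norm (grad v x))\<^sup>2)"
    have XG: "0 \<le> X" "0 \<le> G" by (auto simp: X_def G_def)
    have G: "G \<le> 2 * C1\<^sup>2 * (\<epsilon>\<^sup>2 * P\<^sup>2 + X)"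
    proof -
      have "l2_inner \<mu> (jet v) (drift_adjoint v) \<le> N * (P * grad_norm v)"
        using le[OF v] mult_left_mono[OF P(2)[OF v1] N] by linarith
      then have "(LINT x|\<mu>. (A x *v grad v x) \<bullet> grad v x + (B x \<bullet> grad v x) * v x) \<le> (N * P) * grad_norm v"
        by (simp add: inner_jet_drift_adjoint mult.assoc)
      from energy[OF v1 C1_compact_continuous(1)[OF v1] order_refl _ this]
      have "sqrt G \<le> C1 * (N * P + sqrt X)" using N P(1) by (simp add: G_def X_def)
      also have "\<dots> \<le> C1 * (\<epsilon> * P + sqrt X)" using C1 \<epsilon> P(1) by (intro mult_left_mono add_right_mono mult_right_mono) auto
      finally have "(sqrt G)\<^sup>2 \<le> (C1 * (\<epsilon> * P + sqrt X))\<^sup>2" using XG by (intro power_mono) auto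
      also have "\<dots> = C1\<^sup>2 * (\<epsilon> * P + sqrt X)\<^sup>2" by (simp add: power_mult_distrib)
      also have "\<dots> \<le> C1\<^sup>2 * (2 * (\<epsilon>\<^sup>2 * P\<^sup>2 + X))"
      proof (intro mult_left_mono)
        have "(\<epsilon> * P + sqrt X)\<^sup>2 \<le> 2 * ((\<epsilon> * P)\<^sup>2 + (sqrt X)\<^sup>2)"
          using sum_squares_bound[of "\<epsilon> * P" "sqrt X"] by (simp add: power2_sum)
        then show "(\<epsilon> * P + sqrt X)\<^sup>2 \<le> 2 * (\<epsilon>\<^sup>2 * P\<^sup>2 + X)" using XG by (simp add: power_mult_distrib)
      qed simp
      finally have "(sqrt G)\<^sup>2 \<le> C1\<^sup>2 * (2 * (\<epsilon>\<^sup>2 * P\<^sup>2 + X))" .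
      then show ?thesis
        unfolding real_sqrt_pow2[OF XG(2)] by (simp only: mult.assoc mult.left_commute[of "C1\<^sup>2" 2])
    qed
    define E where "E = {x. L < \<bar>w x\<bar>}"
    have wc: "continuous_on UNIV w" by (rule C1_compact_continuous[OF w])
    have "open E" unfolding E_def by (intro open_Collect_less continuous_intros wc)
    then have E: "E \<in> sets borel" by simp
    have EK: "E \<subseteq> K"
    proof
      fix x assume "x \<in> E"
      then have "w x \<noteq> 0" using L(1) by (auto simp: E_def)
      then show "x \<in> K" using C1_compact_support[OF w] by (metis subsetD)
    qed
    have mE: "L\<^sup>2 * measure lborel E \<le> D * W\<^sup>2"
    proof -
      have iE: "integrable \<mu> (\<lambda>x. indicat_real E x)"
        using E EK K_measurable emeasure_bounded_finite[OF bounded_subset[OF K(3) EK]]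
        by (intro integrable_real_indicator) (auto simp: sets_restrict_space emeasure_restrict_space)
      have "L\<^sup>2 * measure lborel E = (LINT x|\<mu>. L\<^sup>2 * indicat_real E x)"
        using E EK K(1) by (simp add: measure_restrict_space Int_absorb2)
      also have "\<dots> \<le> (LINT x|\<mu>. (w x)\<^sup>2)"
      proof (intro integral_mono integrable_mult_right iE C1_compact_square_integral[OF K(1) w])
        fix x
        have "L\<^sup>2 \<le> \<bar>w x\<bar>\<^sup>2" if "x \<in> E" using that L(1) by (intro power_mono) (auto simp: E_def)
        then show "L\<^sup>2 * indicat_real E x \<le> (w x)\<^sup>2" by (cases "x \<in> E") auto
      qed
      also have "\<dots> \<le> D * (grad_norm w)\<^sup>2" using D(2)[OF w] by (simp add: Bochner_Integration.integral_nonneg)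
      also have "\<dots> \<le> D * W\<^sup>2"
        using log[OF v N le \<epsilon>] D(1) unfolding w_def[symmetric]
        by (intro mult_left_mono power_mono) (auto simp: Bochner_Integration.integral_nonneg)
      finally show ?thesis .
    qed
    have CE: "C2 * measure lborel E \<le> 1 / 4"
    proof -
      have "L\<^sup>2 * (C2 * measure lborel E) \<le> C2 * (D * W\<^sup>2)" using mult_left_mono[OF mE C2] by (simp add: mult_ac)
      also have "\<dots> \<le> L\<^sup>2 * (1 / 4)" using L(2) by simp
      finally show ?thesis using L(1) by (simp only: mult_le_cancel_left_pos zero_less_power)
    qed
    have iEv: "integrable \<mu> (\<lambda>x. indicat_real E x * (v x)\<^sup>2)"
    proof (rule Bochner_Integration.integrable_bound[OF C1_compact_square_integral(1)[OF K(1) v1]])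
      have "(\<lambda>x. indicat_real E x * (v x)\<^sup>2) \<in> borel_measurable borel"
        using E C1_compact_borel(1)[OF v1] by measurable
      then show "(\<lambda>x. indicat_real E x * (v x)\<^sup>2) \<in> borel_measurable \<mu>"
        by (intro measurable_restrict_space1 measurable_completion) simp
    qed (auto simp: indicator_def)
    have ic: "integrable \<mu> (\<lambda>x. c)" for c :: real
      using finite_measure.integrable_const[OF finite_measure_lebesgue_on[OF K_measurable]] by blast
    have "X \<le> (LINT x|\<mu>. indicat_real E x * (v x)\<^sup>2 + (\<epsilon> * sinh L)\<^sup>2)"
      unfolding X_def
    proof (intro integral_mono Bochner_Integration.integrable_add iEv ic C1_compact_square_integral[OF K(1) v1])
      fix x
      show "(v x)\<^sup>2 \<le> indicat_real E x * (v x)\<^sup>2 + (\<epsilon> * sinh L)\<^sup>2"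
      proof (cases "x \<in> E")
        case False
        then have "\<bar>w x\<bar> \<le> L" by (simp add: E_def)
        then have "sinh \<bar>w x\<bar> \<le> sinh L" by (rule sinh_real_le_iff[THEN iffD2])
        then have "\<bar>v x / \<epsilon>\<bar> \<le> sinh L" by (simp add: w_def)
        then have "\<bar>v x\<bar> \<le> \<epsilon> * sinh L" using \<epsilon> by (simp add: abs_divide pos_divide_le_eq mult.commute)
        then have "\<bar>v x\<bar>\<^sup>2 \<le> (\<epsilon> * sinh L)\<^sup>2" by (intro power_mono) auto
        then show ?thesis using False by simp
      qed simp
    qed
    also have "\<dots> = (LINT x|\<mu>. indicat_real E x * (v x)\<^sup>2) + (\<epsilon> * sinh L)\<^sup>2 * m"
      unfolding m_def integral_const_K[symmetric] by (intro Bochner_Integration.integral_add iEv ic)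
    also have "\<dots> \<le> 1 / (8 * C1\<^sup>2) * G + C2 * measure lborel E * X + (\<epsilon> * sinh L)\<^sup>2 * m"
      unfolding G_def X_def by (intro add_right_mono small v1 E EK)
    also have "\<dots> \<le> 1 / (8 * C1\<^sup>2) * (2 * C1\<^sup>2 * (\<epsilon>\<^sup>2 * P\<^sup>2 + X)) + 1 / 4 * X + (\<epsilon> * sinh L)\<^sup>2 * m"
      using XG CE by (intro add_mono mult_left_mono mult_right_mono G) auto
    also have "\<dots> = (\<epsilon>\<^sup>2 * P\<^sup>2 + X) / 4 + 1 / 4 * X + (\<epsilon> * sinh L)\<^sup>2 * m"
      using C1 by simp
    finally have "X \<le> 2 * ((\<epsilon> * sinh L)\<^sup>2 * m) + \<epsilon>\<^sup>2 * P\<^sup>2 / 2" by (simp add: field_simps)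
    also have "\<dots> = Z * \<epsilon>\<^sup>2"
      unfolding Z_def by (simp add: power_mult_distrib algebra_simps)
    finally have X: "X \<le> Z * \<epsilon>\<^sup>2" .
    have "2 * C1\<^sup>2 * (\<epsilon>\<^sup>2 * P\<^sup>2 + X) \<le> 2 * C1\<^sup>2 * (\<epsilon>\<^sup>2 * P\<^sup>2 + Z * \<epsilon>\<^sup>2)"
      by (intro mult_left_mono add_left_mono X) simp
    then have "l2_inner \<mu> (jet v) (jet v) \<le> Z * \<epsilon>\<^sup>2 + 2 * C1\<^sup>2 * (\<epsilon>\<^sup>2 * P\<^sup>2 + Z * \<epsilon>\<^sup>2)"
      using X G unfolding l2_inner_jet_self[OF K(1) v1] X_def[symmetric] G_def[symmetric] by linarith
    also have "\<dots> = (Z + 2 * C1\<^sup>2 * (P\<^sup>2 + Z)) * \<epsilon>\<^sup>2" by (simp add: algebra_simps)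
    finally have "sqrt (l2_inner \<mu> (jet v) (jet v)) \<le> sqrt ((Z + 2 * C1\<^sup>2 * (P\<^sup>2 + Z)) * \<epsilon>\<^sup>2)" by (rule real_sqrt_le_mono)
    then show ?thesis using \<epsilon> by (simp add: C_def real_sqrt_mult)
  qed
  show ?thesis
  proof
    show C: "0 \<le> C" using Z by (simp add: C_def)
    fix v N assume v: "v \<in> test_functions K" and N: "0 \<le> N"
      and le: "\<And>\<psi>. \<psi> \<in> test_functions K \<Longrightarrow>
        l2_inner \<mu> (jet \<psi>) (drift_adjoint v) \<le> N * sqrt (l2_inner \<mu> (jet \<psi>) (jet \<psi>))"
    show "sqrt (l2_inner \<mu> (jet v) (jet v)) \<le> C * N"
    \<comment> \<open>\<open>est\<close> needs a positive \<epsilon>, while \<open>N\<close> may be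
      0; it is applied with \<open>N + e / (C + 1)\<close>, whose excess over \<open>N\<close> costs
      at most \<open>e\<close>.\<close>
    proof (rule field_le_epsilon)
      fix e :: real assume e: "0 < e"
      have "sqrt (l2_inner \<mu> (jet v) (jet v)) \<le> C * (N + e / (C + 1))"
        by (rule est[OF v N _ _ le]) (use N C e in \<open>auto simp: add_nonneg_pos\<close>)
      also have "\<dots> \<le> C * N + e" using C e by (simp add: field_simps)
      finally show "sqrt (l2_inner \<mu> (jet v) (jet v)) \<le> C * N + e" .
    qed
  qed
qed

end

section \<open>Existence for both equations\<close>

context elliptic_drift
begin

lemma matrix_grad_comb:
  assumes "\<phi> \<in> test_functions K" "\<psi> \<in> test_functions K"
  shows "grad (\<lambda>x. \<phi> x + c * \<psi> x) x v* A x = grad \<phi> x v* A x + c *\<^sub>R (grad \<psi> x v* A x)"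
  unfolding test_comb_grad[OF assms]
  by (simp add: vec_eq_iff vector_matrix_mult_def sum.distrib sum_distrib_left algebra_simps)

lemma ex_weak_solution_L1:
  assumes "L2 K g" "\<And>i. L2 K (f i)"
  shows "\<exists>u. weak_solution_L1 K A B g f u"
proof -
  obtain C where C: "0 \<le> C"
    and apriori: "\<And>v N. v \<in> test_functions K \<Longrightarrow> 0 \<le> N \<Longrightarrow>
      (\<And>\<psi>. \<psi> \<in> test_functions K \<Longrightarrow>
        l2_inner \<mu> (jet \<psi>) (drift_adjoint v) \<le> N * sqrt (l2_inner \<mu> (jet \<psi>) (jet \<psi>))) \<Longrightarrow>
      sqrt (l2_inner \<mu> (jet v) (jet v)) \<le> C * N"
    by (fact drift_apriori)
  have comb: "drift_adjoint (\<lambda>x. \<phi> x + c * \<psi> x) x = drift_adjoint \<phi> x + c *\<^sub>R drift_adjoint \<psi> x"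
    if "\<phi> \<in> test_functions K" "\<psi> \<in> test_functions K" for \<phi> \<psi> c x
    using matrix_grad_comb[OF that] by (simp add: drift_adjoint_def algebra_simps)
  show ?thesis
  proof (rule weak_solvability[where f = f, OF K(1) drift_adjoint_square_integrable comb C apriori assms])
    fix u Du assume "u \<in> W12_0 K" "has_W12_gradient K u Du"
      "\<And>\<phi>. \<phi> \<in> test_functions K \<Longrightarrow> (LINT x|\<mu>. (u x, Du x) \<bullet> drift_adjoint \<phi> x) =
        (LINT x|\<mu>. g x * \<phi> x - (\<Sum>i\<in>UNIV. f i x * partial i \<phi> x))"
    then show ?thesis unfolding weak_solution_L1_def inner_drift_adjoint by blast
  qed
qed

definition divergence_adjoint :: "(real^'n \<Rightarrow> real) \<Rightarrow> real^'n \<Rightarrow> real \<times> (real^'n)" where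
  "divergence_adjoint \<phi> x = (B x \<bullet> grad \<phi> x, grad \<phi> x v* A x)"

lemma inner_divergence_adjoint:
  "(v, G) \<bullet> divergence_adjoint \<phi> x = (A x *v G) \<bullet> grad \<phi> x + v * (B x \<bullet> grad \<phi> x)"
  unfolding matrix_vector_inner by (simp add: divergence_adjoint_def inner_commute)

text \<open>The distance to the boundary has a positive minimum on a compact subset.
  \<open>B\<close> may fail to be square integrable on \<open>K\<close>, but
  \<open>B \<bullet> grad \<phi>\<close> only sees the support of \<open>\<phi>\<close>.\<close>

lemma B_bounded_on_compact:
  assumes "compact S" "S \<subseteq> K"
  obtains b where "\<And>x. x \<in> S \<Longrightarrow> norm (B x) \<le> b"
proof (cases "S = {}")
  case False
  have "continuous_on S (\<lambda>x. infdist x (frontier K))" by (intro continuous_intros)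
  then obtain y where y: "y \<in> S" "\<And>x. x \<in> S \<Longrightarrow> infdist y (frontier K) \<le> infdist x (frontier K)"
    using continuous_attains_inf[OF assms(1) False] by blast
  define d where "d = infdist y (frontier K) powr (1 - \<beta>)"
  have y0: "0 < infdist y (frontier K)" using infdist_frontier(2)[OF K(1,3)] y(1) assms(2) by blast
  then have d: "0 < d" by (simp add: d_def)
  have "norm (B x) \<le> M / d" if x: "x \<in> S" for x
  proof -
    have "norm (B x) * d \<le> norm (B x) * infdist x (frontier K) powr (1 - \<beta>)"
      unfolding d_def using y(2)[OF x] y0 \<beta> by (intro mult_left_mono powr_mono2) auto
    also have "\<dots> \<le> M" using B_bound x assms(2) by blast
    finally show ?thesis using d by (simp add: pos_le_divide_eq)
  qed
  then show ?thesis by (rule that)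
qed (use that in blast)

lemma divergence_adjoint_square_integrable:
  assumes "\<phi> \<in> test_functions K"
  shows "square_integrable \<mu> (divergence_adjoint \<phi>)"
proof -
  note \<phi> = test_imp_C1_compact[OF assms]
  note g = C1_compact_square_integrable(2)[OF K(1) \<phi>]
  obtain S where S: "compact S" "S \<subseteq> K" "\<And>x. x \<notin> S \<Longrightarrow> grad \<phi> x = 0"
    using C1_compact_support[OF \<phi>] by metis
  obtain b where b: "\<And>x. x \<in> S \<Longrightarrow> norm (B x) \<le> b" using B_bounded_on_compact[OF S(1,2)] by blast
  have "square_integrable \<mu> (\<lambda>x. B x \<bullet> grad \<phi> x)"
    unfolding square_integrable_def
  proof
    show m: "(\<lambda>x. B x \<bullet> grad \<phi> x) \<in> borel_measurable \<mu>"
      using B_measurable g[THEN square_integrable_measurable] by measurable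
    show "integrable \<mu> (\<lambda>x. (norm (B x \<bullet> grad \<phi> x))\<^sup>2)"
    proof (rule Bochner_Integration.integrable_bound)
      show "integrable \<mu> (\<lambda>x. b\<^sup>2 * (norm (grad \<phi> x))\<^sup>2)" using g by (simp add: square_integrable_def)
      show "(\<lambda>x. (norm (B x \<bullet> grad \<phi> x))\<^sup>2) \<in> borel_measurable \<mu>" using m by measurable
      have "(B x \<bullet> grad \<phi> x)\<^sup>2 \<le> b\<^sup>2 * (norm (grad \<phi> x))\<^sup>2" for x
      proof (cases "x \<in> S")
        case True
        have "\<bar>B x \<bullet> grad \<phi> x\<bar> \<le> norm (B x) * norm (grad \<phi> x)" by (rule Cauchy_Schwarz_ineq2)
        also have "\<dots> \<le> b * norm (grad \<phi> x)" by (intro mult_right_mono b True) simp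
        finally have "\<bar>B x \<bullet> grad \<phi> x\<bar>\<^sup>2 \<le> (b * norm (grad \<phi> x))\<^sup>2" by (intro power_mono) auto
        then show ?thesis by (simp add: power_mult_distrib)
      qed (simp add: S(3))
      then show "AE x in \<mu>. norm ((norm (B x \<bullet> grad \<phi> x))\<^sup>2) \<le> norm (b\<^sup>2 * (norm (grad \<phi> x))\<^sup>2)" by simp
    qed
  qed
  then show ?thesis
    unfolding divergence_adjoint_def[abs_def] by (intro square_integrable_Pair square_integrable_vector_matrix g)
qed

text \<open>Since \<open>\<phi>\<^sup>2\<close> is a test function, \<open>\<integral> \<phi> B \<bullet> \<nabla>\<phi> = \<integral> B \<bullet> \<nabla>(\<phi>\<^sup>2) / 2 = - \<integral> d \<phi>\<^sup>2 / 2 \<ge> 0\<close>.\<close>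
lemma divergence_coercive:
  assumes d: "has_weak_divergence K B d" "\<And>x. x \<in> K \<Longrightarrow> d x \<le> 0" and test: "\<phi> \<in> test_functions K"
  shows "lam * (grad_norm \<phi>)\<^sup>2 \<le> l2_inner \<mu> (jet \<phi>) (divergence_adjoint \<phi>)"
proof -
  note \<phi> = test_imp_C1_compact[OF test]
  have "grad (\<lambda>x. \<phi> x * \<phi> x) x = (2 * \<phi> x) *\<^sub>R grad \<phi> x" for x
    using test_functionsD(1)[OF test, of 1] by (simp add: vec_eq_iff grad_nth partial_mult)
  then have "(LINT x|\<mu>. 2 * (\<phi> x * (B x \<bullet> grad \<phi> x))) = (LINT x|\<mu>. B x \<bullet> grad (\<lambda>x. \<phi> x * \<phi> x) x)"
    by (simp add: mult.assoc)
  also have "\<dots> = - (LINT x|\<mu>. d x * (\<phi> x * \<phi> x))"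
    using d(1) test_mult[OF test test] unfolding has_weak_divergence_def by blast
  also have "\<dots> = (LINT x|\<mu>. - (d x * (\<phi> x * \<phi> x)))" by simp
  also have "\<dots> \<ge> 0"
    using d(2) by (intro Bochner_Integration.integral_nonneg) (auto simp: mult_nonpos_nonneg)
  finally have pos: "0 \<le> (LINT x|\<mu>. \<phi> x * (B x \<bullet> grad \<phi> x))" by simp
  have "integrable \<mu> (\<lambda>x. \<phi> x * (B x \<bullet> grad \<phi> x))"
    using square_integrable_inner[OF drift_square_integrable[OF \<phi> C1_compact_continuous(1)[OF \<phi>] order_refl]
        C1_compact_square_integrable(2)[OF K(1) \<phi>]] by simp
  then have "l2_inner \<mu> (jet \<phi>) (divergence_adjoint \<phi>) =
      (LINT x|\<mu>. (A x *v grad \<phi> x) \<bullet> grad \<phi> x) + (LINT x|\<mu>. \<phi> x * (B x \<bullet> grad \<phi> x))"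
    using A_energy(1)[OF \<phi>] by (simp add: l2_inner_def jet_def inner_divergence_adjoint)
  then show ?thesis using pos A_energy(2)[OF \<phi>] by linarith
qed

lemma ex_weak_solution_L1T:
  assumes d: "has_weak_divergence K B d" "\<And>x. x \<in> K \<Longrightarrow> d x \<le> 0"
    and gf: "L2 K g" "\<And>i. L2 K (f i)"
  shows "\<exists>v. weak_solution_L1T K A B g f v"
proof -
  obtain P where P: "0 \<le> P" "\<And>f. f \<in> C1_compact K \<Longrightarrow> sqrt (l2_inner \<mu> (jet f) (jet f)) \<le> P * grad_norm f"
    by (fact jet_norm_le_grad_norm)
  \<comment> \<open>Coercivity gives \<open>lam * n\<^sup>2 \<le> N * P * n\<close>, hence
    \<open>n \<le> N * P / lam\<close>; passing from the gradient to the full jet norm costs another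
    factor \<open>P\<close>.\<close>
  have C: "0 \<le> P\<^sup>2 / lam" using lam by simp
  have apriori: "sqrt (l2_inner \<mu> (jet v) (jet v)) \<le> P\<^sup>2 / lam * N"
    if v: "v \<in> test_functions K" and N: "0 \<le> N"
      and le: "\<And>\<psi>. \<psi> \<in> test_functions K \<Longrightarrow>
        l2_inner \<mu> (jet \<psi>) (divergence_adjoint v) \<le> N * sqrt (l2_inner \<mu> (jet \<psi>) (jet \<psi>))" for v N
  proof -
    define n where "n = grad_norm v"
    have n: "0 \<le> n" by (simp add: n_def Bochner_Integration.integral_nonneg)
    have y: "sqrt (l2_inner \<mu> (jet v) (jet v)) \<le> P * n"
      unfolding n_def by (rule P(2)[OF test_imp_C1_compact[OF v]])
    have "lam * n\<^sup>2 \<le> N * sqrt (l2_inner \<mu> (jet v) (jet v))"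
      using divergence_coercive[OF d v] le[OF v] unfolding n_def by linarith
    also have "\<dots> \<le> N * (P * n)" by (intro mult_left_mono y N)
    finally have "n * (lam * n) \<le> n * (N * P)" by (simp add: power2_eq_square mult_ac)
    then have "lam * n \<le> N * P"
      using n N P(1) by (cases "n = 0") (auto simp: mult_le_cancel_left)
    then have "P * n \<le> P * (N * P / lam)" using lam P(1) by (intro mult_left_mono) (auto simp: field_simps)
    with y show ?thesis by (simp add: power2_eq_square mult_ac)
  qed
  have comb: "divergence_adjoint (\<lambda>x. \<phi> x + c * \<psi> x) x = divergence_adjoint \<phi> x + c *\<^sub>R divergence_adjoint \<psi> x"
    if "\<phi> \<in> test_functions K" "\<psi> \<in> test_functions K" for \<phi> \<psi> c x
    unfolding divergence_adjoint_def using matrix_grad_comb[OF that] test_comb_grad[OF that]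
    by (simp add: inner_add_right)
  show ?thesis
  proof (rule weak_solvability[where f = f, OF K(1) divergence_adjoint_square_integrable comb C apriori gf])
    fix v Dv assume "v \<in> W12_0 K" "has_W12_gradient K v Dv"
      "\<And>\<phi>. \<phi> \<in> test_functions K \<Longrightarrow> (LINT x|\<mu>. (v x, Dv x) \<bullet> divergence_adjoint \<phi> x) =
        (LINT x|\<mu>. g x * \<phi> x - (\<Sum>i\<in>UNIV. f i x * partial i \<phi> x))"
    then show ?thesis unfolding weak_solution_L1T_def inner_divergence_adjoint by blast
  qed
qed

end

theorem theorem4:
  fixes K :: "(real^'n::finite) set"
    and \<beta> M lam Lam :: real
    and A :: "real^'n \<Rightarrow> real^'n^'n"
    and B :: "real^'n \<Rightarrow> real^'n"
    and g :: "real^'n \<Rightarrow> real"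
    and f :: "'n \<Rightarrow> real^'n \<Rightarrow> real"
    and \<delta> :: "real^'n \<Rightarrow> real"
  defines "\<delta> \<equiv> \<lambda>x. infdist x (frontier K)"
  assumes "CARD('n) \<ge> 3"
    and "open K" and "K \<noteq> {}" and "convex K" and "bounded K"
    and "0 < \<beta>" and "\<beta> < 1" and "0 < M" and "0 < lam" and "lam \<le> Lam"
    and "A \<in> borel_measurable (lebesgue_on K)"
    and "\<And>x \<eta>. x \<in> K \<Longrightarrow> \<eta> \<noteq> 0 \<Longrightarrow>
           (\<Sum>i\<in>UNIV. \<Sum>j\<in>UNIV. A x $ i $ j * \<eta> $ i * \<eta> $ j) \<ge> lam * (norm \<eta>)\<^sup>2"
    and "\<And>x \<eta> \<psi>. x \<in> K \<Longrightarrow> \<eta> \<noteq> 0 \<Longrightarrow> \<psi> \<noteq> 0 \<Longrightarrow>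
           \<bar>\<Sum>i\<in>UNIV. \<Sum>j\<in>UNIV. A x $ i $ j * \<eta> $ i * \<psi> $ j\<bar> \<le> Lam * norm \<eta> * norm \<psi>"
    and "B \<in> borel_measurable (lebesgue_on K)"
    and "\<And>x. x \<in> K \<Longrightarrow> norm (B x) * \<delta> x powr (1 - \<beta>) \<le> M"
    and "L2 K g" and "\<And>i. L2 K (f i)"
  shows "(\<exists>u. weak_solution_L1 K A B g f u) \<and>
    ((\<exists>d. has_weak_divergence K B d \<and>
          (\<forall>x\<in>K. - (M\<^sup>2 / \<delta> x powr (2 - 2 * \<beta>)) \<le> d x \<and> d x \<le> 0)) \<longrightarrow>
      (\<exists>v. weak_solution_L1T K A B g f v))"
proof -
  have form: "(A x *v \<psi>) \<bullet> \<eta> = (\<Sum>i\<in>UNIV. \<Sum>j\<in>UNIV. A x $ i $ j * \<eta> $ i * \<psi> $ j)" for x \<eta> \<psi>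
    by (simp add: inner_vec_def matrix_vector_mult_def sum_distrib_left sum_distrib_right mult_ac)
  \<comment> \<open>The hypotheses on \<open>A\<close> exclude zero vectors; for these both sides of
    the locale's inequalities vanish.\<close>
  interpret elliptic_drift K A B \<beta> M lam Lam
  proof
    show "lam * (norm \<eta>)\<^sup>2 \<le> (A x *v \<eta>) \<bullet> \<eta>" if "x \<in> K" for x \<eta>
      using assms(13)[OF that, of \<eta>] unfolding form by (cases "\<eta> = 0") auto
    show "\<bar>(A x *v \<psi>) \<bullet> \<eta>\<bar> \<le> Lam * norm \<eta> * norm \<psi>" if "x \<in> K" for x \<eta> \<psi>
      using assms(14)[OF that, of \<eta> \<psi>] unfolding form by (cases "\<eta> = 0 \<or> \<psi> = 0") auto
    show "norm (B x) * infdist x (frontier K) powr (1 - \<beta>) \<le> M" if "x \<in> K" for x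
      using assms(16)[OF that] by (simp add: \<delta>_def)
  qed (rule assms)+
  show ?thesis
    using ex_weak_solution_L1[where f = f, OF assms(17,18)] ex_weak_solution_L1T[where f = f, OF _ _ assms(17,18)] by blast
qed

end
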